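(* In the setting of random uniformly expanding maps described in the context, assume (LY), (Min) and (Dec). Let $\alpha\in(0,2)$, let $x_0\in[0,1]\setminus\mathcal{D}$ be non-recurrent, let $\phi_{x_0}(x)=|x-x_0|^{-1/\alpha}$, let $J\in\mathcal{J}$ and $A_n:=\phi_{x_0}^{-1}(b_nJ)$. Then for $\mathbb{P}$-a.e. $\omega\in\Omega$ and all $0\le s<t$, $$\lim_{n\to\infty}\nu^{\sigma^{\lfloor ns\rfloor}\omega}\Big(R_{A_n}(\sigma^{\lfloor ns\rfloor}\omega)>\lfloor n(t-s)\rfloor\Big)=e^{-(t-s)\Pi_\alpha(J)}.$$
   Context: $m$ is Lebesgue measure on $[0,1]$; $\mathrm{Var}$ is total variation; $\mathrm{BV}$ is the space of functions of bounded variation on $[0,1]$ with $\|f\|_{\mathrm{BV}}=\mathrm{Var}(f)+\|f\|_{L^1(m)}$. Random uniformly expanding maps. $\mathcal{S}=\{T_1,\dots,T_q\}$ is a finite collection of maps $[0,1]\to[0,1]$. For each $T\in\mathcal{S}$ there is a finite partition $\mathcal{A}_T$ of $[0,1]$ into intervals such that for each $I\in\mathcal{A}_T$, $T|_I$ extends continuously to a strictly monotonic $C^2$ function on $\bar I$, and $\inf_{I\in\mathcal{A}_T}\inf_{x\in\bar I}|T'(x)|>1$. $\Omega=\{1,\dots,q\}^{\mathbb{Z}}$, $\sigma$ is the left shift, and $\mathbb{P}$ is the Bernoulli (product) measure of a probability vector $(p_1,\dots,p_q)$. Put $T_\omega:=T_{\omega_0}$, $T_\omega^n:=T_{\sigma^{n-1}\omega}\circ\cdots\circ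 T_\omega$, $T_\omega^0=\mathrm{id}$; $\mathcal{A}_\omega:=\mathcal{A}_{T_\omega}$, $\mathcal{A}_\omega^n:=\bigvee_{k=0}^{n-1}(T_\omega^k)^{-1}(\mathcal{A}_{\sigma^k\omega})$, and $\mathcal{D}:=\bigcup_{n\ge0}\bigcup_{\omega\in\Omega}\partial\mathcal{A}_\omega^n$ (all partition endpoints). $P_\omega$ is the transfer operator of $T_\omega$ with respect to $m$: $\int(\varphi\circ T_\omega)\psi\,dm=\int\varphi\,P_\omega\psi\,dm$ for $\varphi\in L^\infty(m),\psi\in L^1(m)$; $P_\omega^n:=P_{\sigma^{n-1}\omega}\circ\cdots\circ P_\omega$. Conditions: (LY) there exist $r\ge1$, $M>0$, $D>0$, $\rho\in(0,1)$ such that for all $\omega\in\Omega$ and $f\in\mathrm{BV}$: $\|P_\omega f\|_{\mathrm{BV}}\le M\|f\|_{\mathrm{BV}}$ and $\mathrm{Var}(P_\omega^rf)\le\rho\,\mathrm{Var}(f)+D\|f\|_{L^1(m)}$. (Dec) there exist $C>0$, $\theta\in(0,1)$ such that for all $n\ge1$, $\omega\in\Omega$ and $f\in\mathrm{BV}$ with $\int f\,dm=0$: $\|P_\omega^nf\|_{\mathrm{BV}}\le C\theta^n\|f\|_{\mathrm{BV}}$. (Min) there exists $c>0$ such that $\inf_{x\in[0,1]}(P_\omega^n\mathbf{1})(x)\ge c$ for all $n\ge1$, $\omega\in\Omega$. Under these conditions $h_\omega:=\lim_{n}P^n_{\sigma^{-n}\omega}\mathbf{1}$ exists in $\mathrm{BV}$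 and $P_\omega h_\omega=h_{\sigma\omega}$. The sample measures are $d\nu^\omega=h_\omega\,dm$, and the stationary measure on $[0,1]$ is $\nu(A)=\int_\Omega\nu^\omega(A)\,d\mathbb{P}(\omega)$. A point $x_0\in[0,1]$ is non-recurrent if for $\mathbb{P}$-a.e. $\omega$, $T_\omega^n(x_0)\ne x_0$ for all $n\ge1$. $(b_n)$ is a sequence of positive reals with $\lim_nn\,\nu(\phi_{x_0}>b_n)=1$. $\mathcal{J}$ is the family of all finite unions of intervals $(x,y]$ with $-\infty\le x<y\le\infty$ and $0\notin[x,y]$. $\Pi_\alpha(dx)=\alpha x^{-\alpha-1}dx$ on $(0,\infty)$ (and zero on $(-\infty,0)$). For measurable $U\subset[0,1]$, the hitting time is $R_U(\omega)(x):=\inf\{k\ge1:T_\omega^k(x)\in U\}$. *)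

theory Defs
  imports "HOL-Probability.Probability"
begin

definition leb01 :: "real measure" where
  "leb01 = restrict_space lborel {0..1}"

text \<open>
  The transfer operator below is determined only up to null sets, so functions on \<open>[0,1]\<close> are
  treated as representatives of their a.e.-classes. Accordingly, the total variation of a class
  is the infimum of the pointwise variations of its representatives.
\<close>

definition pointwise_variation :: "(real \<Rightarrow> real) \<Rightarrow> ennreal" where
  "pointwise_variation f =
     (SUP xs \<in> {xs. sorted xs \<and> set xs \<subseteq> {0..1}}.
        \<Sum>i<length xs - 1. ennreal \<bar>f (xs ! Suc i) - f (xs ! i)\<bar>)"

definition Var :: "(real \<Rightarrow> real) \<Rightarrow> ennreal" where
  "Var f = (INF g \<in> {g. AE x in leb01. g x = f x}. pointwise_variation g)"

definition L1_norm :: "(real \<Rightarrow> real) \<Rightarrow> ennreal" where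
  "L1_norm f = (\<integral>\<^sup>+x. ennreal \<bar>f x\<bar> \<partial>leb01)"

definition BV :: "(real \<Rightarrow> real) set" where
  "BV = {f. integrable leb01 f \<and> Var f < \<infinity>}"

definition BV_norm :: "(real \<Rightarrow> real) \<Rightarrow> ennreal" where
  "BV_norm f = Var f + L1_norm f"


text \<open>
  In the next definition \<open>g\<close> is the extension of \<open>T\<close> from \<open>I\<close> to \<open>closure I\<close>; its derivatives at
  the endpoints are one-sided. The bound \<open>\<kappa>\<close> is common to all \<open>I \<in> A\<close>.
\<close>

definition uniformly_expanding :: "(real \<Rightarrow> real) \<Rightarrow> real set set \<Rightarrow> bool" where
  "uniformly_expanding T A \<longleftrightarrow>
     T ` {0..1} \<subseteq> {0..1} \<and>
     finite A \<and> partition_on {0..1} A \<and> (\<forall>I\<in>A. is_interval I) \<and>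
     (\<exists>\<kappa>>1. \<forall>I\<in>A. \<exists>g g' g''.
        (\<forall>x\<in>I. g x = T x) \<and>
        (strict_mono_on (closure I) g \<or> strict_antimono_on (closure I) g) \<and>
        (\<forall>x\<in>closure I. (g has_real_derivative g' x) (at x within closure I)) \<and>
        (\<forall>x\<in>closure I. (g' has_real_derivative g'' x) (at x within closure I)) \<and>
        continuous_on (closure I) g'' \<and>
        (\<forall>x\<in>closure I. \<kappa> \<le> \<bar>g' x\<bar>))"

text \<open>
  The index set \<open>{1,\<dots>,q}\<close> is a finite type \<open>'q\<close>, the sequence space is the type \<open>int \<Rightarrow> 'q\<close>, and
  a probability vector is a \<open>'q pmf\<close>.
\<close>

definition bernoulli_measure :: "'q::finite pmf \<Rightarrow> (int \<Rightarrow> 'q) measure" where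
  "bernoulli_measure p = (\<Pi>\<^sub>M i\<in>UNIV. measure_pmf p)"

definition shift :: "int \<Rightarrow> (int \<Rightarrow> 'q) \<Rightarrow> int \<Rightarrow> 'q" where
  "shift k \<omega> = (\<lambda>i. \<omega> (i + k))"

primrec orbit_map :: "('q \<Rightarrow> real \<Rightarrow> real) \<Rightarrow> (int \<Rightarrow> 'q) \<Rightarrow> nat \<Rightarrow> real \<Rightarrow> real" where
  "orbit_map T \<omega> 0 = id"
| "orbit_map T \<omega> (Suc n) = T (shift (int n) \<omega> 0) \<circ> orbit_map T \<omega> n"

definition join_partition ::
  "('q \<Rightarrow> real \<Rightarrow> real) \<Rightarrow> ('q \<Rightarrow> real set set) \<Rightarrow> (int \<Rightarrow> 'q) \<Rightarrow> nat \<Rightarrow> real set set" where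
  "join_partition T A \<omega> n =
     {{x\<in>{0..1}. \<forall>k<n. orbit_map T \<omega> k x \<in> B k} | B.
        \<forall>k<n. B k \<in> A (shift (int k) \<omega> 0)} - {{}}"

definition partition_endpoints ::
  "('q \<Rightarrow> real \<Rightarrow> real) \<Rightarrow> ('q \<Rightarrow> real set set) \<Rightarrow> real set" where
  "partition_endpoints T A = (\<Union>n. \<Union>\<omega>. \<Union>I\<in>join_partition T A \<omega> n. frontier I)"


definition transfer_op :: "(real \<Rightarrow> real) \<Rightarrow> (real \<Rightarrow> real) \<Rightarrow> real \<Rightarrow> real" where
  "transfer_op T \<psi> =
     (SOME g. integrable leb01 g \<and>
        (\<forall>\<phi>\<in>borel_measurable leb01. (\<exists>B. AE x in leb01. \<bar>\<phi> x\<bar> \<le> B) \<longrightarrow>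
           (\<integral>x. \<phi> (T x) * \<psi> x \<partial>leb01) = (\<integral>x. \<phi> x * g x \<partial>leb01)))"

primrec transfer_iter ::
  "('q \<Rightarrow> real \<Rightarrow> real) \<Rightarrow> (int \<Rightarrow> 'q) \<Rightarrow> nat \<Rightarrow> (real \<Rightarrow> real) \<Rightarrow> real \<Rightarrow> real" where
  "transfer_iter T \<omega> 0 = id"
| "transfer_iter T \<omega> (Suc n) = transfer_op (T (shift (int n) \<omega> 0)) \<circ> transfer_iter T \<omega> n"

definition cond_LY :: "('q \<Rightarrow> real \<Rightarrow> real) \<Rightarrow> bool" where
  "cond_LY T \<longleftrightarrow>
     (\<exists>r\<ge>1. \<exists>M>0. \<exists>D>0. \<exists>\<rho>\<in>{0<..<1}. \<forall>\<omega>. \<forall>f\<in>BV.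
        BV_norm (transfer_op (T (\<omega> 0)) f) \<le> ennreal M * BV_norm f \<and>
        Var (transfer_iter T \<omega> r f) \<le> ennreal \<rho> * Var f + ennreal D * L1_norm f)"

definition cond_Dec :: "('q \<Rightarrow> real \<Rightarrow> real) \<Rightarrow> bool" where
  "cond_Dec T \<longleftrightarrow>
     (\<exists>C>0. \<exists>\<theta>\<in>{0<..<1}. \<forall>n\<ge>1. \<forall>\<omega>. \<forall>f\<in>BV. (\<integral>x. f x \<partial>leb01) = 0 \<longrightarrow>
        BV_norm (transfer_iter T \<omega> n f) \<le> ennreal (C * \<theta> ^ n) * BV_norm f)"

text \<open>The infimum over \<open>[0,1]\<close> of an a.e.-class is its essential infimum.\<close>

definition cond_Min :: "('q \<Rightarrow> real \<Rightarrow> real) \<Rightarrow> bool" where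
  "cond_Min T \<longleftrightarrow>
     (\<exists>c>0. \<forall>n\<ge>1. \<forall>\<omega>. AE x in leb01. c \<le> transfer_iter T \<omega> n (\<lambda>_. 1) x)"

text \<open>The limit is unique up to null sets, so \<open>sample_measure\<close> does not depend on the choice.\<close>

definition sample_density :: "('q \<Rightarrow> real \<Rightarrow> real) \<Rightarrow> (int \<Rightarrow> 'q) \<Rightarrow> real \<Rightarrow> real" where
  "sample_density T \<omega> =
     (SOME h. h \<in> BV \<and>
        (\<lambda>n. BV_norm (\<lambda>x. transfer_iter T (shift (- int n) \<omega>) n (\<lambda>_. 1) x - h x))
          \<longlonglongrightarrow> 0)"

definition sample_measure :: "('q \<Rightarrow> real \<Rightarrow> real) \<Rightarrow> (int \<Rightarrow> 'q) \<Rightarrow> real measure" where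
  "sample_measure T \<omega> = density leb01 (\<lambda>x. ennreal (sample_density T \<omega> x))"

definition stationary_prob :: "('q::finite \<Rightarrow> real \<Rightarrow> real) \<Rightarrow> 'q pmf \<Rightarrow> real set \<Rightarrow> real" where
  "stationary_prob T p U = (\<integral>\<omega>. measure (sample_measure T \<omega>) U \<partial>bernoulli_measure p)"


definition nonrecurrent :: "('q::finite \<Rightarrow> real \<Rightarrow> real) \<Rightarrow> 'q pmf \<Rightarrow> real \<Rightarrow> bool" where
  "nonrecurrent T p x0 \<longleftrightarrow>
     (AE \<omega> in bernoulli_measure p. \<forall>n\<ge>1. orbit_map T \<omega> n x0 \<noteq> x0)"

text \<open>The case distinction is needed because \<open>0 powr a = 0\<close> for every \<open>a\<close>.\<close>

definition phi :: "real \<Rightarrow> real \<Rightarrow> real \<Rightarrow> ereal" where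
  "phi \<alpha> x0 x = (if x = x0 then \<infinity> else ereal (\<bar>x - x0\<bar> powr (- (1 / \<alpha>))))"

definition J_family :: "ereal set set" where
  "J_family = {\<Union>K | K. finite K \<and> K \<subseteq> {{x<..y} | x y. x < y \<and> 0 \<notin> {x..y}}}"

definition levy_measure :: "real \<Rightarrow> real measure" where
  "levy_measure \<alpha> =
     density lborel (\<lambda>x. ennreal (indicator {0<..} x * (\<alpha> * x powr (- \<alpha> - 1))))"

text \<open>With values in \<open>enat\<close>, the infimum of the empty set is \<open>\<infinity>\<close>.\<close>

definition hitting_time ::
  "('q \<Rightarrow> real \<Rightarrow> real) \<Rightarrow> real set \<Rightarrow> (int \<Rightarrow> 'q) \<Rightarrow> real \<Rightarrow> enat" where
  "hitting_time T U \<omega> x = Inf (enat ` {k. k \<ge> 1 \<and> orbit_map T \<omega> k x \<in> U})"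

end

theory Submission
  imports Defs "HOL-Real_Asymp.Real_Asymp"
begin

text \<open>
  Write \<open>\<nu>\<^sup>\<omega>\<close> for the sample measures and \<open>\<sigma>\<close> for the left shift. Splitting off the first step shows that
  \<open>H\<^sub>N(\<omega>) = \<nu>\<^sup>\<omega>(R\<^sub>U > N)\<close> satisfies \<open>H\<^sub>N\<^sub>+\<^sub>1(\<omega>) = H\<^sub>N(\<sigma>\<omega>) - \<nu>\<^sup>\<sigma>\<^sup>\<omega>(U \<inter> {R\<^sub>U > N})\<close>. Here the past only enters through
  the indicator of \<open>U\<close>, which has bounded variation, so the decay of correlations over a gap \<open>l\<close> gives
  \<open>\<nu>\<^sup>\<omega>(U \<inter> {R\<^sub>U > N}) \<approx> \<nu>\<^sup>\<omega>(U) H\<^sub>N(\<omega>)\<close> up to \<open>\<nu>\<^sup>\<omega>(U \<inter> {R\<^sub>U \<le> l})\<close>, \<open>O(\<theta>\<^sup>l)\<close> and \<open>O(l)\<close> times the square of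
  the measure of \<open>U\<close>. Hence \<open>H\<^sub>N(\<omega>)\<close> is close to \<open>exp (- S\<^sub>N)\<close>,
  where \<open>S\<^sub>N\<close> is the sum of the measures of \<open>U\<close> at the first \<open>N\<close> shifts of \<open>\<omega>\<close>.

  Short returns to the shrinking balls around \<open>x0\<close> are impossible before any fixed time \<open>K\<close>, because \<open>x0\<close> is
  a non-recurrent continuity point of all iterates, and after time \<open>K\<close> they contribute \<open>O(\<theta>\<^sup>K)\<close>. The sums \<open>S\<^sub>N\<close>
  concentrate around their mean by Hoeffding's inequality, as the sample
  measures depend exponentially little on the remote past and the base is Bernoulli. The mean is found by
  rescaling at \<open>x0\<close>, where densities of bounded variation have one-sided limits.
\<close>

section \<open>Functions of bounded variation on the unit interval\<close>

text \<open>The analytic estimates are uniform in \<omega>, so only non-recurrence and the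
  concentration of the sums discard a null set, and this set must serve all s and t at once.
  Concentration is therefore proved for all lengths \<open>N \<le> m * n\<close> simultaneously, and
  the block of times after floor(n s) is a difference of two initial sums. One length of order
  n^(1/4) serves both as the gap and as the number of past coordinates kept in approximating the
  sample measures. The contribution of returns after time K does not vanish with n, so K is fixed
  before n. It stays proportional to the measure of the ball because bounded variation controls the
  supremum: an arbitrary future event enters the decay estimate with its own Lebesgue measure as a
  factor. The local density at \<open>x0\<close> never has to be computed. The level sets are
  symmetric about \<open>x0\<close>, as is the ball that normalises \<open>b n\<close>, so the same
  factor occurs for both and cancels. Finally, operators and densities are chosen by
  \<open>SOME\<close> among almost everywhere equal functions; linearity and equivariance are
  recovered by integrating against bounded test functions.\<close>

lemma space_leb01 [simp]: "space leb01 = {0..1}"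
  by (simp add: leb01_def space_restrict_space)

lemma sets_leb01: "A \<in> sets leb01 \<longleftrightarrow> A \<in> sets borel \<and> A \<subseteq> {0..1}"
  by (auto simp: leb01_def sets_restrict_space_iff)

lemma emeasure_leb01: "A \<subseteq> {0..1} \<Longrightarrow> emeasure leb01 A = emeasure lborel A"
  by (simp add: leb01_def emeasure_restrict_space)

lemma measure_leb01: "A \<subseteq> {0..1} \<Longrightarrow> measure leb01 A = measure lborel A"
  by (simp add: measure_def emeasure_leb01)

interpretation leb01: prob_space leb01
  by standard (simp add: emeasure_leb01)

lemma integrable_leb01_bounded:
  fixes f :: "real \<Rightarrow> real"
  assumes "f \<in> borel_measurable leb01" "AE x in leb01. \<bar>f x\<bar> \<le> B"
  shows "integrable leb01 f"
  using assms by (intro leb01.integrable_const_bound[where B = B]) auto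

lemma integrable_leb01_mult:
  fixes f g :: "real \<Rightarrow> real"
  assumes f: "integrable leb01 f" and g: "g \<in> borel_measurable leb01" "AE x in leb01. \<bar>g x\<bar> \<le> B"
  shows "integrable leb01 (\<lambda>x. g x * f x)"
proof (rule Bochner_Integration.integrable_bound[where f = "\<lambda>x. B * \<bar>f x\<bar>"])
  show "integrable leb01 (\<lambda>x. B * \<bar>f x\<bar>)" using f by auto
  show "(\<lambda>x. g x * f x) \<in> borel_measurable leb01" using f g by auto
  show "AE x in leb01. norm (g x * f x) \<le> norm (B * \<bar>f x\<bar>)"
    using g(2)
  proof eventually_elim
    case (elim x)
    then show ?case by (auto simp: abs_mult intro!: mult_right_mono)
  qed
qed

text \<open>
  The existence of such a \<open>v\<close> is equivalent to \<open>pointwise_variation f \<le> K\<close>: one may take for \<open>v x\<close> the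
  variation of \<open>f\<close> on \<open>[0,x]\<close>.
\<close>

definition increments_le :: "real \<Rightarrow> (real \<Rightarrow> real) \<Rightarrow> (real \<Rightarrow> real) \<Rightarrow> bool" where
  "increments_le K v f \<longleftrightarrow>
     (\<forall>x\<in>{0..1}. v x \<in> {0..K}) \<and>
     (\<forall>x y. 0 \<le> x \<longrightarrow> x \<le> y \<longrightarrow> y \<le> 1 \<longrightarrow> \<bar>f y - f x\<bar> \<le> v y - v x)"

definition variation_le :: "real \<Rightarrow> (real \<Rightarrow> real) \<Rightarrow> bool" where
  "variation_le K f \<longleftrightarrow> (\<exists>v. increments_le K v f)"

text \<open>One real constant bounds both the L1 norm and the variation of some representative. This
  keeps the estimates out of \<open>ennreal\<close> and away from the infimum in \<open>Var\<close>;
  the conversions to and from \<open>BV_norm\<close> cost a constant factor.\<close>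

definition bv_le :: "real \<Rightarrow> (real \<Rightarrow> real) \<Rightarrow> bool" where
  "bv_le K f \<longleftrightarrow> integrable leb01 f \<and> (\<integral>x. \<bar>f x\<bar> \<partial>leb01) \<le> K \<and>
     (\<exists>g. (AE x in leb01. g x = f x) \<and> variation_le K g)"

lemma variation_leI:
  assumes "\<And>x. 0 \<le> x \<Longrightarrow> x \<le> 1 \<Longrightarrow> 0 \<le> v x" "\<And>x. 0 \<le> x \<Longrightarrow> x \<le> 1 \<Longrightarrow> v x \<le> K"
    and "\<And>x y. 0 \<le> x \<Longrightarrow> x \<le> y \<Longrightarrow> y \<le> 1 \<Longrightarrow> \<bar>f y - f x\<bar> \<le> v y - v x"
  shows "variation_le K f"
  unfolding variation_le_def increments_le_def using assms by (intro exI[of _ v]) auto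

lemma increments_leD:
  assumes "increments_le K v f"
  shows "\<And>x. 0 \<le> x \<Longrightarrow> x \<le> 1 \<Longrightarrow> 0 \<le> v x" "\<And>x. 0 \<le> x \<Longrightarrow> x \<le> 1 \<Longrightarrow> v x \<le> K"
    "\<And>x y. 0 \<le> x \<Longrightarrow> x \<le> y \<Longrightarrow> y \<le> 1 \<Longrightarrow> \<bar>f y - f x\<bar> \<le> v y - v x"
  using assms unfolding increments_le_def by auto

lemma pointwise_variation_le:
  assumes "variation_le K f"
  shows "pointwise_variation f \<le> ennreal K"
proof -
  obtain v where "increments_le K v f"
    using assms by (auto simp: variation_le_def)
  note v = increments_leD[OF this]
  show ?thesis
    unfolding pointwise_variation_def
  proof (rule SUP_least)
    fix xs :: "real list" assume "xs \<in> {xs. sorted xs \<and> set xs \<subseteq> {0..1}}"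
    then have xs: "sorted xs" "set xs \<subseteq> {0..1}" by auto
    have in01: "xs ! i \<in> {0..1}" if "i < length xs" for i
      using xs(2) that nth_mem by blast
    have "(\<Sum>i<length xs - 1. \<bar>f (xs ! Suc i) - f (xs ! i)\<bar>)
        \<le> (\<Sum>i<length xs - 1. v (xs ! Suc i) - v (xs ! i))"
    proof (rule sum_mono)
      fix i assume "i \<in> {..<length xs - 1}"
      then have i: "Suc i < length xs" by auto
      show "\<bar>f (xs ! Suc i) - f (xs ! i)\<bar> \<le> v (xs ! Suc i) - v (xs ! i)"
        using in01[of i] in01[of "Suc i"] i sorted_nth_mono[OF xs(1), of i "Suc i"]
        by (intro v) auto
    qed
    also have "\<dots> = v (xs ! (length xs - 1)) - v (xs ! 0)"
      by (rule sum_lessThan_telescope)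
    also have "\<dots> \<le> K"
    proof (cases "xs = []")
      case True
      then show ?thesis using v(1,2)[of 0] by auto
    next
      case False
      then show ?thesis
        using v(1)[of "xs ! 0"] v(2)[of "xs ! (length xs - 1)"] in01[of 0] in01[of "length xs - 1"]
        by auto
    qed
    finally show "(\<Sum>i<length xs - 1. ennreal \<bar>f (xs ! Suc i) - f (xs ! i)\<bar>) \<le> ennreal K"
      by (simp add: sum_ennreal ennreal_leI)
  qed
qed

lemma variation_le_if_pointwise:
  assumes "pointwise_variation f \<le> ennreal K" "0 \<le> K"
  shows "variation_le K f"
proof -
  define S where "S xs = (\<Sum>i<length xs - 1. \<bar>f (xs ! Suc i) - f (xs ! i)\<bar>)" for xs
  define L where "L x = {xs. sorted xs \<and> set xs \<subseteq> {0..x}}" for x :: real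
  have SK: "S xs \<le> K" if "sorted xs" "set xs \<subseteq> {0..1}" for xs
  proof -
    have "ennreal (S xs) = (\<Sum>i<length xs - 1. ennreal \<bar>f (xs ! Suc i) - f (xs ! i)\<bar>)"
      by (simp add: S_def sum_ennreal)
    also have "\<dots> \<le> pointwise_variation f"
      unfolding pointwise_variation_def using that by (intro SUP_upper) auto
    also note assms(1)
    finally show ?thesis using assms(2) by simp
  qed
  have bdd: "bdd_above (S ` L x)" if "x \<le> 1" for x
  proof (rule bdd_aboveI2)
    fix xs assume "xs \<in> L x"
    then have "sorted xs" "set xs \<subseteq> {0..1}" using that by (auto simp: L_def)
    then show "S xs \<le> K" by (rule SK)
  qed
  have nil: "[] \<in> L x" for x by (simp add: L_def)
  show ?thesis
  proof (rule variation_leI[where v = "\<lambda>x. SUP xs \<in> L x. S xs"])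
    fix x :: real assume x: "0 \<le> x" "x \<le> 1"
    have "S [] \<le> (SUP xs \<in> L x. S xs)" using bdd[OF x(2)] nil by (rule cSUP_upper2) simp
    then show "0 \<le> (SUP xs \<in> L x. S xs)" by (simp add: S_def)
    show "(SUP xs \<in> L x. S xs) \<le> K"
    proof (rule cSUP_least)
      show "L x \<noteq> {}" using nil by blast
      fix xs assume "xs \<in> L x"
      then have "sorted xs" "set xs \<subseteq> {0..1}" using x by (auto simp: L_def)
      then show "S xs \<le> K" by (rule SK)
    qed
  next
    fix x y :: real assume xy: "0 \<le> x" "x \<le> y" "y \<le> 1"
    have "S xs \<le> (SUP xs \<in> L y. S xs) - \<bar>f y - f x\<bar>" if "xs \<in> L x" for xs
    proof -
      let ?ys = "xs @ [x, y]"
      have ys: "?ys \<in> L y" using that xy by (force simp: L_def sorted_append)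
      \<comment> \<open>In \<open>?ys\<close> the index \<open>length xs\<close> is the step from
        \<open>x\<close> to \<open>y\<close>. For nonempty \<open>xs\<close> the step from its last
        point to \<open>x\<close>, at index \<open>length xs - 1\<close>, is left out here and only
        enlarges \<open>S ?ys\<close>.\<close>
      have "S xs + \<bar>f y - f x\<bar> =
          (\<Sum>i\<in>{..<length xs - 1} \<union> {length xs}. \<bar>f (?ys ! Suc i) - f (?ys ! i)\<bar>)"
        by (subst sum.union_disjoint) (auto simp: S_def nth_append intro!: sum.cong)
      also have "\<dots> \<le> S ?ys"
        unfolding S_def by (rule sum_mono2) auto
      also have "\<dots> \<le> (SUP xs \<in> L y. S xs)"
        using ys bdd xy by (intro cSUP_upper)
      finally show ?thesis by simp
    qed
    then have "(SUP xs \<in> L x. S xs) \<le> (SUP xs \<in> L y. S xs) - \<bar>f y - f x\<bar>"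
      using nil by (intro cSUP_least) auto
    then show "\<bar>f y - f x\<bar> \<le> (SUP xs \<in> L y. S xs) - (SUP xs \<in> L x. S xs)" by simp
  qed
qed

lemma variation_le_mono: "variation_le K f \<Longrightarrow> K \<le> L \<Longrightarrow> variation_le L f"
  by (auto simp: variation_le_def increments_le_def intro: order_trans)

lemma variation_le_const: "0 \<le> K \<Longrightarrow> variation_le K (\<lambda>_. a)"
  by (rule variation_leI[where v = "\<lambda>_. 0"]) auto

lemma variation_le_add:
  assumes "variation_le K f" "variation_le L g"
  shows "variation_le (K + L) (\<lambda>x. f x + g x)"
proof -
  obtain v where "increments_le K v f"
    using assms(1) by (auto simp: variation_le_def)
  note v = increments_leD[OF this]
  obtain w where "increments_le L w g"
    using assms(2) by (auto simp: variation_le_def)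
  note w = increments_leD[OF this]
  show ?thesis
  proof (rule variation_leI[where v = "\<lambda>x. v x + w x"])
    fix x y :: real assume "0 \<le> x" "x \<le> y" "y \<le> 1"
    then show "\<bar>f y + g y - (f x + g x)\<bar> \<le> v y + w y - (v x + w x)"
      using v(3)[of x y] w(3)[of x y] by linarith
  qed (use v(1,2) w(1,2) in \<open>auto intro: add_mono\<close>)
qed

lemma variation_le_cmult:
  assumes "variation_le K f" "\<bar>a\<bar> * K \<le> L"
  shows "variation_le L (\<lambda>x. a * f x)"
proof -
  obtain v where "increments_le K v f"
    using assms(1) by (auto simp: variation_le_def)
  note v = increments_leD[OF this]
  show ?thesis
  proof (rule variation_leI[where v = "\<lambda>x. \<bar>a\<bar> * v x"])
    fix x y :: real assume "0 \<le> x" "x \<le> y" "y \<le> 1"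
    then have "\<bar>a\<bar> * \<bar>f y - f x\<bar> \<le> \<bar>a\<bar> * (v y - v x)"
      using v(3)[of x y] by (intro mult_left_mono) auto
    then show "\<bar>a * f y - a * f x\<bar> \<le> \<bar>a\<bar> * v y - \<bar>a\<bar> * v x"
      by (simp add: abs_mult[symmetric] algebra_simps)
  next
    fix x :: real assume "0 \<le> x" "x \<le> 1"
    then have "\<bar>a\<bar> * v x \<le> \<bar>a\<bar> * K" using v(2) by (intro mult_left_mono) auto
    then show "\<bar>a\<bar> * v x \<le> L" using assms(2) by linarith
  qed (use v(1) in auto)
qed

lemma variation_le_diff:
  assumes "variation_le K f" "variation_le L g"
  shows "variation_le (K + L) (\<lambda>x. f x - g x)"
  using variation_le_add[OF assms(1) variation_le_cmult[OF assms(2), of "-1" L]] by simp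

lemma variation_le_mult:
  assumes "variation_le K f" "variation_le L g"
    and "\<And>x. 0 \<le> x \<Longrightarrow> x \<le> 1 \<Longrightarrow> \<bar>f x\<bar> \<le> A" "\<And>x. 0 \<le> x \<Longrightarrow> x \<le> 1 \<Longrightarrow> \<bar>g x\<bar> \<le> B"
  shows "variation_le (A * L + B * K) (\<lambda>x. f x * g x)"
proof -
  obtain v where "increments_le K v f"
    using assms(1) by (auto simp: variation_le_def)
  note v = increments_leD[OF this]
  obtain w where "increments_le L w g"
    using assms(2) by (auto simp: variation_le_def)
  note w = increments_leD[OF this]
  have AB: "0 \<le> A" "0 \<le> B" using assms(3,4)[of 0] by auto
  show ?thesis
  proof (rule variation_leI[where v = "\<lambda>x. A * w x + B * v x"])
    fix x y :: real assume xy: "0 \<le> x" "x \<le> y" "y \<le> 1"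
    have "\<bar>f y * g y - f x * g x\<bar> = \<bar>f y * (g y - g x) + g x * (f y - f x)\<bar>"
      by (simp add: algebra_simps)
    also have "\<dots> \<le> \<bar>f y\<bar> * \<bar>g y - g x\<bar> + \<bar>g x\<bar> * \<bar>f y - f x\<bar>"
      by (metis abs_mult abs_triangle_ineq)
    also have "\<dots> \<le> A * (w y - w x) + B * (v y - v x)"
      using xy v(3)[of x y] w(3)[of x y] assms(3)[of y] assms(4)[of x] AB
      by (intro add_mono mult_mono) auto
    finally show "\<bar>f y * g y - f x * g x\<bar> \<le> A * w y + B * v y - (A * w x + B * v x)"
      by (simp add: algebra_simps)
  next
    fix x :: real assume "0 \<le> x" "x \<le> 1"
    then show "A * w x + B * v x \<le> A * L + B * K" "0 \<le> A * w x + B * v x"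
      using v(1,2)[of x] w(1,2)[of x] AB by (auto intro!: add_mono mult_left_mono)
  qed
qed

lemma variation_le_indicator_interval:
  fixes I :: "real set"
  assumes "is_interval I"
  shows "variation_le 2 (indicator I)"
proof -
  \<comment> \<open>\<open>a\<close> records that \<open>I\<close> has been entered,
    \<open>b\<close> that it has been left. Both are increasing and their difference is the
    indicator, so \<open>a + b\<close>, which is at most 2, dominates the increments.\<close>
  define a where "a x = (if \<exists>y\<in>I. y \<le> x then 1 else 0 :: real)" for x
  define b where "b x = (if (\<exists>y\<in>I. y \<le> x) \<and> x \<notin> I then 1 else 0 :: real)" for x
  have a: "a x \<le> a y" if "x \<le> y" for x y
    using that unfolding a_def by (auto intro: order_trans)
  have b: "b x \<le> b y" if "x \<le> y" for x y
  proof -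
    have "(\<exists>z\<in>I. z \<le> y) \<and> y \<notin> I" if *: "(\<exists>z\<in>I. z \<le> x) \<and> x \<notin> I"
      using * \<open>x \<le> y\<close> mem_is_interval_1_I[OF assms] by (meson order_trans)
    then show ?thesis by (simp add: b_def)
  qed
  have ab: "indicator I x = a x - b x" for x
    unfolding a_def b_def indicator_def by auto
  show ?thesis
  proof (rule variation_leI[where v = "\<lambda>x. a x + b x"])
    fix x y :: real assume "x \<le> y"
    then show "\<bar>indicator I y - indicator I x\<bar> \<le> a y + b y - (a x + b x)"
      using a[of x y] b[of x y] unfolding ab by linarith
  qed (auto simp: a_def b_def)
qed

lemma variation_le_indicator_Un:
  assumes "variation_le K (indicator A)" "variation_le L (indicator B)"
  shows "variation_le (K + L) (indicator (A \<union> B))"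
proof -
  obtain v where "increments_le K v (indicator A)"
    using assms(1) by (auto simp: variation_le_def)
  note v = increments_leD[OF this]
  obtain w where "increments_le L w (indicator B)"
    using assms(2) by (auto simp: variation_le_def)
  note w = increments_leD[OF this]
  show ?thesis
  proof (rule variation_leI[where v = "\<lambda>x. v x + w x"])
    fix x y :: real assume "0 \<le> x" "x \<le> y" "y \<le> 1"
    then show "\<bar>indicator (A \<union> B) y - indicator (A \<union> B) x\<bar> \<le> v y + w y - (v x + w x)"
      using v(3)[of x y] w(3)[of x y] by (auto simp: indicator_def split: if_splits)
  qed (use v(1,2) w(1,2) in \<open>auto intro: add_mono\<close>)
qed

text \<open>Jordan decomposition: \<open>v\<close> and \<open>v - f\<close> are increasing, hence
  measurable.\<close>

lemma variation_le_measurable: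
  assumes "variation_le K f"
  shows "f \<in> borel_measurable leb01"
proof -
  obtain v where "increments_le K v f"
    using assms by (auto simp: variation_le_def)
  note v = increments_leD[OF this]
  have "v x \<le> v y" "v x - f x \<le> v y - f y" if "0 \<le> x" "x \<le> y" "y \<le> 1" for x y
    using v(3)[OF that] by auto
  then have "mono_on {0..1} v" "mono_on {0..1} (\<lambda>x. v x - f x)"
    by (auto intro!: mono_onI)
  moreover have "borel_measurable leb01 = borel_measurable (restrict_space borel {0..1})"
    by (intro measurable_cong_sets) (simp_all add: leb01_def sets_restrict_space)
  ultimately have "v \<in> borel_measurable leb01" "(\<lambda>x. v x - f x) \<in> borel_measurable leb01"
    using borel_measurable_mono_on_fnc by auto
  then have "(\<lambda>x. v x - (v x - f x)) \<in> borel_measurable leb01"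
    by (rule borel_measurable_diff)
  then show ?thesis by simp
qed

lemma variation_le_bounded:
  assumes "variation_le K f" "x \<in> {0..1}" "y \<in> {0..1}"
  shows "\<bar>f x - f y\<bar> \<le> K"
proof -
  obtain v where "increments_le K v f"
    using assms(1) by (auto simp: variation_le_def)
  note v = increments_leD[OF this]
  show ?thesis
    using v(3)[of x y] v(3)[of y x] v(1)[of x] v(1)[of y] v(2)[of x] v(2)[of y] assms(2,3)
    by (cases "x \<le> y") auto
qed

lemma variation_le_sup:
  assumes f: "variation_le K f" "integrable leb01 f" and I: "(\<integral>x. \<bar>f x\<bar> \<partial>leb01) \<le> L"
    and x: "x \<in> {0..1}"
  shows "\<bar>f x\<bar> \<le> K + L"
proof -
  \<comment> \<open>Every value of \<open>f\<close> is within \<open>K\<close> of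
    \<open>f x\<close>, so the mean of its modulus over the probability measure \<open>leb01\<close>
    falls below the modulus of \<open>f x\<close> by at most \<open>K\<close>.\<close>
  have "\<bar>f x\<bar> - K = (\<integral>y. \<bar>f x\<bar> - K \<partial>leb01)"
    using leb01.prob_space by simp
  also have "\<dots> \<le> (\<integral>y. \<bar>f y\<bar> \<partial>leb01)"
  proof (rule integral_mono)
    fix y assume "y \<in> space leb01"
    then show "\<bar>f x\<bar> - K \<le> \<bar>f y\<bar>" using variation_le_bounded[OF f(1) x, of y] by auto
  qed (use f in auto)
  finally show ?thesis using I by simp
qed

lemma bv_leE:
  assumes "bv_le K f"
  obtains g where "AE x in leb01. g x = f x" "variation_le K g" "integrable leb01 g"
    "\<forall>x\<in>{0..1}. \<bar>g x\<bar> \<le> 2 * K" "(\<integral>x. \<bar>g x\<bar> \<partial>leb01) \<le> K"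
proof -
  from assms obtain g where g: "AE x in leb01. g x = f x" "variation_le K g"
    and f: "integrable leb01 f" "(\<integral>x. \<bar>f x\<bar> \<partial>leb01) \<le> K"
    by (auto simp: bv_le_def)
  have gm: "g \<in> borel_measurable leb01" by (rule variation_le_measurable[OF g(2)])
  have gi: "integrable leb01 g"
    by (rule integrable_cong_AE_imp[OF f(1) gm]) (use g(1) in auto)
  have "(\<integral>x. \<bar>g x\<bar> \<partial>leb01) = (\<integral>x. \<bar>f x\<bar> \<partial>leb01)"
    using f gm g(1) by (intro integral_cong_AE) auto
  with f have gl: "(\<integral>x. \<bar>g x\<bar> \<partial>leb01) \<le> K" by simp
  show thesis
    by (rule that[OF g gi _ gl]) (use variation_le_sup[OF g(2) gi gl] in simp)
qed

lemma bv_leI: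
  assumes "integrable leb01 f" "AE x in leb01. g x = f x" "variation_le K g"
    "(\<integral>x. \<bar>f x\<bar> \<partial>leb01) \<le> K"
  shows "bv_le K f"
  using assms by (auto simp: bv_le_def)

lemma bv_le_integrable: "bv_le K f \<Longrightarrow> integrable leb01 f"
  by (simp add: bv_le_def)

lemma bv_le_L1: "bv_le K f \<Longrightarrow> (\<integral>x. \<bar>f x\<bar> \<partial>leb01) \<le> K"
  by (simp add: bv_le_def)

lemma bv_le_nonneg: "bv_le K f \<Longrightarrow> 0 \<le> K"
proof -
  have "0 \<le> (\<integral>x. \<bar>f x\<bar> \<partial>leb01)" by simp
  also assume "bv_le K f"
  then have "(\<integral>x. \<bar>f x\<bar> \<partial>leb01) \<le> K" by (rule bv_le_L1)
  finally show ?thesis .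
qed

lemma bv_le_bounded: "bv_le K f \<Longrightarrow> AE x in leb01. \<bar>f x\<bar> \<le> 2 * K"
proof (erule bv_leE)
  fix g assume g: "AE x in leb01. g x = f x" "\<forall>x\<in>{0..1}. \<bar>g x\<bar> \<le> 2 * K"
  from g(1) AE_space show ?thesis by eventually_elim (use g(2) in force)
qed

lemma bv_le_mono: "bv_le K f \<Longrightarrow> K \<le> L \<Longrightarrow> bv_le L f"
  unfolding bv_le_def by (auto intro: variation_le_mono)

lemma bv_le_const: "\<bar>a\<bar> \<le> K \<Longrightarrow> bv_le K (\<lambda>_. a)"
  using leb01.prob_space by (auto intro!: bv_leI[where g = "\<lambda>_. a"] variation_le_const)

lemma bv_le_cong_AE:
  assumes "bv_le K f" "AE x in leb01. f x = g x" "g \<in> borel_measurable leb01"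
  shows "bv_le K g"
proof -
  from assms(1) obtain r where r: "AE x in leb01. r x = f x" "variation_le K r"
    and f: "integrable leb01 f" "(\<integral>x. \<bar>f x\<bar> \<partial>leb01) \<le> K"
    by (auto simp: bv_le_def)
  have "integrable leb01 g"
    by (rule integrable_cong_AE_imp[OF f(1) assms(3)]) (use assms(2) in auto)
  moreover have "(\<integral>x. \<bar>g x\<bar> \<partial>leb01) = (\<integral>x. \<bar>f x\<bar> \<partial>leb01)"
    using f(1) assms(2,3) by (intro integral_cong_AE) auto
  moreover have "AE x in leb01. r x = g x" using r(1) assms(2) by eventually_elim auto
  ultimately show ?thesis using r f by (intro bv_leI[where g = r]) auto
qed

lemma bv_le_diff:
  assumes "bv_le K f" "bv_le L g"
  shows "bv_le (K + L) (\<lambda>x. f x - g x)"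
proof -
  obtain f' where f': "AE x in leb01. f' x = f x" "variation_le K f'" using assms(1) by (rule bv_leE) blast
  obtain g' where g': "AE x in leb01. g' x = g x" "variation_le L g'" using assms(2) by (rule bv_leE) blast
  note i = bv_le_integrable[OF assms(1)] bv_le_integrable[OF assms(2)]
  have "(\<integral>x. \<bar>f x - g x\<bar> \<partial>leb01) \<le> (\<integral>x. \<bar>f x\<bar> + \<bar>g x\<bar> \<partial>leb01)"
    using i by (intro integral_mono) auto
  also have "\<dots> \<le> K + L"
    using i bv_le_L1[OF assms(1)] bv_le_L1[OF assms(2)] by simp
  finally show ?thesis
    using i f' g' by (intro bv_leI[where g = "\<lambda>x. f' x - g' x"] variation_le_diff) auto
qed

lemma bv_le_cmult:
  assumes "bv_le K f"
  shows "bv_le (\<bar>a\<bar> * K) (\<lambda>x. a * f x)"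
proof -
  obtain f' where f': "AE x in leb01. f' x = f x" "variation_le K f'" using assms(1) by (rule bv_leE) blast
  have "(\<integral>x. \<bar>a * f x\<bar> \<partial>leb01) = \<bar>a\<bar> * (\<integral>x. \<bar>f x\<bar> \<partial>leb01)"
    by (simp add: abs_mult)
  also have "\<dots> \<le> \<bar>a\<bar> * K" using bv_le_L1[OF assms] by (intro mult_left_mono) auto
  finally show ?thesis
    using f' bv_le_integrable[OF assms]
    by (intro bv_leI[where g = "\<lambda>x. a * f' x"] variation_le_cmult[OF f'(2)]) auto
qed

text \<open>By the product rule: \<open>indicator U\<close> is at most 1 and the good representative
  of \<open>f\<close> at most \<open>2 * K\<close>, so the variation is at most
  \<open>K + 2 * K * L\<close>.\<close>

lemma bv_le_indicator_mult:
  assumes f: "bv_le K f" and U: "variation_le L (indicator U)" "0 \<le> L"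
  shows "bv_le ((2 * L + 1) * K) (\<lambda>x. indicator U x * f x)"
proof -
  obtain g where g: "AE x in leb01. g x = f x" "variation_le K g" "integrable leb01 g"
    "\<forall>x\<in>{0..1}. \<bar>g x\<bar> \<le> 2 * K" using f by (rule bv_leE) blast
  have Um: "(indicator U :: real \<Rightarrow> real) \<in> borel_measurable leb01" by (rule variation_le_measurable[OF U(1)])
  have i: "integrable leb01 (\<lambda>x. indicator U x * f x)"
    using bv_le_integrable[OF f] Um by (rule integrable_leb01_mult[where B = 1]) auto
  have K: "0 \<le> K" using f by (rule bv_le_nonneg)
  have "(\<integral>x. \<bar>indicator U x * f x\<bar> \<partial>leb01) \<le> (\<integral>x. \<bar>f x\<bar> \<partial>leb01)"
    using i bv_le_integrable[OF f] by (intro integral_mono) (auto simp: indicator_def)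
  also have "\<dots> \<le> K" by (rule bv_le_L1[OF f])
  also have "\<dots> \<le> (2 * L + 1) * K" using K U(2) by (simp add: algebra_simps)
  finally have L1: "(\<integral>x. \<bar>indicator U x * f x\<bar> \<partial>leb01) \<le> (2 * L + 1) * K" .
  have "variation_le (1 * K + (2 * K) * L) (\<lambda>x. indicator U x * g x)"
    by (rule variation_le_mult[OF U(1) g(2)]) (use g(4) in \<open>auto simp: indicator_def\<close>)
  then have "variation_le ((2 * L + 1) * K) (\<lambda>x. indicator U x * g x)"
    by (simp add: algebra_simps)
  then show ?thesis
    using i g(1) L1 by (intro bv_leI[where g = "\<lambda>x. indicator U x * g x"]) auto
qed

section \<open>Comparison with the extended-valued BV norm\<close>

lemma nn_integral_abs_leb01:
  assumes "integrable leb01 f"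
  shows "L1_norm f = ennreal (\<integral>x. \<bar>f x\<bar> \<partial>leb01)"
  unfolding L1_norm_def using assms by (intro nn_integral_eq_integral) auto

lemma BV_norm_le:
  assumes "bv_le K f"
  shows "BV_norm f \<le> ennreal (2 * K)"
proof -
  obtain g where g: "AE x in leb01. g x = f x" "variation_le K g" using assms by (rule bv_leE) blast
  have "Var f \<le> pointwise_variation g"
    unfolding Var_def using g(1) by (intro INF_lower) auto
  also have "\<dots> \<le> ennreal K" by (rule pointwise_variation_le[OF g(2)])
  finally have "Var f \<le> ennreal K" .
  moreover have "L1_norm f \<le> ennreal K"
    using assms by (auto simp: nn_integral_abs_leb01 bv_le_def intro: ennreal_leI)
  ultimately have "BV_norm f \<le> ennreal K + ennreal K"
    unfolding BV_norm_def by (rule add_mono)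
  also have "\<dots> = ennreal (2 * K)"
    using bv_le_nonneg[OF assms] by (simp flip: ennreal_plus)
  finally show ?thesis .
qed

lemma bv_le_BV: "bv_le K f \<Longrightarrow> f \<in> BV"
proof -
  assume f: "bv_le K f"
  have "Var f \<le> BV_norm f" by (simp add: BV_norm_def)
  also have "\<dots> \<le> ennreal (2 * K)" by (rule BV_norm_le[OF f])
  also have "\<dots> < \<infinity>" by simp
  finally show ?thesis using f by (simp add: BV_def bv_le_def)
qed

text \<open>The strict inequality yields a representative directly from the infimum in
  \<open>Var\<close>, without showing that the infimum is attained.\<close>

lemma bv_le_if_BV_norm:
  assumes f: "integrable leb01 f" and K: "BV_norm f < ennreal K"
  shows "bv_le K f"
proof -
  have K0: "0 \<le> K" using K by (metis ennreal_neg linorder_le_cases not_less_zero)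
  have "Var f \<le> BV_norm f" by (simp add: BV_norm_def)
  with K have "Var f < ennreal K" by (rule le_less_trans[rotated])
  then obtain g where g: "AE x in leb01. g x = f x" "pointwise_variation g < ennreal K"
    unfolding Var_def INF_less_iff by auto
  have "variation_le K g" using g(2) K0 by (intro variation_le_if_pointwise) auto
  moreover have "L1_norm f \<le> BV_norm f" by (simp add: BV_norm_def)
  then have "L1_norm f \<le> ennreal K" using K by simp
  then have "(\<integral>x. \<bar>f x\<bar> \<partial>leb01) \<le> K"
    using K0 by (simp add: nn_integral_abs_leb01[OF f])
  ultimately show ?thesis using f g(1) by (intro bv_leI)
qed

text \<open>
  Choosing everywhere-controlled representatives turns absolute convergence in \<open>BV\<close> into uniform
  convergence, and the dominating functions of the variation simply add up.
\<close>

lemma bv_le_suminf: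
  fixes f :: "nat \<Rightarrow> real \<Rightarrow> real"
  assumes f: "\<And>n. bv_le (K n) (f n)" and K: "summable K"
  obtains h where "\<And>n. bv_le (2 * (\<Sum>i. K (i + n))) (\<lambda>x. h x - (\<Sum>i<n. f i x))"
proof -
  have "\<exists>g. (AE x in leb01. g x = f n x) \<and> variation_le (K n) g \<and> integrable leb01 g \<and>
      (\<forall>x\<in>{0..1}. \<bar>g x\<bar> \<le> 2 * K n)" for n
    by (rule bv_leE[OF f[of n]]) (intro exI conjI; assumption)
  then obtain g where g: "\<And>n. AE x in leb01. g n x = f n x" "\<And>n. variation_le (K n) (g n)"
    "\<And>n. integrable leb01 (g n)" "\<And>n x. x \<in> {0..1} \<Longrightarrow> \<bar>g n x\<bar> \<le> 2 * K n"
    by metis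
  from g(2) obtain v where "\<And>n. increments_le (K n) (v n) (g n)"
    unfolding variation_le_def by metis
  note v' = increments_leD[OF this]
  have v: "\<And>n x. x \<in> {0..1} \<Longrightarrow> v n x \<in> {0..K n}"
    "\<And>n x y. 0 \<le> x \<Longrightarrow> x \<le> y \<Longrightarrow> y \<le> 1 \<Longrightarrow> \<bar>g n y - g n x\<bar> \<le> v n y - v n x"
    using v' by auto
  have K0: "0 \<le> K n" for n using f by (rule bv_le_nonneg)
  have Ks: "summable (\<lambda>i. K (i + n))" for n using K by (rule summable_ignore_initial_segment)
  have gs: "summable (\<lambda>n. g n x)" "summable (\<lambda>n. \<bar>g n x\<bar>)" if "x \<in> {0..1}" for x
    using g(4)[OF that] K
    by (auto intro!: summable_comparison_test'[where g = "\<lambda>n. 2 * K n"] summable_mult)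
  have vs: "summable (\<lambda>n. v n x)" if "x \<in> {0..1}" for x
    using v(1)[OF that] K by (auto intro!: summable_comparison_test'[where g = K])
  define h where "h x = (\<Sum>n. g n x)" for x
  define r where "r n x = (\<Sum>i. g (i + n) x)" for n x
  have rn: "r n x = h x - (\<Sum>i<n. g i x)" if "x \<in> {0..1}" for n x
    using suminf_minus_initial_segment[OF gs(1)[OF that], of n] by (simp add: r_def h_def)
  have rv: "variation_le (\<Sum>i. K (i + n)) (r n)" for n
  proof (rule variation_leI[where v = "\<lambda>x. \<Sum>i. v (i + n) x"])
    fix x :: real assume "0 \<le> x" "x \<le> 1"
    then have x: "x \<in> {0..1}" by simp
    have s: "summable (\<lambda>i. v (i + n) x)" using vs[OF x] by (rule summable_ignore_initial_segment)
    show "0 \<le> (\<Sum>i. v (i + n) x)" using v(1)[OF x] s by (intro suminf_nonneg) auto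
    show "(\<Sum>i. v (i + n) x) \<le> (\<Sum>i. K (i + n))"
      using v(1)[OF x] s Ks by (intro suminf_le) auto
  next
    fix x y :: real assume xy: "0 \<le> x" "x \<le> y" "y \<le> 1"
    then have x: "x \<in> {0..1}" and y: "y \<in> {0..1}" by auto
    note s = gs(1)[OF x, THEN summable_ignore_initial_segment, of n]
      gs(1)[OF y, THEN summable_ignore_initial_segment, of n]
      vs[OF x, THEN summable_ignore_initial_segment, of n]
      vs[OF y, THEN summable_ignore_initial_segment, of n]
    have le: "\<bar>g (i + n) y - g (i + n) x\<bar> \<le> v (i + n) y - v (i + n) x" for i
      using v(2)[OF xy] .
    have sd: "summable (\<lambda>i. \<bar>g (i + n) y - g (i + n) x\<bar>)"
      by (rule summable_comparison_test'[OF summable_diff[OF s(4) s(3)], of 0]) (use le in auto)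
    have "\<bar>r n y - r n x\<bar> = \<bar>\<Sum>i. g (i + n) y - g (i + n) x\<bar>"
      unfolding r_def using s by (simp add: suminf_diff)
    also have "\<dots> \<le> (\<Sum>i. \<bar>g (i + n) y - g (i + n) x\<bar>)"
      using sd by (rule summable_rabs)
    also have "\<dots> \<le> (\<Sum>i. v (i + n) y - v (i + n) x)"
      by (rule suminf_le[OF le sd summable_diff[OF s(4) s(3)]])
    also have "\<dots> = (\<Sum>i. v (i + n) y) - (\<Sum>i. v (i + n) x)"
      using s by (simp add: suminf_diff)
    finally show "\<bar>r n y - r n x\<bar> \<le> (\<Sum>i. v (i + n) y) - (\<Sum>i. v (i + n) x)" .
  qed
  have rb: "\<bar>r n x\<bar> \<le> 2 * (\<Sum>i. K (i + n))" if x: "x \<in> {0..1}" for n x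
  proof -
    have s: "summable (\<lambda>i. \<bar>g (i + n) x\<bar>)" using gs(2)[OF x] by (rule summable_ignore_initial_segment)
    have "\<bar>r n x\<bar> \<le> (\<Sum>i. \<bar>g (i + n) x\<bar>)" unfolding r_def using s by (rule summable_rabs)
    also have "\<dots> \<le> (\<Sum>i. 2 * K (i + n))"
      using g(4)[OF x] s Ks by (intro suminf_le summable_mult) auto
    also have "\<dots> = 2 * (\<Sum>i. K (i + n))" using Ks by (rule suminf_mult)
    finally show ?thesis .
  qed
  have S0: "0 \<le> (\<Sum>i. K (i + n))" for n using Ks K0 by (intro suminf_nonneg)
  \<comment> \<open>The variations add up to the tail sum of \<open>K\<close>, whereas the L1 norm
    is bounded through the supremum, and the representatives are bounded by \<open>2 * K n\<close>:
    hence the factor 2.\<close>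
  have rbv: "bv_le (2 * (\<Sum>i. K (i + n))) (r n)" for n
  proof (rule bv_leI[where g = "r n"])
    show i: "integrable leb01 (r n)"
      using variation_le_measurable[OF rv] rb
      by (intro integrable_leb01_bounded[where B = "2 * (\<Sum>i. K (i + n))"] AE_I2) auto
    have "(\<integral>x. \<bar>r n x\<bar> \<partial>leb01) \<le> (\<integral>x. 2 * (\<Sum>i. K (i + n)) \<partial>leb01)"
      using i rb by (intro integral_mono) auto
    then show "(\<integral>x. \<bar>r n x\<bar> \<partial>leb01) \<le> 2 * (\<Sum>i. K (i + n))" using leb01.prob_space by simp
    show "variation_le (2 * (\<Sum>i. K (i + n))) (r n)"
      using S0[of n] by (intro variation_le_mono[OF rv]) auto
  qed simp
  have hm: "h \<in> borel_measurable leb01"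
  proof -
    have "r 0 \<in> borel_measurable leb01" by (rule variation_le_measurable[OF rv])
    then show ?thesis by (simp add: r_def[abs_def] h_def[abs_def])
  qed
  show thesis
  proof (rule that[of h], rule bv_le_cong_AE[OF rbv])
    fix n
    have "AE x in leb01. \<forall>i\<in>{..<n}. g i x = f i x"
      using g(1) by (subst AE_finite_all) auto
    with AE_space show "AE x in leb01. r n x = h x - (\<Sum>i<n. f i x)"
    proof eventually_elim
      case (elim x)
      then show ?case using rn[of x n] by simp
    qed
    have "f i \<in> borel_measurable leb01" for i using bv_le_integrable[OF f] by auto
    then show "(\<lambda>x. h x - (\<Sum>i<n. f i x)) \<in> borel_measurable leb01"
      using hm by (intro borel_measurable_diff borel_measurable_sum)
  qed
qed

section \<open>Transfer operators\<close>

lemma unit_interval_in_sets_leb01 [simp]: "{0..1} \<in> sets leb01"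
  by (simp add: sets_leb01)

lemma interval_in_sets_leb01:
  assumes "is_interval I" "I \<subseteq> {0..1}"
  shows "I \<in> sets leb01"
proof -
  have "(indicator I :: real \<Rightarrow> real) \<in> borel_measurable leb01"
    using variation_le_indicator_interval[OF assms(1)] by (rule variation_le_measurable)
  then have "I \<inter> space leb01 \<in> sets leb01" by (simp add: borel_measurable_indicator_iff)
  then show ?thesis using assms(2) by (simp add: Int_absorb2)
qed

text \<open>Measurability and nonsingularity of \<open>T\<close> and continuity of the orbit maps
  are derived from these facts. The distance inequality is the mean value theorem for the extension
  \<open>g\<close>, on a segment that lies in the interval \<open>I\<close>.\<close>

lemma uniformly_expanding_branch:
  assumes "uniformly_expanding T A" "I \<in> A"
  shows "I \<in> sets leb01" "continuous_on I T" "\<And>x y. x \<in> I \<Longrightarrow> y \<in> I \<Longrightarrow> \<bar>x - y\<bar> \<le> \<bar>T x - T y\<bar>"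
proof -
  from assms(1) obtain \<kappa> where \<kappa>1: "1 < \<kappa>" and "\<forall>I\<in>A. \<exists>g g' g''.
        (\<forall>x\<in>I. g x = T x) \<and>
        (strict_mono_on (closure I) g \<or> strict_antimono_on (closure I) g) \<and>
        (\<forall>x\<in>closure I. (g has_real_derivative g' x) (at x within closure I)) \<and>
        (\<forall>x\<in>closure I. (g' has_real_derivative g'' x) (at x within closure I)) \<and>
        continuous_on (closure I) g'' \<and>
        (\<forall>x\<in>closure I. \<kappa> \<le> \<bar>g' x\<bar>)"
    unfolding uniformly_expanding_def by (elim conjE exE) (rule that)
  from this(2)[rule_format, OF assms(2)] obtain g g' where "\<forall>x\<in>I. g x = T x"
    "\<forall>x\<in>closure I. (g has_real_derivative g' x) (at x within closure I)"
    "\<forall>x\<in>closure I. \<kappa> \<le> \<bar>g' x\<bar>"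
    by (elim exE conjE) (rule that)
  then have g: "1 < \<kappa>" "\<And>x. x \<in> I \<Longrightarrow> g x = T x"
    and g': "\<And>x. x \<in> closure I \<Longrightarrow> (g has_real_derivative g' x) (at x within closure I)"
    and \<kappa>: "\<And>x. x \<in> closure I \<Longrightarrow> \<kappa> \<le> \<bar>g' x\<bar>"
    using \<kappa>1 by auto
  have I: "is_interval I" "I \<subseteq> {0..1}"
    using assms by (auto simp: uniformly_expanding_def partition_on_def)
  show "I \<in> sets leb01" by (rule interval_in_sets_leb01[OF I])
  have "continuous_on (closure I) g"
    using g' by (rule DERIV_continuous_on)
  then have "continuous_on I g" by (rule continuous_on_subset) (rule closure_subset)
  then show "continuous_on I T" by (rule continuous_on_eq) (use g in auto)
  have *: "\<bar>x - y\<bar> \<le> \<bar>T x - T y\<bar>" if "x \<in> I" "y \<in> I" "x < y" for x y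
  proof -
    have sub: "{x..y} \<subseteq> I" 
      by (rule subsetI) (use mem_is_interval_1_I[OF I(1) that(1,2)] in auto)
    then have sub': "{x..y} \<subseteq> closure I" using closure_subset by blast
    have "\<exists>z\<in>{x<..<y}. g y - g x = g' z * (y - x)"
      using \<open>x < y\<close>
    proof (rule mvt_simple)
      fix z assume "x \<le> z" "z \<le> y"
      then have "z \<in> closure I" using sub' by auto
      from has_field_derivative_subset[OF g'[OF this] sub']
      show "(g has_derivative (*) (g' z)) (at z within {x..y})"
        by (simp add: has_field_derivative_def)
    qed
    then obtain z where z: "z \<in> {x<..<y}" "g y - g x = g' z * (y - x)" by blast
    have "z \<in> closure I" using sub' z(1) by (auto simp: subset_iff)
    then have "1 \<le> \<bar>g' z\<bar>" using \<kappa>[of z] g(1) by simp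
    then have "1 * \<bar>y - x\<bar> \<le> \<bar>g' z\<bar> * \<bar>y - x\<bar>" by (intro mult_right_mono) auto
    also have "\<dots> = \<bar>T y - T x\<bar>" using z(2) g(2) that by (simp add: abs_mult)
    finally show ?thesis by (simp add: abs_minus_commute)
  qed
  show "\<bar>x - y\<bar> \<le> \<bar>T x - T y\<bar>" if "x \<in> I" "y \<in> I" for x y
    using *[OF that] *[OF that(2,1)] by (cases x y rule: linorder_cases) (auto simp: abs_minus_commute)
qed

lemma uniformly_expanding_measurable:
  assumes "uniformly_expanding T A"
  shows "T \<in> measurable leb01 leb01"
proof -
  have A: "finite A" "\<Union>A = {0..1}" "T ` {0..1} \<subseteq> {0..1}"
    using assms by (auto simp: uniformly_expanding_def partition_on_def)
  have "T \<in> measurable leb01 borel"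
  proof (rule measurable_piecewise_restrict)
    show "countable A" using A(1) by (rule countable_finite)
    show "space leb01 \<subseteq> \<Union>A" using A(2) by simp
    fix I assume I: "I \<in> A"
    show "I \<inter> space leb01 \<in> sets leb01"
      using sets.Int[OF uniformly_expanding_branch(1)[OF assms I] sets.top] .
    have "I \<subseteq> {0..1}" using I A(2) by auto
    then have "I \<inter> ({0..1} \<inter> B) = I \<inter> B" for B by auto
    then have "sets (restrict_space leb01 I) = sets (restrict_space borel I)"
      by (simp add: leb01_def sets_restrict_space image_image)
    then show "T \<in> measurable (restrict_space leb01 I) borel"
      using borel_measurable_continuous_on_restrict[OF uniformly_expanding_branch(2)[OF assms I]]
      by (simp cong: measurable_cong_sets)
  qed
  then have "T \<in> measurable leb01 (restrict_space borel {0..1})"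
    using A(3) by (intro measurable_restrict_space2) auto
  then show ?thesis
    by (rule measurable_cong_sets[THEN equalityD1, THEN subsetD, rotated -1])
      (simp_all add: leb01_def sets_restrict_space)
qed

text \<open>On each branch the preimage is the image of a part of \<open>N\<close> under the inverse
  branch. This inverse is 1-Lipschitz since the branch does not contract distances, and Lipschitz
  maps preserve negligible sets.\<close>

lemma uniformly_expanding_nonsingular:
  assumes T: "uniformly_expanding T A" and N: "N \<in> null_sets leb01"
  shows "T -` N \<inter> {0..1} \<in> null_sets leb01"
proof -
  have A: "finite A" "\<Union>A = {0..1}"
    using T by (auto simp: uniformly_expanding_def partition_on_def)
  have N': "N \<subseteq> {0..1}" "N \<in> sets borel" using N null_setsD2 sets_leb01 by blast+
  then have "N \<in> null_sets lborel" using N by (auto simp: null_sets_def emeasure_leb01)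
  then have "N \<in> null_sets lebesgue" by (rule null_sets_completionI)
  then have neg: "negligible N" by (simp add: negligible_iff_null_sets)
  have "negligible (T -` N \<inter> I)" if I: "I \<in> A" for I
  proof -
    note exp = uniformly_expanding_branch(3)[OF T I]
    have inj: "inj_on T I" using exp by (force intro: inj_onI)
    have "T -` N \<inter> I = the_inv_into I T ` (N \<inter> T ` I)"
      using the_inv_into_f_f[OF inj] by (force simp: image_iff)
    moreover have "negligible (the_inv_into I T ` (N \<inter> T ` I))"
    proof (rule negligible_locally_Lipschitz_image)
      show "negligible (N \<inter> T ` I)" using neg by (rule negligible_subset) auto
      fix x assume x: "x \<in> N \<inter> T ` I"
      have "norm (the_inv_into I T y - the_inv_into I T x) \<le> 1 * norm (y - x)"
        if "y \<in> N \<inter> T ` I" for y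
        using that x exp the_inv_into_f_f[OF inj] by auto
      then show "\<exists>U B. open U \<and> x \<in> U \<and>
          (\<forall>y\<in>N \<inter> T ` I \<inter> U. norm (the_inv_into I T y - the_inv_into I T x) \<le> B * norm (y - x))"
        by (intro exI[of _ UNIV] exI[of _ 1]) auto
    qed simp
    ultimately show ?thesis by simp
  qed
  then have "negligible (\<Union>I\<in>A. T -` N \<inter> I)" using A(1) by (intro negligible_Union) auto
  also have "(\<Union>I\<in>A. T -` N \<inter> I) = T -` N \<inter> {0..1}" using A(2) by auto
  finally have "T -` N \<inter> {0..1} \<in> null_sets lebesgue" by (simp add: negligible_iff_null_sets)
  moreover have m: "T -` N \<inter> {0..1} \<in> sets leb01"
    using measurable_sets[OF uniformly_expanding_measurable[OF T] null_setsD2[OF N]] by simp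
  ultimately have "emeasure lborel (T -` N \<inter> {0..1}) = 0"
    using sets_leb01 by (auto simp: null_sets_def)
  then show ?thesis using m by (auto simp: null_sets_def emeasure_leb01)
qed

text \<open>Testing with the sign of \<open>g\<close> gives its L1 norm.\<close>

lemma integral_0_if_tested:
  fixes g :: "real \<Rightarrow> real"
  assumes g: "integrable leb01 g"
    and test: "\<And>\<phi>. \<phi> \<in> borel_measurable leb01 \<Longrightarrow> (\<And>x. \<bar>\<phi> x\<bar> \<le> 1) \<Longrightarrow> (\<integral>x. \<phi> x * g x \<partial>leb01) = 0"
  shows "AE x in leb01. g x = 0"
proof -
  have gm: "g \<in> borel_measurable leb01" using g by auto
  have "(\<integral>x. \<bar>g x\<bar> \<partial>leb01) = (\<integral>x. sgn (g x) * g x \<partial>leb01)"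
    by (intro Bochner_Integration.integral_cong) (auto simp: abs_sgn mult.commute)
  also have "\<dots> = 0" using gm by (intro test) (auto simp: sgn_real_def)
  finally show ?thesis using integral_nonneg_eq_0_iff_AE[of leb01 "\<lambda>x. \<bar>g x\<bar>"] g by auto
qed

text \<open>\<open>D\<close> is the Radon-Nikodym derivative of the image under \<open>T\<close> of
  the measure with density \<psi>; nonsingularity makes this image absolutely continuous.
  Integrability is carried along so that positive and negative parts can be recombined.\<close>

lemma transfer_exists_nonneg:
  fixes \<psi> :: "real \<Rightarrow> real"
  assumes T: "T \<in> measurable leb01 leb01"
    and nonsing: "\<And>N. N \<in> null_sets leb01 \<Longrightarrow> T -` N \<inter> {0..1} \<in> null_sets leb01"
    and \<psi>: "integrable leb01 \<psi>" "\<And>x. 0 \<le> \<psi> x"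
  shows "\<exists>D. integrable leb01 D \<and>
    (\<forall>\<phi> B. \<phi> \<in> borel_measurable leb01 \<longrightarrow> (AE x in leb01. \<bar>\<phi> x\<bar> \<le> B) \<longrightarrow>
       integrable leb01 (\<lambda>x. \<phi> (T x) * \<psi> x) \<and> integrable leb01 (\<lambda>x. \<phi> x * D x) \<and>
       (\<integral>x. \<phi> (T x) * \<psi> x \<partial>leb01) = (\<integral>x. \<phi> x * D x \<partial>leb01))"
proof -
  note [measurable] = T
  have [measurable]: "\<psi> \<in> borel_measurable leb01" using \<psi> by auto
  define M where "M = density leb01 \<psi>"
  define N where "N = distr M leb01 T"
  have TM [measurable]: "T \<in> measurable M leb01" unfolding M_def by simp
  have M_fin: "emeasure M (space M) < \<infinity>"
  proof -
    have "emeasure M (space M) = (\<integral>\<^sup>+x. ennreal (\<psi> x) \<partial>leb01)"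
      unfolding M_def by (subst emeasure_density) (auto intro!: nn_integral_cong)
    also have "\<dots> = ennreal (\<integral>x. \<psi> x \<partial>leb01)"
      using \<psi> by (intro nn_integral_eq_integral) auto
    finally show ?thesis by simp
  qed
  then have "finite_measure M" by (intro finite_measureI) auto
  then have N_fin: "finite_measure N" unfolding N_def by (rule finite_measure.finite_measure_distr) simp
  have sets_N [simp]: "sets N = sets leb01" by (simp add: N_def)
  have ac: "absolutely_continuous leb01 N"
    unfolding absolutely_continuous_def
  proof
    fix S assume S: "S \<in> null_sets leb01"
    then have Sm: "S \<in> sets leb01" by auto
    have "T -` S \<inter> {0..1} \<in> null_sets M"
      using nonsing[OF S] absolutely_continuousI_density[of "\<lambda>x. ennreal (\<psi> x)" leb01]
      unfolding M_def absolutely_continuous_def by auto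
    then have "emeasure N S = 0"
      unfolding N_def using Sm by (subst emeasure_distr) (auto simp: M_def)
    then show "S \<in> null_sets N" using Sm by (intro null_setsI) auto
  qed
  obtain D where D [measurable]: "D \<in> borel_measurable leb01"
    and RN: "AE x in leb01. RN_deriv leb01 N x = ennreal (D x)" and D0: "\<And>x. 0 \<le> D x"
    using leb01.real_RN_deriv[OF N_fin ac sets_N] by metis
  have N_D: "N = density leb01 D"
  proof -
    have "N = density leb01 (RN_deriv leb01 N)"
      using leb01.density_RN_deriv[OF ac sets_N] by simp
    also have "\<dots> = density leb01 D" using RN by (intro density_cong) auto
    finally show ?thesis .
  qed
  show ?thesis
  proof (intro exI[of _ D] conjI allI impI)
    have "integrable N (\<lambda>_. 1 :: real)" using N_fin by (simp add: finite_measure.integrable_const)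
    then show "integrable leb01 D" unfolding N_D using D0 by (subst (asm) integrable_density) auto
    fix \<phi> :: "real \<Rightarrow> real" and B
    assume \<phi> [measurable]: "\<phi> \<in> borel_measurable leb01" and B: "AE x in leb01. \<bar>\<phi> x\<bar> \<le> B"
    have "AE x in N. \<bar>\<phi> x\<bar> \<le> B" by (rule absolutely_continuous_AE[OF sets_N ac B])
    then have i: "integrable N \<phi>"
      using N_fin by (intro finite_measure.integrable_const_bound[where B = B]) (auto simp: N_def)
    have "integrable M (\<lambda>x. \<phi> (T x))"
      using i unfolding N_def by (subst (asm) integrable_distr_eq) auto
    then have 1: "integrable leb01 (\<lambda>x. \<phi> (T x) * \<psi> x)"
      unfolding M_def using \<psi> by (subst (asm) integrable_density) (auto simp: mult.commute)
    have 2: "integrable leb01 (\<lambda>x. \<phi> x * D x)"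
      using i D0 unfolding N_D by (subst (asm) integrable_density) (auto simp: mult.commute)
    have "(\<integral>x. \<phi> (T x) * \<psi> x \<partial>leb01) = (\<integral>x. \<phi> (T x) \<partial>M)"
      unfolding M_def using \<psi> by (subst integral_density) (auto simp: mult.commute)
    also have "\<dots> = (\<integral>x. \<phi> x \<partial>N)" unfolding N_def by (subst integral_distr) auto
    also have "\<dots> = (\<integral>x. \<phi> x * D x \<partial>leb01)"
      unfolding N_D using D0 by (subst integral_density) (auto simp: mult.commute)
    finally show "(\<integral>x. \<phi> (T x) * \<psi> x \<partial>leb01) = (\<integral>x. \<phi> x * D x \<partial>leb01)" .
    show "integrable leb01 (\<lambda>x. \<phi> (T x) * \<psi> x)" "integrable leb01 (\<lambda>x. \<phi> x * D x)"
      by (fact 1 2)+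
  qed
qed

text \<open>\<open>transfer_op\<close> is defined by \<open>SOME\<close>, so its characterisation
  holds once a witness exists. The witness is the difference of those for the positive and the
  negative part of \<psi>.\<close>

lemma transfer_op_spec:
  fixes \<psi> :: "real \<Rightarrow> real"
  assumes T: "T \<in> measurable leb01 leb01"
    and nonsing: "\<And>N. N \<in> null_sets leb01 \<Longrightarrow> T -` N \<inter> {0..1} \<in> null_sets leb01"
    and \<psi>: "integrable leb01 \<psi>"
  shows "integrable leb01 (transfer_op T \<psi>) \<and>
    (\<forall>\<phi>\<in>borel_measurable leb01. (\<exists>B. AE x in leb01. \<bar>\<phi> x\<bar> \<le> B) \<longrightarrow>
       (\<integral>x. \<phi> (T x) * \<psi> x \<partial>leb01) = (\<integral>x. \<phi> x * transfer_op T \<psi> x \<partial>leb01))"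
proof -
  let ?p = "\<lambda>x. max 0 (\<psi> x)" and ?n = "\<lambda>x. max 0 (- \<psi> x)"
  have pn: "\<psi> x = ?p x - ?n x" for x by auto
  obtain D where D: "integrable leb01 D"
    "\<And>\<phi> B. \<phi> \<in> borel_measurable leb01 \<Longrightarrow> AE x in leb01. \<bar>\<phi> x\<bar> \<le> B \<Longrightarrow>
       integrable leb01 (\<lambda>x. \<phi> (T x) * ?p x) \<and> integrable leb01 (\<lambda>x. \<phi> x * D x) \<and>
       (\<integral>x. \<phi> (T x) * ?p x \<partial>leb01) = (\<integral>x. \<phi> x * D x \<partial>leb01)"
    using transfer_exists_nonneg[OF T nonsing, of ?p] \<psi> by auto
  obtain E where E: "integrable leb01 E"
    "\<And>\<phi> B. \<phi> \<in> borel_measurable leb01 \<Longrightarrow> AE x in leb01. \<bar>\<phi> x\<bar> \<le> B \<Longrightarrow>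
       integrable leb01 (\<lambda>x. \<phi> (T x) * ?n x) \<and> integrable leb01 (\<lambda>x. \<phi> x * E x) \<and>
       (\<integral>x. \<phi> (T x) * ?n x \<partial>leb01) = (\<integral>x. \<phi> x * E x \<partial>leb01)"
    using transfer_exists_nonneg[OF T nonsing, of ?n] \<psi> by auto
  have "\<exists>g. integrable leb01 g \<and>
    (\<forall>\<phi>\<in>borel_measurable leb01. (\<exists>B. AE x in leb01. \<bar>\<phi> x\<bar> \<le> B) \<longrightarrow>
       (\<integral>x. \<phi> (T x) * \<psi> x \<partial>leb01) = (\<integral>x. \<phi> x * g x \<partial>leb01))"
  proof (intro exI[of _ "\<lambda>x. D x - E x"] conjI ballI impI)
    show "integrable leb01 (\<lambda>x. D x - E x)" using D(1) E(1) by auto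
    fix \<phi> :: "real \<Rightarrow> real"
    assume \<phi>: "\<phi> \<in> borel_measurable leb01" and "\<exists>B. AE x in leb01. \<bar>\<phi> x\<bar> \<le> B"
    then obtain B where B: "AE x in leb01. \<bar>\<phi> x\<bar> \<le> B" by blast
    note d = D(2)[OF \<phi> B] and e = E(2)[OF \<phi> B]
    have "(\<integral>x. \<phi> (T x) * \<psi> x \<partial>leb01) = (\<integral>x. \<phi> (T x) * ?p x - \<phi> (T x) * ?n x \<partial>leb01)"
      by (subst pn) (simp only: right_diff_distrib)
    also have "\<dots> = (\<integral>x. \<phi> x * D x \<partial>leb01) - (\<integral>x. \<phi> x * E x \<partial>leb01)"
      using d e by (subst Bochner_Integration.integral_diff) auto
    also have "\<dots> = (\<integral>x. \<phi> x * (D x - E x) \<partial>leb01)"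
      using d e by (subst Bochner_Integration.integral_diff[symmetric]) (auto simp: right_diff_distrib)
    finally show "(\<integral>x. \<phi> (T x) * \<psi> x \<partial>leb01) = (\<integral>x. \<phi> x * (D x - E x) \<partial>leb01)" .
  qed
  then show ?thesis unfolding transfer_op_def by (rule someI_ex)
qed

lemma shift_shift: "shift a (shift b \<omega>) = shift (a + b) \<omega>"
  by (simp add: shift_def fun_eq_iff add.assoc)

lemma shift_0 [simp]: "shift 0 \<omega> = \<omega>"
  by (simp add: shift_def)

lemma shift_apply [simp]: "shift a \<omega> i = \<omega> (i + a)"
  by (simp add: shift_def)

lemma orbit_map_add:
  "orbit_map T \<omega> (m + n) x = orbit_map T (shift (int m) \<omega>) n (orbit_map T \<omega> m x)"
  by (induction n) (simp_all add: add.commute)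

lemma transfer_iter_add:
  "transfer_iter T \<omega> (m + n) f = transfer_iter T (shift (int m) \<omega>) n (transfer_iter T \<omega> m f)"
  by (induction n) (simp_all add: add.commute)

lemma orbit_map_cong:
  assumes "\<And>i. 0 \<le> i \<Longrightarrow> i < int n \<Longrightarrow> \<omega> i = \<omega>' i"
  shows "orbit_map T \<omega> n = orbit_map T \<omega>' n"
  using assms by (induction n) auto

lemma transfer_iter_cong:
  assumes "\<And>i. 0 \<le> i \<Longrightarrow> i < int n \<Longrightarrow> \<omega> i = \<omega>' i"
  shows "transfer_iter T \<omega> n = transfer_iter T \<omega>' n"
  using assms by (induction n) auto

locale nonsingular_maps =
  fixes T :: "'q \<Rightarrow> real \<Rightarrow> real"
  assumes T_measurable [measurable]: "\<And>i. T i \<in> measurable leb01 leb01"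
    and T_nonsingular: "\<And>i N. N \<in> null_sets leb01 \<Longrightarrow> T i -` N \<inter> {0..1} \<in> null_sets leb01"
begin

lemma transfer_op_integrable: "integrable leb01 f \<Longrightarrow> integrable leb01 (transfer_op (T i) f)"
  using transfer_op_spec[OF T_measurable T_nonsingular] by blast

lemma transfer_op_dual:
  assumes "integrable leb01 f" "\<phi> \<in> borel_measurable leb01" "\<And>x. x \<in> {0..1} \<Longrightarrow> \<bar>\<phi> x\<bar> \<le> B"
  shows "(\<integral>x. \<phi> (T i x) * f x \<partial>leb01) = (\<integral>x. \<phi> x * transfer_op (T i) f x \<partial>leb01)"
proof -
  have "AE x in leb01. \<bar>\<phi> x\<bar> \<le> B" using assms(3) by (intro AE_I2) auto
  then show ?thesis using transfer_op_spec[OF T_measurable T_nonsingular assms(1)] assms(2) by blast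
qed

lemma orbit_map_measurable [measurable]: "orbit_map T \<omega> n \<in> measurable leb01 leb01"
  by (induction n) (auto simp: id_def)

lemma orbit_map_in: "x \<in> {0..1} \<Longrightarrow> orbit_map T \<omega> n x \<in> {0..1}"
  using measurable_space[OF orbit_map_measurable, of x \<omega> n] by simp

lemma transfer_iter_integrable: "integrable leb01 f \<Longrightarrow> integrable leb01 (transfer_iter T \<omega> n f)"
  by (induction n) (auto intro: transfer_op_integrable)

lemma transfer_iter_dual:
  assumes f: "integrable leb01 f"
    and "\<phi> \<in> borel_measurable leb01" "\<And>x. x \<in> {0..1} \<Longrightarrow> \<bar>\<phi> x\<bar> \<le> B"
  shows "(\<integral>x. \<phi> (orbit_map T \<omega> n x) * f x \<partial>leb01) = (\<integral>x. \<phi> x * transfer_iter T \<omega> n f x \<partial>leb01)"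
  using assms(2,3)
proof (induction n arbitrary: \<phi>)
  case 0
  then show ?case by simp
next
  case (Suc n)
  note [measurable] = Suc.prems(1)
  let ?S = "T (shift (int n) \<omega> 0)"
  have "(\<integral>x. \<phi> (?S (orbit_map T \<omega> n x)) * f x \<partial>leb01)
      = (\<integral>x. \<phi> (?S x) * transfer_iter T \<omega> n f x \<partial>leb01)"
  proof (rule Suc.IH)
    show "(\<lambda>x. \<phi> (?S x)) \<in> borel_measurable leb01" by measurable
    show "\<bar>\<phi> (?S x)\<bar> \<le> B" if "x \<in> {0..1}" for x
      using measurable_space[OF T_measurable, of x] that Suc.prems(2) by auto
  qed
  also have "\<dots> = (\<integral>x. \<phi> x * transfer_op ?S (transfer_iter T \<omega> n f) x \<partial>leb01)"
    by (rule transfer_op_dual[OF transfer_iter_integrable[OF f] Suc.prems])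
  finally show ?case by simp
qed

lemma transfer_iter_integral:
  "integrable leb01 f \<Longrightarrow> (\<integral>x. transfer_iter T \<omega> n f x \<partial>leb01) = (\<integral>x. f x \<partial>leb01)"
  using transfer_iter_dual[of f "\<lambda>_. 1" 1 \<omega> n] by simp

text \<open>The choice in \<open>transfer_op\<close> is made separately for each function, so
  linearity is not built in. It holds almost everywhere because both sides have the same integral
  against every bounded test function.\<close>

lemma transfer_iter_diff:
  assumes f: "integrable leb01 f" and g: "integrable leb01 g"
  shows "AE x in leb01. transfer_iter T \<omega> n (\<lambda>x. f x - g x) x = transfer_iter T \<omega> n f x - transfer_iter T \<omega> n g x"
proof -
  let ?P = "transfer_iter T \<omega> n"
  have fg: "integrable leb01 (\<lambda>x. f x - g x)" using f g by auto
  note i = transfer_iter_integrable[OF f, of \<omega> n] transfer_iter_integrable[OF g, of \<omega> n]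
    transfer_iter_integrable[OF fg, of \<omega> n]
  have "AE x in leb01. ?P (\<lambda>x. f x - g x) x - (?P f x - ?P g x) = 0"
  proof (rule integral_0_if_tested)
    fix \<phi> :: "real \<Rightarrow> real" assume \<phi>: "\<phi> \<in> borel_measurable leb01" "\<And>x. \<bar>\<phi> x\<bar> \<le> 1"
    have m: "(\<lambda>x. \<phi> (orbit_map T \<omega> n x)) \<in> borel_measurable leb01" using \<phi>(1) by measurable
    have int: "integrable leb01 (\<lambda>x. \<phi> x * u x)" "integrable leb01 (\<lambda>x. \<phi> (orbit_map T \<omega> n x) * u x)"
      if "integrable leb01 u" for u
      using \<phi> m that by (auto intro!: integrable_leb01_mult[where B = 1])
    have "(\<integral>x. \<phi> x * (?P (\<lambda>x. f x - g x) x - (?P f x - ?P g x)) \<partial>leb01) =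
      (\<integral>x. \<phi> x * ?P (\<lambda>x. f x - g x) x \<partial>leb01) - ((\<integral>x. \<phi> x * ?P f x \<partial>leb01) - (\<integral>x. \<phi> x * ?P g x \<partial>leb01))"
      using int(1)[OF i(1)] int(1)[OF i(2)] int(1)[OF i(3)] by (simp add: right_diff_distrib)
    also have "\<dots> = (\<integral>x. \<phi> (orbit_map T \<omega> n x) * (f x - g x) \<partial>leb01) -
      ((\<integral>x. \<phi> (orbit_map T \<omega> n x) * f x \<partial>leb01) - (\<integral>x. \<phi> (orbit_map T \<omega> n x) * g x \<partial>leb01))"
      using transfer_iter_dual[OF f \<phi>(1), of 1] transfer_iter_dual[OF g \<phi>(1), of 1]
        transfer_iter_dual[OF fg \<phi>(1), of 1] \<phi>(2) by simp
    also have "\<dots> = 0"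
      using int(2)[OF f] int(2)[OF g] by (simp add: right_diff_distrib)
    finally show "(\<integral>x. \<phi> x * (?P (\<lambda>x. f x - g x) x - (?P f x - ?P g x)) \<partial>leb01) = 0" .
  qed (use i in auto)
  then show ?thesis by eventually_elim auto
qed

end

section \<open>Sample measures\<close>

text \<open>The one-step bound of (LY), (Dec) and (Min), restated with \<open>bv_le\<close>.
  \<open>decay\<close> includes \<open>n = 0\<close>, on which (Dec) is silent; for this reason the
  instance built later has \<open>C\<close> at least 1. The condition \<open>0 < K\<close> leaves
  room for the strict inequality in \<open>bv_le_if_BV_norm\<close>.\<close>

locale mixing_maps = nonsingular_maps T for T :: "'q \<Rightarrow> real \<Rightarrow> real" +
  fixes M C \<theta> c :: real
  assumes M_pos: "0 < M" and C_pos: "0 < C" and \<theta>_pos: "0 < \<theta>" and \<theta>_less: "\<theta> < 1" and c_pos: "0 < c"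
    and transfer_op_bv: "\<And>K f i. bv_le K f \<Longrightarrow> 0 < K \<Longrightarrow> bv_le (M * K) (transfer_op (T i) f)"
    and decay: "\<And>K f n \<omega>. bv_le K f \<Longrightarrow> 0 < K \<Longrightarrow> (\<integral>x. f x \<partial>leb01) = 0 \<Longrightarrow>
      bv_le (C * \<theta> ^ n * K) (transfer_iter T \<omega> n f)"
    and lower_bound: "\<And>n \<omega>. 1 \<le> n \<Longrightarrow> AE x in leb01. c \<le> transfer_iter T \<omega> n (\<lambda>_. 1) x"
begin

definition pushed :: "(int \<Rightarrow> 'q) \<Rightarrow> nat \<Rightarrow> real \<Rightarrow> real" where
  "pushed \<omega> n = transfer_iter T (shift (- int n) \<omega>) n (\<lambda>_. 1)"

text \<open>\<open>E * \<theta> ^ n\<close> is twice the tail from \<open>n\<close> on of the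
  geometric series that bounds the increments of \<open>pushed\<close>; the 2 is that of
  \<open>bv_le_suminf\<close>.\<close>

definition E :: real where "E = 2 * (C * (M + 1)) / (1 - \<theta>)"

lemma E_pos: "0 < E"
  using M_pos C_pos \<theta>_less by (auto simp: E_def)

lemma pushed_integrable: "integrable leb01 (pushed \<omega> n)"
  unfolding pushed_def by (rule transfer_iter_integrable) simp

lemma pushed_integral: "(\<integral>x. pushed \<omega> n x \<partial>leb01) = 1"
  unfolding pushed_def using leb01.prob_space by (subst transfer_iter_integral) auto

text \<open>Starting one step further in the past replaces the initial density 1 by its image under
  one operator. The difference of the two has integral 0, and the \<open>n\<close> remaining steps
  contract it.\<close>

lemma pushed_increment: "bv_le (C * (M + 1) * \<theta> ^ n) (\<lambda>x. pushed \<omega> (Suc n) x - pushed \<omega> n x)"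
proof -
  let ?S = "transfer_op (T (shift (- int (Suc n)) \<omega> 0))" and ?Q = "transfer_iter T (shift (- int n) \<omega>) n"
  have P1: "bv_le (M * 1) (?S (\<lambda>_. 1))" by (rule transfer_op_bv) (auto intro: bv_le_const)
  then have f: "bv_le (M * 1 + 1) (\<lambda>x. ?S (\<lambda>_. 1) x - 1)"
    by (rule bv_le_diff) (rule bv_le_const, simp)
  have "(\<integral>x. ?S (\<lambda>_. 1) x \<partial>leb01) = 1"
    using transfer_op_dual[of "\<lambda>_. 1" "\<lambda>_. 1" 1] leb01.prob_space by simp
  then have "(\<integral>x. ?S (\<lambda>_. 1) x - 1 \<partial>leb01) = 0"
    using bv_le_integrable[OF P1] leb01.prob_space by simp
  with f have bv: "bv_le (C * \<theta> ^ n * (M * 1 + 1)) (?Q (\<lambda>x. ?S (\<lambda>_. 1) x - 1))"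
    using M_pos by (intro decay) auto
  have suc: "pushed \<omega> (Suc n) = ?Q (?S (\<lambda>_. 1))"
    unfolding pushed_def using transfer_iter_add[of T "shift (- int (Suc n)) \<omega>" 1 n "\<lambda>_. 1"]
    by (simp add: shift_shift)
  have "AE x in leb01. ?Q (\<lambda>x. ?S (\<lambda>_. 1) x - 1) x = ?Q (?S (\<lambda>_. 1)) x - ?Q (\<lambda>_. 1) x"
    by (rule transfer_iter_diff) (use bv_le_integrable[OF P1] in auto)
  then have "AE x in leb01. ?Q (\<lambda>x. ?S (\<lambda>_. 1) x - 1) x = pushed \<omega> (Suc n) x - pushed \<omega> n x"
    by (simp only: suc) (simp add: pushed_def)
  with bv have "bv_le (C * \<theta> ^ n * (M * 1 + 1)) (\<lambda>x. pushed \<omega> (Suc n) x - pushed \<omega> n x)"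
    using pushed_integrable by (rule_tac bv_le_cong_AE) auto
  then show ?thesis by (simp add: mult_ac)
qed

lemma limit_density_exists: "\<exists>h. \<forall>n. bv_le (E * \<theta> ^ n) (\<lambda>x. h x - pushed \<omega> n x)"
proof -
  let ?K = "\<lambda>n. C * (M + 1) * \<theta> ^ n" and ?d = "\<lambda>n x. pushed \<omega> (Suc n) x - pushed \<omega> n x"
  have sum: "(\<lambda>i. ?K (i + n)) sums (C * (M + 1) * \<theta> ^ n * (1 / (1 - \<theta>)))" for n
  proof -
    have "(\<lambda>i. C * (M + 1) * \<theta> ^ n * \<theta> ^ i) sums (C * (M + 1) * \<theta> ^ n * (1 / (1 - \<theta>)))"
      using \<theta>_pos \<theta>_less by (intro sums_mult geometric_sums) auto
    then show ?thesis by (simp add: power_add mult_ac)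
  qed
  have summ: "summable ?K" using sum[of 0] by (simp add: sums_iff)
  obtain h where h: "\<And>n. bv_le (2 * (\<Sum>i. ?K (i + n))) (\<lambda>x. h x - (\<Sum>i<n. ?d i x))"
    using bv_le_suminf[of ?K ?d, OF pushed_increment summ] by blast
  have "bv_le (E * \<theta> ^ n) (\<lambda>x. (h x + 1) - pushed \<omega> n x)" for n
  proof -
    \<comment> \<open>The telescoping sum leaves \<open>pushed \<omega> 0\<close>, which is the
      constant 1.\<close>
    have eq: "h x - (\<Sum>i<n. ?d i x) = h x + 1 - pushed \<omega> n x" for x
      by (subst sum_lessThan_telescope) (simp add: pushed_def)
    have "2 * (\<Sum>i. ?K (i + n)) = E * \<theta> ^ n"
      unfolding sums_unique[OF sum[of n], symmetric] by (simp add: E_def)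
    then show ?thesis using h[of n] unfolding eq by (simp only:)
  qed
  then show ?thesis by (intro exI[of _ "\<lambda>x. h x + 1"]) auto
qed

abbreviation h :: "(int \<Rightarrow> 'q) \<Rightarrow> real \<Rightarrow> real" where
  "h \<equiv> sample_density T"

text \<open>The series limit \<open>g\<close> shows that the choice in \<open>sample_density\<close>
  is possible. The chosen density and \<open>g\<close> are both L1 limits of \<open>pushed\<close>,
  so they agree almost everywhere and the geometric rate passes from \<open>g\<close> to
  \<open>h \<omega>\<close>.\<close>

lemma sample_density_approx: "bv_le (E * \<theta> ^ n) (\<lambda>x. h \<omega> x - pushed \<omega> n x)"
proof -
  obtain g where g: "\<And>n. bv_le (E * \<theta> ^ n) (\<lambda>x. g x - pushed \<omega> n x)"
    using limit_density_exists by blast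
  have pow0: "(\<lambda>n. E * \<theta> ^ n) \<longlonglongrightarrow> 0"
    using \<theta>_pos \<theta>_less by (intro tendsto_mult_right_zero LIMSEQ_power_zero) auto
  have gi: "integrable leb01 g"
    using bv_le_integrable[OF g[of 0]] Bochner_Integration.integrable_add[OF bv_le_integrable[OF g[of 0]] pushed_integrable[of \<omega> 0]] by simp
  have "bv_le (E + 1) (\<lambda>x. (g x - pushed \<omega> 0 x) - (- 1))"
    using g[of 0] by (intro bv_le_diff bv_le_const) auto
  then have "g \<in> BV" by (intro bv_le_BV[of "E + 1"]) (simp add: pushed_def)
  moreover have "(\<lambda>n. BV_norm (\<lambda>x. pushed \<omega> n x - g x)) \<longlonglongrightarrow> 0"
  proof (rule tendsto_sandwich[OF _ _ tendsto_const])
    have "bv_le (\<bar>-1\<bar> * (E * \<theta> ^ n)) (\<lambda>x. (- 1) * (g x - pushed \<omega> n x))" for n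
      by (rule bv_le_cmult[OF g])
    then have "bv_le (E * \<theta> ^ n) (\<lambda>x. pushed \<omega> n x - g x)" for n by simp
    then show "\<forall>\<^sub>F n in sequentially. BV_norm (\<lambda>x. pushed \<omega> n x - g x) \<le> ennreal (2 * (E * \<theta> ^ n))"
      by (auto intro!: BV_norm_le always_eventually)
    have "(\<lambda>n. 2 * (E * \<theta> ^ n)) \<longlonglongrightarrow> 2 * 0" using pow0 by (rule tendsto_mult_left)
    then have "(\<lambda>n. ennreal (2 * (E * \<theta> ^ n))) \<longlonglongrightarrow> ennreal (2 * 0)" by (rule tendsto_ennrealI)
    then show "(\<lambda>n. ennreal (2 * (E * \<theta> ^ n))) \<longlonglongrightarrow> 0" by simp
  qed auto
  ultimately have "\<exists>g. g \<in> BV \<and> (\<lambda>n. BV_norm (\<lambda>x. transfer_iter T (shift (- int n) \<omega>) n (\<lambda>_. 1) x - g x)) \<longlonglongrightarrow> 0"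
    unfolding pushed_def by blast
  then have h: "h \<omega> \<in> BV \<and> (\<lambda>n. BV_norm (\<lambda>x. pushed \<omega> n x - h \<omega> x)) \<longlonglongrightarrow> 0"
    unfolding sample_density_def pushed_def by (rule someI_ex)
  then have hi: "integrable leb01 (h \<omega>)" by (simp add: BV_def)
  have "(\<lambda>n. L1_norm (\<lambda>x. pushed \<omega> n x - h \<omega> x)) \<longlonglongrightarrow> 0"
    by (rule tendsto_sandwich[OF _ _ tendsto_const conjunct2[OF h]]) (auto simp: BV_norm_def)
  then have "(\<lambda>n. ennreal (\<integral>x. \<bar>pushed \<omega> n x - h \<omega> x\<bar> \<partial>leb01)) \<longlonglongrightarrow> ennreal 0"
    using hi pushed_integrable by (simp add: nn_integral_abs_leb01)
  then have L1: "(\<lambda>n. \<integral>x. \<bar>pushed \<omega> n x - h \<omega> x\<bar> \<partial>leb01) \<longlonglongrightarrow> 0"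
    by (subst (asm) tendsto_ennreal_iff) auto
  have "(\<integral>x. \<bar>g x - h \<omega> x\<bar> \<partial>leb01) \<le> 0"
  proof (rule LIMSEQ_le_const)
    show "(\<lambda>n. E * \<theta> ^ n + (\<integral>x. \<bar>pushed \<omega> n x - h \<omega> x\<bar> \<partial>leb01)) \<longlonglongrightarrow> 0"
      using tendsto_add[OF pow0 L1] by simp
    have "(\<integral>x. \<bar>g x - h \<omega> x\<bar> \<partial>leb01) \<le> E * \<theta> ^ n + (\<integral>x. \<bar>pushed \<omega> n x - h \<omega> x\<bar> \<partial>leb01)" for n
    proof -
      have "(\<integral>x. \<bar>g x - h \<omega> x\<bar> \<partial>leb01) \<le> (\<integral>x. \<bar>g x - pushed \<omega> n x\<bar> + \<bar>pushed \<omega> n x - h \<omega> x\<bar> \<partial>leb01)"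
        using gi hi pushed_integrable by (intro integral_mono) auto
      also have "\<dots> = (\<integral>x. \<bar>g x - pushed \<omega> n x\<bar> \<partial>leb01) + (\<integral>x. \<bar>pushed \<omega> n x - h \<omega> x\<bar> \<partial>leb01)"
        using gi hi pushed_integrable by (intro Bochner_Integration.integral_add) auto
      finally show ?thesis using bv_le_L1[OF g[of n]] by simp
    qed
    then show "\<exists>N. \<forall>n\<ge>N. (\<integral>x. \<bar>g x - h \<omega> x\<bar> \<partial>leb01) \<le> E * \<theta> ^ n + (\<integral>x. \<bar>pushed \<omega> n x - h \<omega> x\<bar> \<partial>leb01)"
      by blast
  qed
  moreover have "0 \<le> (\<integral>x. \<bar>g x - h \<omega> x\<bar> \<partial>leb01)" by simp
  ultimately have "(\<integral>x. \<bar>g x - h \<omega> x\<bar> \<partial>leb01) = 0" by linarith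
  then have "AE x in leb01. \<bar>g x - h \<omega> x\<bar> = 0"
    using gi hi by (subst (asm) integral_nonneg_eq_0_iff_AE) auto
  then have "AE x in leb01. g x - pushed \<omega> n x = h \<omega> x - pushed \<omega> n x" by eventually_elim auto
  then show ?thesis using g[of n] hi pushed_integrable[of \<omega> n] by (rule_tac bv_le_cong_AE) auto
qed

text \<open>The approximation error at \<open>n = 0\<close>, where \<open>pushed\<close> is the
  constant 1, plus the bound of that constant.\<close>

definition H :: real where "H = E + 1"

lemma H_pos: "0 < H"
  using E_pos by (simp add: H_def)

lemma h_bv: "bv_le H (h \<omega>)"
proof -
  have "bv_le (E + 1) (\<lambda>x. (h \<omega> x - pushed \<omega> 0 x) - (- 1))"
    using sample_density_approx[of 0 \<omega>] by (intro bv_le_diff bv_le_const) auto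
  then show ?thesis by (simp add: pushed_def H_def)
qed

lemma h_integrable [simp]: "integrable leb01 (h \<omega>)"
  using h_bv by (rule bv_le_integrable)

lemma h_measurable [measurable]: "h \<omega> \<in> borel_measurable leb01"
  using h_integrable by (rule borel_measurable_integrable)

lemma h_upper: "AE x in leb01. \<bar>h \<omega> x\<bar> \<le> 2 * H"
  by (rule bv_le_bounded[OF h_bv])

lemma E_power_tendsto_0: "(\<lambda>n. a * (E * \<theta> ^ n)) \<longlonglongrightarrow> 0"
  using \<theta>_pos \<theta>_less by (intro tendsto_mult_right_zero LIMSEQ_power_zero) auto

lemma h_lower: "AE x in leb01. c \<le> h \<omega> x"
proof -
  have "AE x in leb01. \<forall>n. \<bar>h \<omega> x - pushed \<omega> n x\<bar> \<le> 2 * (E * \<theta> ^ n)"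
    using bv_le_bounded[OF sample_density_approx] by (subst AE_all_countable) auto
  moreover have "AE x in leb01. \<forall>n. 1 \<le> n \<longrightarrow> c \<le> pushed \<omega> n x"
    using lower_bound by (subst AE_all_countable) (auto simp: pushed_def)
  ultimately show ?thesis
  proof eventually_elim
    case (elim x)
    have "(\<lambda>n. c - 2 * (E * \<theta> ^ n)) \<longlonglongrightarrow> c - 0"
      by (intro tendsto_diff tendsto_const E_power_tendsto_0)
    moreover have "\<forall>n\<ge>1. c - 2 * (E * \<theta> ^ n) \<le> h \<omega> x"
      using elim by (auto simp: abs_le_iff) (smt (verit))
    ultimately show ?case by (intro LIMSEQ_le_const2[of _ c]) auto
  qed
qed

lemma integral_test_approx:
  assumes \<phi>: "\<phi> \<in> borel_measurable leb01" "\<And>x. x \<in> {0..1} \<Longrightarrow> \<bar>\<phi> x\<bar> \<le> B"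
  shows "\<bar>(\<integral>x. \<phi> x * h \<omega> x \<partial>leb01) - (\<integral>x. \<phi> x * pushed \<omega> n x \<partial>leb01)\<bar> \<le> B * (E * \<theta> ^ n)"
proof -
  have AEB: "AE x in leb01. \<bar>\<phi> x\<bar> \<le> B" using \<phi>(2) by (intro AE_I2) auto
  have B: "0 \<le> B" using \<phi>(2)[of 0] by auto
  note i = integrable_leb01_mult[OF h_integrable \<phi>(1) AEB, of \<omega>]
    integrable_leb01_mult[OF pushed_integrable \<phi>(1) AEB, of \<omega> n]
  have "\<bar>(\<integral>x. \<phi> x * h \<omega> x \<partial>leb01) - (\<integral>x. \<phi> x * pushed \<omega> n x \<partial>leb01)\<bar>
      = \<bar>\<integral>x. \<phi> x * (h \<omega> x - pushed \<omega> n x) \<partial>leb01\<bar>"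
    using i by (simp add: right_diff_distrib)
  also have "\<dots> \<le> (\<integral>x. \<bar>\<phi> x * (h \<omega> x - pushed \<omega> n x)\<bar> \<partial>leb01)"
    using integral_norm_bound[of leb01 "\<lambda>x. \<phi> x * (h \<omega> x - pushed \<omega> n x)"] by simp
  also have "\<dots> \<le> (\<integral>x. B * \<bar>h \<omega> x - pushed \<omega> n x\<bar> \<partial>leb01)"
  proof (rule integral_mono)
    have hp: "integrable leb01 (\<lambda>x. h \<omega> x - pushed \<omega> n x)" using pushed_integrable by auto
    show "integrable leb01 (\<lambda>x. \<bar>\<phi> x * (h \<omega> x - pushed \<omega> n x)\<bar>)"
      using integrable_leb01_mult[OF hp \<phi>(1) AEB] by (rule integrable_abs)
    show "integrable leb01 (\<lambda>x. B * \<bar>h \<omega> x - pushed \<omega> n x\<bar>)" using hp by auto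
    fix x assume "x \<in> space leb01"
    then show "\<bar>\<phi> x * (h \<omega> x - pushed \<omega> n x)\<bar> \<le> B * \<bar>h \<omega> x - pushed \<omega> n x\<bar>"
      using \<phi>(2)[of x] by (simp add: abs_mult mult_right_mono)
  qed
  also have "\<dots> = B * (\<integral>x. \<bar>h \<omega> x - pushed \<omega> n x\<bar> \<partial>leb01)" by simp
  also have "\<dots> \<le> B * (E * \<theta> ^ n)"
    using bv_le_L1[OF sample_density_approx] B by (intro mult_left_mono)
  finally show ?thesis .
qed

lemma h_integral: "(\<integral>x. h \<omega> x \<partial>leb01) = 1"
proof -
  have "\<bar>(\<integral>x. h \<omega> x \<partial>leb01) - 1\<bar> \<le> 0"
  proof (rule LIMSEQ_le_const[OF E_power_tendsto_0[of 1]])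
    show "\<exists>N. \<forall>n\<ge>N. \<bar>(\<integral>x. h \<omega> x \<partial>leb01) - 1\<bar> \<le> 1 * (E * \<theta> ^ n)"
      using integral_test_approx[of "\<lambda>_. 1" 1 \<omega>] by (simp add: pushed_integral)
  qed
  then show ?thesis by simp
qed

text \<open>Equivariance of the densities under the transfer operator, in dual form: one operator
  turns \<open>pushed \<omega> n\<close> into \<open>pushed (shift 1 \<omega>) (Suc n)\<close>, and
  the integrals against \<phi> converge on both sides.\<close>

lemma h_push:
  assumes \<phi>: "\<phi> \<in> borel_measurable leb01" "\<And>x. x \<in> {0..1} \<Longrightarrow> \<bar>\<phi> x\<bar> \<le> B"
  shows "(\<integral>x. \<phi> (T (\<omega> 0) x) * h \<omega> x \<partial>leb01) = (\<integral>x. \<phi> x * h (shift 1 \<omega>) x \<partial>leb01)"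
proof -
  let ?I = "\<integral>x. \<phi> (T (\<omega> 0) x) * h \<omega> x \<partial>leb01" and ?J = "\<integral>x. \<phi> x * h (shift 1 \<omega>) x \<partial>leb01"
  have \<phi>T: "(\<lambda>x. \<phi> (T (\<omega> 0) x)) \<in> borel_measurable leb01" using \<phi>(1) by measurable
  have \<phi>B: "\<bar>\<phi> (T (\<omega> 0) x)\<bar> \<le> B" if "x \<in> {0..1}" for x
    using \<phi>(2) that measurable_space[OF T_measurable, of x] by auto
  have "\<bar>?I - ?J\<bar> \<le> 0"
  proof (rule LIMSEQ_le_const[OF E_power_tendsto_0[of "B * (1 + \<theta>)"]])
    have "\<bar>?I - ?J\<bar> \<le> B * (1 + \<theta>) * (E * \<theta> ^ n)" for n
    proof -
      have "pushed (shift 1 \<omega>) (Suc n) = transfer_op (T (\<omega> 0)) (pushed \<omega> n)"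
        by (simp add: pushed_def shift_shift)
      then have "(\<integral>x. \<phi> (T (\<omega> 0) x) * pushed \<omega> n x \<partial>leb01)
          = (\<integral>x. \<phi> x * pushed (shift 1 \<omega>) (Suc n) x \<partial>leb01)"
        using transfer_op_dual[OF pushed_integrable \<phi>] by simp
      then have "\<bar>?I - ?J\<bar> \<le> B * (E * \<theta> ^ n) + B * (E * \<theta> ^ Suc n)"
        using integral_test_approx[OF \<phi>T \<phi>B, of \<omega> n] integral_test_approx[OF \<phi>, of "shift 1 \<omega>" "Suc n"]
        by linarith
      then show ?thesis by (simp add: algebra_simps)
    qed
    then show "\<exists>N. \<forall>n\<ge>N. \<bar>?I - ?J\<bar> \<le> B * (1 + \<theta>) * (E * \<theta> ^ n)" by blast
  qed
  then show ?thesis by simp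
qed

abbreviation \<nu> :: "(int \<Rightarrow> 'q) \<Rightarrow> real measure" where
  "\<nu> \<equiv> sample_measure T"

lemma sets_\<nu> [simp, measurable_cong]: "sets (\<nu> \<omega>) = sets leb01"
  by (simp add: sample_measure_def)

lemma space_\<nu> [simp]: "space (\<nu> \<omega>) = {0..1}"
  by (simp add: sample_measure_def)

lemma h_nonneg: "AE x in leb01. 0 \<le> h \<omega> x"
  using h_lower[of \<omega>] by eventually_elim (use c_pos in simp)

lemma integral_\<nu>:
  fixes \<phi> :: "real \<Rightarrow> real"
  assumes "\<phi> \<in> borel_measurable leb01"
  shows "(\<integral>x. \<phi> x \<partial>\<nu> \<omega>) = (\<integral>x. \<phi> x * h \<omega> x \<partial>leb01)"
  unfolding sample_measure_def using assms h_nonneg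
  by (subst integral_density) (auto simp: mult.commute)

lemma prob_space_\<nu>: "prob_space (\<nu> \<omega>)"
proof
  have "emeasure (\<nu> \<omega>) (space (\<nu> \<omega>)) = (\<integral>\<^sup>+x. ennreal (h \<omega> x) \<partial>leb01)"
    unfolding sample_measure_def by (subst emeasure_density) (auto intro!: nn_integral_cong)
  also have "\<dots> = ennreal (\<integral>x. h \<omega> x \<partial>leb01)"
    using h_nonneg by (intro nn_integral_eq_integral) auto
  finally show "emeasure (\<nu> \<omega>) (space (\<nu> \<omega>)) = 1" by (simp add: h_integral)
qed

sublocale \<nu>: prob_space "\<nu> \<omega>" for \<omega>
  by (rule prob_space_\<nu>)

lemma measure_\<nu>:
  assumes "U \<in> sets leb01"
  shows "measure (\<nu> \<omega>) U = (\<integral>x. indicator U x * h \<omega> x \<partial>leb01)"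
proof -
  have "measure (\<nu> \<omega>) U = (\<integral>x. indicator U x \<partial>\<nu> \<omega>)"
    using assms sets.sets_into_space[OF assms] by (simp add: Int_absorb2)
  also have "\<dots> = (\<integral>x. indicator U x * h \<omega> x \<partial>leb01)" using assms by (intro integral_\<nu>) auto
  finally show ?thesis .
qed

lemma measure_\<nu>_le:
  assumes "U \<in> sets leb01"
  shows "measure (\<nu> \<omega>) U \<le> 2 * H * measure leb01 U"
proof -
  have "measure (\<nu> \<omega>) U \<le> (\<integral>x. 2 * H * indicator U x \<partial>leb01)"
    unfolding measure_\<nu>[OF assms]
  proof (rule integral_mono_AE)
    show "integrable leb01 (\<lambda>x. indicator U x * h \<omega> x)"
      using assms by (intro integrable_leb01_mult[where B = 1]) auto
    show "AE x in leb01. indicator U x * h \<omega> x \<le> 2 * H * indicator U x"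
      using h_upper[of \<omega>] by eventually_elim (auto simp: indicator_def)
  qed (use assms in \<open>auto intro!: integrable_mult_right integrable_leb01_bounded[where B = 1]\<close>)
  also have "\<dots> = 2 * H * measure leb01 U"
    using assms sets.sets_into_space[OF assms] by (simp add: Int_absorb2)
  finally show ?thesis .
qed

lemma measure_\<nu>_ge:
  assumes "U \<in> sets leb01"
  shows "c * measure leb01 U \<le> measure (\<nu> \<omega>) U"
proof -
  have "c * measure leb01 U = (\<integral>x. c * indicator U x \<partial>leb01)"
    using assms sets.sets_into_space[OF assms] by (simp add: Int_absorb2)
  also have "\<dots> \<le> measure (\<nu> \<omega>) U"
    unfolding measure_\<nu>[OF assms]
  proof (rule integral_mono_AE)
    show "integrable leb01 (\<lambda>x. indicator U x * h \<omega> x)"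
      using assms by (intro integrable_leb01_mult[where B = 1]) auto
    show "AE x in leb01. c * indicator U x \<le> indicator U x * h \<omega> x"
      using h_lower[of \<omega>] by eventually_elim (auto simp: indicator_def)
  qed (use assms in \<open>auto intro!: integrable_mult_right integrable_leb01_bounded[where B = 1]\<close>)
  finally show ?thesis .
qed

lemma integral_orbit:
  assumes "\<phi> \<in> borel_measurable leb01" "\<And>x. x \<in> {0..1} \<Longrightarrow> \<bar>\<phi> x\<bar> \<le> B"
  shows "(\<integral>x. \<phi> (orbit_map T \<omega> n x) * h \<omega> x \<partial>leb01) = (\<integral>x. \<phi> x * h (shift (int n) \<omega>) x \<partial>leb01)"
  using assms
proof (induction n arbitrary: \<phi>)
  case 0
  then show ?case by simp
next
  case (Suc n)
  note [measurable] = Suc.prems(1)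
  let ?S = "T (shift (int n) \<omega> 0)"
  have "(\<integral>x. \<phi> (?S (orbit_map T \<omega> n x)) * h \<omega> x \<partial>leb01) = (\<integral>x. \<phi> (?S x) * h (shift (int n) \<omega>) x \<partial>leb01)"
  proof (rule Suc.IH)
    show "(\<lambda>x. \<phi> (?S x)) \<in> borel_measurable leb01" by measurable
    show "\<bar>\<phi> (?S x)\<bar> \<le> B" if "x \<in> {0..1}" for x
      using measurable_space[OF T_measurable, of x] that Suc.prems(2) by auto
  qed
  also have "\<dots> = (\<integral>x. \<phi> x * h (shift 1 (shift (int n) \<omega>)) x \<partial>leb01)"
    by (rule h_push[OF Suc.prems])
  also have "shift 1 (shift (int n) \<omega>) = shift (int (Suc n)) \<omega>"
    by (simp only: shift_shift of_nat_Suc)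
  finally show ?case by (simp only: orbit_map.simps comp_apply)
qed

lemma orbit_vimage_in_sets:
  "U \<in> sets leb01 \<Longrightarrow> {x\<in>{0..1}. orbit_map T \<omega> n x \<in> U} \<in> sets leb01"
  using measurable_sets[OF orbit_map_measurable, of U \<omega> n] by (simp add: vimage_def Int_def conj_commute)

lemma measure_orbit_vimage:
  assumes "U \<in> sets leb01"
  shows "measure (\<nu> \<omega>) {x\<in>{0..1}. orbit_map T \<omega> n x \<in> U} = measure (\<nu> (shift (int n) \<omega>)) U"
proof -
  have "measure (\<nu> \<omega>) {x\<in>{0..1}. orbit_map T \<omega> n x \<in> U} = (\<integral>x. indicator U (orbit_map T \<omega> n x) * h \<omega> x \<partial>leb01)"
    unfolding measure_\<nu>[OF orbit_vimage_in_sets[OF assms]]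
    by (intro Bochner_Integration.integral_cong) (auto simp: indicator_def)
  also have "\<dots> = (\<integral>x. indicator U x * h (shift (int n) \<omega>) x \<partial>leb01)"
    using assms by (intro integral_orbit[where B = 1]) auto
  finally show ?thesis using measure_\<nu>[OF assms] by simp
qed

text \<open>The difference is the integral of \<open>indicator V\<close> against the
  \<open>n\<close>-th image of \<open>f\<close>, which has integral 0 and BV bound
  \<open>2 * (L + 1) * H\<close>. Thus bounded variation is asked of \<open>U\<close> alone, while
  \<open>V\<close> is an arbitrary event of the future. A BV bound controls the supremum up to a
  factor 2, so the error carries the factor \<open>measure leb01 V\<close>, on which
  \<open>short_returns\<close> relies.\<close>

lemma decorrelation:
  assumes U: "variation_le L (indicator U)" "U \<in> sets leb01" "0 \<le> L" and V: "V \<in> sets leb01"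
  shows "\<bar>measure (\<nu> \<omega>) {x\<in>U. orbit_map T \<omega> n x \<in> V} - measure (\<nu> \<omega>) U * measure (\<nu> (shift (int n) \<omega>)) V\<bar>
    \<le> 4 * C * (L + 1) * H * \<theta> ^ n * measure leb01 V"
proof -
  define f where "f x = indicator U x * h \<omega> x - measure (\<nu> \<omega>) U * h \<omega> x" for x
  let ?K = "(2 * L + 1) * H + H"
  have U01: "U \<subseteq> {0..1}" using sets.sets_into_space[OF U(2)] by simp
  have b1: "bv_le ((2 * L + 1) * H) (\<lambda>x. indicator U x * h \<omega> x)" by (rule bv_le_indicator_mult[OF h_bv U(1,3)])
  have "bv_le (\<bar>measure (\<nu> \<omega>) U\<bar> * H) (\<lambda>x. measure (\<nu> \<omega>) U * h \<omega> x)" by (rule bv_le_cmult[OF h_bv])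
  then have b2: "bv_le H (\<lambda>x. measure (\<nu> \<omega>) U * h \<omega> x)"
    using \<nu>.prob_le_1[of \<omega> U] H_pos by (rule_tac bv_le_mono) (auto intro: mult_left_le_one_le)
  have f: "bv_le ?K f" unfolding f_def by (rule bv_le_diff[OF b1 b2])
  have K: "0 < ?K" using U(3) H_pos by (auto intro!: add_nonneg_pos)
  have "(\<integral>x. f x \<partial>leb01) = 0"
    unfolding f_def using bv_le_integrable[OF b1] bv_le_integrable[OF b2] by (simp add: h_integral measure_\<nu>[OF U(2)])
  from decay[OF f K this] have P: "bv_le (C * \<theta> ^ n * ?K) (transfer_iter T \<omega> n f)" .
  have Vm: "(indicator V :: real \<Rightarrow> real) \<in> borel_measurable leb01" using V by simp
  have VT: "(\<lambda>x. indicator V (orbit_map T \<omega> n x) :: real) \<in> borel_measurable leb01" using Vm by measurable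
  have "measure (\<nu> \<omega>) {x\<in>U. orbit_map T \<omega> n x \<in> V} - measure (\<nu> \<omega>) U * measure (\<nu> (shift (int n) \<omega>)) V
      = (\<integral>x. indicator V (orbit_map T \<omega> n x) * f x \<partial>leb01)"
  proof -
    have "{x\<in>U. orbit_map T \<omega> n x \<in> V} = U \<inter> {x\<in>{0..1}. orbit_map T \<omega> n x \<in> V}" using U01 by auto
    then have s: "{x\<in>U. orbit_map T \<omega> n x \<in> V} \<in> sets leb01"
      using U(2) orbit_vimage_in_sets[OF V] by simp
    have 1: "measure (\<nu> \<omega>) {x\<in>U. orbit_map T \<omega> n x \<in> V}
        = (\<integral>x. indicator V (orbit_map T \<omega> n x) * (indicator U x * h \<omega> x) \<partial>leb01)"
      unfolding measure_\<nu>[OF s] by (intro Bochner_Integration.integral_cong) (auto simp: indicator_def)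
    have 2: "measure (\<nu> \<omega>) U * measure (\<nu> (shift (int n) \<omega>)) V
        = (\<integral>x. indicator V (orbit_map T \<omega> n x) * (measure (\<nu> \<omega>) U * h \<omega> x) \<partial>leb01)"
    proof -
      have "(\<integral>x. indicator V (orbit_map T \<omega> n x) * (measure (\<nu> \<omega>) U * h \<omega> x) \<partial>leb01)
          = (\<integral>x. measure (\<nu> \<omega>) U * (indicator V (orbit_map T \<omega> n x) * h \<omega> x) \<partial>leb01)"
        by (simp add: mult_ac)
      also have "\<dots> = measure (\<nu> \<omega>) U * (\<integral>x. indicator V (orbit_map T \<omega> n x) * h \<omega> x \<partial>leb01)" by simp
      also have "(\<integral>x. indicator V (orbit_map T \<omega> n x) * h \<omega> x \<partial>leb01) = (\<integral>x. indicator V x * h (shift (int n) \<omega>) x \<partial>leb01)"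
        using Vm by (intro integral_orbit[where B = 1]) auto
      finally show ?thesis by (simp add: measure_\<nu>[OF V])
    qed
    note i = integrable_leb01_mult[OF bv_le_integrable[OF b1] VT, of 1] integrable_leb01_mult[OF bv_le_integrable[OF b2] VT, of 1]
    show ?thesis unfolding 1 2 f_def right_diff_distrib
      by (rule Bochner_Integration.integral_diff[symmetric]) (use i in auto)
  qed
  also have "\<dots> = (\<integral>x. indicator V x * transfer_iter T \<omega> n f x \<partial>leb01)"
    using bv_le_integrable[OF f] Vm by (intro transfer_iter_dual[where B = 1]) auto
  also have "\<bar>\<dots>\<bar> \<le> (\<integral>x. \<bar>indicator V x * transfer_iter T \<omega> n f x\<bar> \<partial>leb01)"
    using integral_norm_bound[of leb01 "\<lambda>x. indicator V x * transfer_iter T \<omega> n f x"] by simp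
  also have "\<dots> \<le> (\<integral>x. 2 * (C * \<theta> ^ n * ?K) * indicator V x \<partial>leb01)"
  proof (rule integral_mono_AE)
    show "integrable leb01 (\<lambda>x. \<bar>indicator V x * transfer_iter T \<omega> n f x\<bar>)"
      using integrable_leb01_mult[OF bv_le_integrable[OF P] Vm, of 1] by (intro integrable_abs) auto
    show "integrable leb01 (\<lambda>x. 2 * (C * \<theta> ^ n * ?K) * indicator V x :: real)"
      using V by (intro integrable_mult_right integrable_leb01_bounded[where B = 1]) auto
    show "AE x in leb01. \<bar>indicator V x * transfer_iter T \<omega> n f x\<bar> \<le> 2 * (C * \<theta> ^ n * ?K) * indicator V x"
      using bv_le_bounded[OF P] by eventually_elim (auto simp: indicator_def)
  qed
  also have "\<dots> = 2 * (C * \<theta> ^ n * ?K) * measure leb01 V"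
    using V sets.sets_into_space[OF V] by (simp add: Int_absorb2)
  finally show ?thesis by (simp add: algebra_simps)
qed

end

section \<open>Hitting times\<close>

context mixing_maps
begin

definition survive :: "real set \<Rightarrow> (int \<Rightarrow> 'q) \<Rightarrow> nat \<Rightarrow> real set" where
  "survive U \<omega> N = {x\<in>{0..1}. \<forall>k. 1 \<le> k \<longrightarrow> k \<le> N \<longrightarrow> orbit_map T \<omega> k x \<notin> U}"

lemma hitting_time_survive:
  "{x\<in>{0..1}. hitting_time T U \<omega> x > enat N} = survive U \<omega> N"
proof -
  have "hitting_time T U \<omega> x > enat N \<longleftrightarrow> (\<forall>k. 1 \<le> k \<longrightarrow> k \<le> N \<longrightarrow> orbit_map T \<omega> k x \<notin> U)" for x
  proof
    assume l: "hitting_time T U \<omega> x > enat N"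
    show "\<forall>k. 1 \<le> k \<longrightarrow> k \<le> N \<longrightarrow> orbit_map T \<omega> k x \<notin> U"
    proof (intro allI impI notI)
      fix k assume k: "1 \<le> k" "k \<le> N" "orbit_map T \<omega> k x \<in> U"
      then have "hitting_time T U \<omega> x \<le> enat k"
        unfolding hitting_time_def by (intro Inf_lower) auto
      with l have "enat N < enat k" by (rule less_le_trans)
      with k show False by simp
    qed
  next
    assume r: "\<forall>k. 1 \<le> k \<longrightarrow> k \<le> N \<longrightarrow> orbit_map T \<omega> k x \<notin> U"
    have "enat (Suc N) \<le> hitting_time T U \<omega> x"
      unfolding hitting_time_def
    proof (rule Inf_greatest)
      fix e assume "e \<in> enat ` {k. k \<ge> 1 \<and> orbit_map T \<omega> k x \<in> U}"
      then obtain k where k: "e = enat k" "1 \<le> k" "orbit_map T \<omega> k x \<in> U" by auto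
      then have "\<not> k \<le> N" using r by auto
      then show "enat (Suc N) \<le> e" using k by simp
    qed
    moreover have "enat N < enat (Suc N)" by simp
    ultimately show "hitting_time T U \<omega> x > enat N" by (rule less_le_trans[rotated])
  qed
  then show ?thesis by (simp add: survive_def)
qed

lemma survive_mono: "n \<le> N \<Longrightarrow> survive U \<omega> N \<subseteq> survive U \<omega> n"
  by (auto simp: survive_def)

lemma survive_subset: "survive U \<omega> N \<subseteq> {0..1}"
  by (auto simp: survive_def)

lemma survive_add:
  "survive U \<omega> (l + N) = {x\<in>survive U \<omega> l. orbit_map T \<omega> l x \<in> survive U (shift (int l) \<omega>) N}"
proof (intro equalityI subsetI)
  fix x assume x: "x \<in> survive U \<omega> (l + N)"
  have "orbit_map T (shift (int l) \<omega>) k (orbit_map T \<omega> l x) \<notin> U" if "1 \<le> k" "k \<le> N" for k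
    using x that by (auto simp: survive_def simp flip: orbit_map_add)
  then show "x \<in> {x\<in>survive U \<omega> l. orbit_map T \<omega> l x \<in> survive U (shift (int l) \<omega>) N}"
    using x orbit_map_in[of x \<omega> l] by (auto simp: survive_def)
next
  fix x assume x: "x \<in> {x\<in>survive U \<omega> l. orbit_map T \<omega> l x \<in> survive U (shift (int l) \<omega>) N}"
  have "orbit_map T \<omega> k x \<notin> U" if k: "1 \<le> k" "k \<le> l + N" for k
  proof (cases "k \<le> l")
    case True
    then show ?thesis using x k by (auto simp: survive_def)
  next
    case False
    then have "orbit_map T \<omega> k x = orbit_map T (shift (int l) \<omega>) (k - l) (orbit_map T \<omega> l x)"
      using orbit_map_add[of T \<omega> l "k - l" x] by simp
    then show ?thesis using x k False by (auto simp: survive_def)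
  qed
  then show "x \<in> survive U \<omega> (l + N)" using x by (auto simp: survive_def)
qed

lemma survive_in_sets:
  assumes "U \<in> sets leb01"
  shows "survive U \<omega> N \<in> sets leb01"
proof -
  have "survive U \<omega> N = {0..1} - (\<Union>k\<in>{1..N}. {x\<in>{0..1}. orbit_map T \<omega> k x \<in> U})"
    by (auto simp: survive_def)
  also have "\<dots> \<in> sets leb01"
    using assms by (intro sets.Diff sets.finite_UN orbit_vimage_in_sets) auto
  finally show ?thesis .
qed

lemma measure_hit_le:
  assumes U: "U \<in> sets leb01"
  shows "measure (\<nu> \<omega>) ({0..1} - survive U \<omega> l) \<le> (\<Sum>j=1..l. measure (\<nu> (shift (int j) \<omega>)) U)"
proof -
  have "{0..1} - survive U \<omega> l = (\<Union>k\<in>{1..l}. {x\<in>{0..1}. orbit_map T \<omega> k x \<in> U})"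
    by (auto simp: survive_def)
  then have "measure (\<nu> \<omega>) ({0..1} - survive U \<omega> l)
      \<le> (\<Sum>k\<in>{1..l}. measure (\<nu> \<omega>) {x\<in>{0..1}. orbit_map T \<omega> k x \<in> U})"
    using orbit_vimage_in_sets[OF U] by (simp add: \<nu>.finite_measure_subadditive_finite image_subset_iff)
  then show ?thesis using measure_orbit_vimage[OF U] by simp
qed

lemma measure_survive_Suc:
  assumes U: "U \<in> sets leb01"
  shows "measure (\<nu> \<omega>) (survive U \<omega> (Suc N)) = measure (\<nu> (shift 1 \<omega>)) (survive U (shift 1 \<omega>) N)
    - measure (\<nu> (shift 1 \<omega>)) (U \<inter> survive U (shift 1 \<omega>) N)"
proof -
  let ?S = "survive U (shift 1 \<omega>) N"
  have S: "?S \<in> sets leb01" by (rule survive_in_sets[OF U])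
  have "x \<in> survive U \<omega> 1 \<longleftrightarrow> x \<in> {0..1} \<and> orbit_map T \<omega> 1 x \<notin> U" for x
    by (auto simp: survive_def)
  then have "survive U \<omega> (Suc N) = {x\<in>{0..1}. orbit_map T \<omega> 1 x \<in> ?S - U}"
    using survive_add[of U \<omega> 1 N] by auto
  then have "measure (\<nu> \<omega>) (survive U \<omega> (Suc N)) = measure (\<nu> (shift (int 1) \<omega>)) (?S - U)"
    using measure_orbit_vimage[of "?S - U" \<omega> 1] S U by simp
  also have "?S - U = ?S - (U \<inter> ?S)" by auto
  also have "measure (\<nu> (shift (int 1) \<omega>)) (?S - (U \<inter> ?S))
      = measure (\<nu> (shift 1 \<omega>)) ?S - measure (\<nu> (shift 1 \<omega>)) (U \<inter> ?S)"
    using S U by (subst \<nu>.finite_measure_Diff) auto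
  finally show ?thesis .
qed

text \<open>A gap of length \<open>l\<close> between the visit to \<open>U\<close> and the later
  survival is opened by dropping the conditions at times 1 to \<open>l\<close>. Dropping them costs
  the first error term in the joint event and the last one in the product; across the gap
  \<open>decorrelation\<close> applies.\<close>

lemma survive_decorrelation:
  assumes U: "variation_le L (indicator U)" "U \<in> sets leb01" "0 \<le> L"
  shows "\<bar>measure (\<nu> \<omega>) (U \<inter> survive U \<omega> N) - measure (\<nu> \<omega>) U * measure (\<nu> \<omega>) (survive U \<omega> N)\<bar>
    \<le> measure (\<nu> \<omega>) (U - survive U \<omega> l) + 4 * C * (L + 1) * H * \<theta> ^ l
      + measure (\<nu> \<omega>) U * (\<Sum>j=1..l. measure (\<nu> (shift (int j) \<omega>)) U)"
proof -
  let ?m = "measure (\<nu> \<omega>)" and ?S = "survive U \<omega>" and ?D = "4 * C * (L + 1) * H * \<theta> ^ l"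
  have S: "?S n \<in> sets leb01" for n by (rule survive_in_sets[OF U(2)])
  have U01: "U \<subseteq> {0..1}" using sets.sets_into_space[OF U(2)] by simp
  have D: "0 \<le> ?D" using C_pos H_pos \<theta>_pos U(3) by simp
  have compl: "?m ({0..1} - ?S n) = 1 - ?m (?S n)" for n
    using \<nu>.prob_compl[of "?S n" \<omega>] S by simp
  have hit: "?m U * ?m ({0..1} - ?S l) \<le> ?m U * (\<Sum>j=1..l. measure (\<nu> (shift (int j) \<omega>)) U)"
    using measure_hit_le[OF U(2)] by (intro mult_left_mono) auto
  show ?thesis
  proof (cases "N \<le> l")
    \<comment> \<open>There is no room for a gap. Both quantities are smaller than
      \<open>?m U\<close>, each by at most one of the two hitting errors.\<close>
    case True
    have 1: "?m (U \<inter> ?S N) = ?m U - ?m (U - ?S N)"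
    proof -
      have "U \<inter> ?S N = U - (U - ?S N)" by auto
      then show ?thesis using U(2) S by (simp add: \<nu>.finite_measure_Diff)
    qed
    have 2: "?m (U - ?S N) \<le> ?m (U - ?S l)"
      using survive_mono[OF True] U(2) S by (intro \<nu>.finite_measure_mono) auto
    have "?m ({0..1} - ?S N) \<le> ?m ({0..1} - ?S l)"
      using survive_mono[OF True] S by (intro \<nu>.finite_measure_mono) auto
    then have 3: "?m U * ?m ({0..1} - ?S N) \<le> ?m U * ?m ({0..1} - ?S l)"
      by (intro mult_left_mono) auto
    have 4: "?m (U \<inter> ?S N) - ?m U * ?m (?S N) = ?m U * ?m ({0..1} - ?S N) - ?m (U - ?S N)"
      unfolding 1 compl by (simp add: algebra_simps)
    have "0 \<le> ?m U * ?m ({0..1} - ?S N)" "0 \<le> ?m (U - ?S N)" by auto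
    then show ?thesis unfolding 4 using 2 3 hit D by linarith
  next
    case False
    define m where "m = N - l"
    have N: "N = l + m" using False by (simp add: m_def)
    let ?V = "survive U (shift (int l) \<omega>) m"
    have V: "?V \<in> sets leb01" by (rule survive_in_sets[OF U(2)])
    let ?X = "{x\<in>U. orbit_map T \<omega> l x \<in> ?V}" and ?Y = "{x\<in>{0..1}. orbit_map T \<omega> l x \<in> ?V}"
    have Y: "?Y \<in> sets leb01" by (rule orbit_vimage_in_sets[OF V])
    have "?X = U \<inter> ?Y" using U01 by auto
    then have X: "?X \<in> sets leb01" using U(2) Y by simp
    have SN: "?S N = ?S l \<inter> ?Y" unfolding N survive_add using survive_subset[of U \<omega> l] by auto
    have dec: "\<bar>?m ?X - ?m U * measure (\<nu> (shift (int l) \<omega>)) ?V\<bar> \<le> ?D"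
    proof -
      have "?D * measure leb01 ?V \<le> ?D" using leb01.prob_le_1[of ?V] D by (intro mult_left_le) auto
      then show ?thesis using decorrelation[OF U V, of \<omega> l] by linarith
    qed
    have YV: "?m ?Y = measure (\<nu> (shift (int l) \<omega>)) ?V" by (rule measure_orbit_vimage[OF V])
    have a: "?m (U \<inter> ?S N) \<le> ?m ?X" "?m ?X \<le> ?m (U \<inter> ?S N) + ?m (U - ?S l)"
    proof -
      show "?m (U \<inter> ?S N) \<le> ?m ?X"
        using X U(2) S by (intro \<nu>.finite_measure_mono) (auto simp: SN)
      have "?X \<subseteq> (U \<inter> ?S N) \<union> (U - ?S l)" using U01 by (auto simp: SN)
      then have "?m ?X \<le> ?m ((U \<inter> ?S N) \<union> (U - ?S l))"
        using U(2) S by (intro \<nu>.finite_measure_mono) auto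
      also have "\<dots> \<le> ?m (U \<inter> ?S N) + ?m (U - ?S l)"
        using U(2) S by (intro measure_Un_le) auto
      finally show "?m ?X \<le> ?m (U \<inter> ?S N) + ?m (U - ?S l)" .
    qed
    have b: "?m (?S N) \<le> ?m ?Y" "?m ?Y \<le> ?m (?S N) + ?m ({0..1} - ?S l)"
    proof -
      show "?m (?S N) \<le> ?m ?Y"
        using Y by (intro \<nu>.finite_measure_mono) (auto simp: SN)
      have "?Y \<subseteq> ?S N \<union> ({0..1} - ?S l)" by (auto simp: SN)
      then have "?m ?Y \<le> ?m (?S N \<union> ({0..1} - ?S l))"
        using sets.Un[OF S sets.Diff[OF unit_interval_in_sets_leb01 S]]
        by (intro \<nu>.finite_measure_mono) auto
      also have "\<dots> \<le> ?m (?S N) + ?m ({0..1} - ?S l)"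
        using S sets.Diff[OF unit_interval_in_sets_leb01 S] by (intro measure_Un_le) auto
      finally show "?m ?Y \<le> ?m (?S N) + ?m ({0..1} - ?S l)" .
    qed
    have "?m U * ?m (?S N) \<le> ?m U * ?m ?Y" using b(1) by (intro mult_left_mono) auto
    moreover have "?m U * ?m ?Y \<le> ?m U * ?m (?S N) + ?m U * ?m ({0..1} - ?S l)"
      using mult_left_mono[OF b(2), of "?m U"] by (simp add: algebra_simps)
    ultimately show ?thesis using a dec hit unfolding YV by linarith
  qed
qed

text \<open>Unrolls the one-step recursion along the orbit. An error made at one step is afterwards
  multiplied by factors \<open>1 - ?u\<close> in \<open>[0,1]\<close>, so the errors merely add
  up.\<close>

lemma survive_product:
  assumes U: "variation_le L (indicator U)" "U \<in> sets leb01" "0 \<le> L"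
    and a: "\<And>\<omega>. measure (\<nu> \<omega>) U \<le> a"
  shows "\<bar>measure (\<nu> \<omega>) (survive U \<omega> N) - (\<Prod>k<N. 1 - measure (\<nu> (shift (int (Suc k)) \<omega>)) U)\<bar>
    \<le> (\<Sum>k<N. measure (\<nu> (shift (int (Suc k)) \<omega>)) (U - survive U (shift (int (Suc k)) \<omega>) l))
      + real N * (4 * C * (L + 1) * H * \<theta> ^ l + real l * a\<^sup>2)"
proof (induction N arbitrary: \<omega>)
  case 0
  have "survive U \<omega> 0 = space (\<nu> \<omega>)" by (auto simp: survive_def)
  then show ?case using \<nu>.prob_space[of \<omega>] by simp
next
  case (Suc N)
  let ?\<omega> = "shift 1 \<omega>" and ?D = "4 * C * (L + 1) * H * \<theta> ^ l"
  let ?u = "measure (\<nu> ?\<omega>) U" and ?s = "measure (\<nu> ?\<omega>) (survive U ?\<omega> N)"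
  let ?P = "\<Prod>k<N. 1 - measure (\<nu> (shift (int (Suc k)) ?\<omega>)) U"
  let ?r = "\<lambda>k \<omega>. measure (\<nu> (shift (int (Suc k)) \<omega>)) (U - survive U (shift (int (Suc k)) \<omega>) l)"
  have sh: "shift (int (Suc k)) ?\<omega> = shift (int (Suc (Suc k))) \<omega>" for k
    by (simp only: shift_shift of_nat_Suc ac_simps)
  have sh1: "shift (int (Suc 0)) \<omega> = ?\<omega>" by simp
  have e: "\<bar>measure (\<nu> \<omega>) (survive U \<omega> (Suc N)) - (1 - ?u) * ?s\<bar> \<le> ?r 0 \<omega> + ?D + real l * a\<^sup>2"
  proof -
    have "(\<Sum>j=1..l. measure (\<nu> (shift (int j) ?\<omega>)) U) \<le> (\<Sum>j=1..l. a)"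
      by (intro sum_mono a)
    then have "?u * (\<Sum>j=1..l. measure (\<nu> (shift (int j) ?\<omega>)) U) \<le> a * (real l * a)"
      using a[of ?\<omega>] by (intro mult_mono) (auto intro: sum_nonneg order_trans[OF measure_nonneg])
    moreover have "measure (\<nu> \<omega>) (survive U \<omega> (Suc N)) - (1 - ?u) * ?s
        = - (measure (\<nu> ?\<omega>) (U \<inter> survive U ?\<omega> N) - ?u * ?s)"
      unfolding measure_survive_Suc[OF U(2)] by (simp add: algebra_simps)
    ultimately show ?thesis
      using survive_decorrelation[OF U, of ?\<omega> N l] unfolding sh1
      by (simp add: power2_eq_square mult_ac)
  qed
  have u: "0 \<le> 1 - ?u" "1 - ?u \<le> 1" using \<nu>.prob_le_1[of ?\<omega> U] by auto
  have "\<bar>(1 - ?u) * ?s - (1 - ?u) * ?P\<bar> = (1 - ?u) * \<bar>?s - ?P\<bar>"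
    using u by (simp add: abs_mult flip: right_diff_distrib)
  also have "\<dots> \<le> 1 * \<bar>?s - ?P\<bar>" using u by (intro mult_right_mono) auto
  also have "\<dots> \<le> (\<Sum>k<N. ?r k ?\<omega>) + real N * (?D + real l * a\<^sup>2)"
    using Suc.IH[of ?\<omega>] by (simp only: mult_1)
  finally have f: "\<bar>(1 - ?u) * ?s - (1 - ?u) * ?P\<bar> \<le> (\<Sum>k<N. ?r k ?\<omega>) + real N * (?D + real l * a\<^sup>2)" .
  have prod: "(\<Prod>k<Suc N. 1 - measure (\<nu> (shift (int (Suc k)) \<omega>)) U) = (1 - ?u) * ?P"
    unfolding prod.lessThan_Suc_shift sh sh1 ..
  have sum: "(\<Sum>k<Suc N. ?r k \<omega>) = ?r 0 \<omega> + (\<Sum>k<N. ?r k ?\<omega>)"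
    unfolding sum.lessThan_Suc_shift sh ..
  show ?case
    unfolding prod sum using e f by (simp add: algebra_simps)
qed

end

text \<open>All factors lie in \<open>[0,1]\<close>, so the products differ by at most the sum of
  the differences of their factors, and each of these is of second order.\<close>

lemma prod_one_minus_exp:
  fixes u :: "'a \<Rightarrow> real"
  assumes "finite I" "\<And>k. k \<in> I \<Longrightarrow> 0 \<le> u k" "\<And>k. k \<in> I \<Longrightarrow> u k \<le> 1"
  shows "\<bar>(\<Prod>k\<in>I. 1 - u k) - exp (- (\<Sum>k\<in>I. u k))\<bar> \<le> (\<Sum>k\<in>I. (u k)\<^sup>2)"
proof -
  have "exp (- (\<Sum>k\<in>I. u k)) = (\<Prod>k\<in>I. exp (- u k))"
    using assms(1) by (simp add: exp_sum flip: sum_negf)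
  then have "\<bar>(\<Prod>k\<in>I. 1 - u k) - exp (- (\<Sum>k\<in>I. u k))\<bar> \<le> (\<Sum>k\<in>I. \<bar>(1 - u k) - exp (- u k)\<bar>)"
    using norm_prod_diff[of I "\<lambda>k. 1 - u k" "\<lambda>k. exp (- u k)"] assms(2,3) by (simp add: abs_le_iff)
  also have "\<dots> \<le> (\<Sum>k\<in>I. (u k)\<^sup>2)"
  proof (rule sum_mono)
    fix k assume "k \<in> I"
    then have u: "0 \<le> u k" "u k \<le> 1" using assms by auto
    have "1 - u k \<le> exp (- u k)" using exp_ge_add_one_self[of "- u k"] by simp
    moreover have "exp (- u k) \<le> 1 / (1 + u k)"
      using exp_ge_add_one_self[of "u k"] u by (simp add: exp_minus field_simps)
    moreover have "1 / (1 + u k) - (1 - u k) \<le> (u k)\<^sup>2"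
    proof -
      have "1 / (1 + u k) - (1 - u k) = (u k)\<^sup>2 / (1 + u k)"
        using u by (simp add: field_simps power2_eq_square)
      also have "\<dots> \<le> (u k)\<^sup>2 / 1" using u by (intro divide_left_mono) auto
      finally show ?thesis by simp
    qed
    ultimately show "\<bar>(1 - u k) - exp (- u k)\<bar> \<le> (u k)\<^sup>2" by linarith
  qed
  finally show ?thesis .
qed

context mixing_maps
begin

lemma survive_exp:
  assumes U: "variation_le L (indicator U)" "U \<in> sets leb01" "0 \<le> L"
    and a: "\<And>\<omega>. measure (\<nu> \<omega>) U \<le> a"
  shows "\<bar>measure (\<nu> \<omega>) (survive U \<omega> N) - exp (- (\<Sum>k<N. measure (\<nu> (shift (int (Suc k)) \<omega>)) U))\<bar>
    \<le> (\<Sum>k<N. measure (\<nu> (shift (int (Suc k)) \<omega>)) (U - survive U (shift (int (Suc k)) \<omega>) l))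
      + real N * (4 * C * (L + 1) * H * \<theta> ^ l + real (Suc l) * a\<^sup>2)"
proof -
  let ?u = "\<lambda>k. measure (\<nu> (shift (int (Suc k)) \<omega>)) U"
  have "\<bar>(\<Prod>k<N. 1 - ?u k) - exp (- (\<Sum>k<N. ?u k))\<bar> \<le> (\<Sum>k<N. (?u k)\<^sup>2)"
    using \<nu>.prob_le_1 by (intro prod_one_minus_exp) auto
  also have "\<dots> \<le> (\<Sum>k<N. a\<^sup>2)" by (intro sum_mono power_mono a) auto
  finally have "\<bar>(\<Prod>k<N. 1 - ?u k) - exp (- (\<Sum>k<N. ?u k))\<bar> \<le> real N * a\<^sup>2" by simp
  then show ?thesis
    using survive_product[OF U a, of \<omega> N l] by (simp add: algebra_simps)
qed

text \<open>Returns up to time \<open>K\<close> are excluded by hypothesis. A later return at time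
  \<open>j\<close> has probability at most \<open>(2 * H * b)\<^sup>2\<close> plus a multiple of
  \<open>b * \<theta> ^ j\<close>, and the latter sums to a geometric tail. \<open>U\<close> is
  enlarged to \<open>B\<close> so that one set of variation 2 serves as past and future; hence 12 =
  4 (2 + 1).\<close>

lemma short_returns:
  assumes B: "variation_le 2 (indicator B)" "B \<in> sets leb01" and U: "U \<in> sets leb01" "U \<subseteq> B"
    and K: "\<And>x j. x \<in> B \<Longrightarrow> 1 \<le> j \<Longrightarrow> j \<le> K \<Longrightarrow> orbit_map T \<omega> j x \<notin> B"
    and b: "measure leb01 B \<le> b"
  shows "measure (\<nu> \<omega>) (U - survive U \<omega> l) \<le> real l * (2 * H * b)\<^sup>2 + 12 * C * H * b * (\<theta> ^ K / (1 - \<theta>))"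
proof -
  let ?R = "\<lambda>j. {x\<in>B. orbit_map T \<omega> j x \<in> B}"
  have B01: "B \<subseteq> {0..1}" using sets.sets_into_space[OF B(2)] by simp
  have b0: "0 \<le> b" using b measure_nonneg[of leb01 B] by linarith
  have "?R j = B \<inter> {x\<in>{0..1}. orbit_map T \<omega> j x \<in> B}" for j using B01 by auto
  then have R: "?R j \<in> sets leb01" for j using B(2) orbit_vimage_in_sets[OF B(2)] by simp
  have "U - survive U \<omega> l \<subseteq> (\<Union>j\<in>{K<..l}. ?R j)"
  proof
    fix x assume x: "x \<in> U - survive U \<omega> l"
    then obtain j where j: "1 \<le> j" "j \<le> l" "orbit_map T \<omega> j x \<in> U"
      using U B01 by (auto simp: survive_def)
    with x U have "x \<in> ?R j" by auto
    moreover from this have "K < j" using K[of x j] j(1) by force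
    ultimately show "x \<in> (\<Union>j\<in>{K<..l}. ?R j)" using j by auto
  qed
  then have "measure (\<nu> \<omega>) (U - survive U \<omega> l) \<le> measure (\<nu> \<omega>) (\<Union>j\<in>{K<..l}. ?R j)"
    using R by (intro \<nu>.finite_measure_mono) (auto intro!: sets.finite_UN)
  also have "\<dots> \<le> (\<Sum>j\<in>{K<..l}. measure (\<nu> \<omega>) (?R j))"
    using R by (intro \<nu>.finite_measure_subadditive_finite) auto
  also have "\<dots> \<le> (\<Sum>j\<in>{K<..l}. (2 * H * b)\<^sup>2 + 12 * C * H * b * \<theta> ^ j)"
  proof (rule sum_mono)
    fix j
    have up: "measure (\<nu> \<omega>') B \<le> 2 * H * b" for \<omega>'
    proof -
      have "measure (\<nu> \<omega>') B \<le> 2 * H * measure leb01 B" by (rule measure_\<nu>_le[OF B(2)])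
      also have "\<dots> \<le> 2 * H * b" using b H_pos by (intro mult_left_mono) auto
      finally show ?thesis .
    qed
    have "measure (\<nu> \<omega>) B * measure (\<nu> (shift (int j) \<omega>)) B \<le> (2 * H * b) * (2 * H * b)"
      using up b0 H_pos by (intro mult_mono) auto
    moreover have "12 * C * H * \<theta> ^ j * measure leb01 B \<le> 12 * C * H * \<theta> ^ j * b"
      using b C_pos H_pos \<theta>_pos by (intro mult_left_mono) auto
    ultimately show "measure (\<nu> \<omega>) (?R j) \<le> (2 * H * b)\<^sup>2 + 12 * C * H * b * \<theta> ^ j"
      using decorrelation[OF B(1,2) _ B(2), of \<omega> j] by (simp add: power2_eq_square mult_ac)
  qed
  also have "\<dots> = real (l - K) * (2 * H * b)\<^sup>2 + 12 * C * H * b * (\<Sum>j\<in>{K<..l}. \<theta> ^ j)"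
    by (simp add: sum.distrib sum_distrib_left)
  also have "\<dots> \<le> real l * (2 * H * b)\<^sup>2 + 12 * C * H * b * (\<theta> ^ K / (1 - \<theta>))"
  proof (intro add_mono mult_right_mono mult_left_mono)
    have "(\<Sum>j\<in>{K<..l}. \<theta> ^ j) \<le> (\<Sum>j\<in>{K..l}. \<theta> ^ j)"
      using \<theta>_pos by (intro sum_mono2) auto
    also have "\<dots> \<le> \<theta> ^ K / (1 - \<theta>)"
      using \<theta>_less \<theta>_pos by (auto simp: sum_gp intro!: divide_right_mono)
    finally show "(\<Sum>j\<in>{K<..l}. \<theta> ^ j) \<le> \<theta> ^ K / (1 - \<theta>)" .
  qed (use C_pos H_pos b0 in auto)
  finally show ?thesis .
qed

end

section \<open>Concentration for block observables of a Bernoulli sequence\<close>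

lemma prob_space_bernoulli: "prob_space (bernoulli_measure p)"
  unfolding bernoulli_measure_def by (intro prob_space_PiM prob_space_measure_pmf)

lemma space_bernoulli [simp]: "space (bernoulli_measure p) = UNIV"
  by (simp add: bernoulli_measure_def space_PiM PiE_UNIV_domain)

lemma coordinate_measurable: "(\<lambda>\<omega>. \<omega> i) \<in> measurable (bernoulli_measure p) (measure_pmf p)"
  unfolding bernoulli_measure_def by (intro measurable_component_singleton) simp

lemma shift_measurable [measurable]:
  fixes p :: "'q::finite pmf"
  shows "shift k \<in> measurable (bernoulli_measure p) (bernoulli_measure p)"
proof -
  have "(shift k :: (int \<Rightarrow> 'q) \<Rightarrow> _) = (\<lambda>\<omega>. \<lambda>i\<in>UNIV. \<omega> (i + k))" by (simp add: shift_def fun_eq_iff)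
  moreover have "(\<lambda>\<omega>. \<lambda>i\<in>UNIV. \<omega> (i + k)) \<in> measurable (bernoulli_measure p) (\<Pi>\<^sub>M i\<in>UNIV. measure_pmf p)"
    by (intro measurable_restrict coordinate_measurable)
  ultimately show ?thesis by (simp add: bernoulli_measure_def)
qed

lemma distr_shift:
  fixes p :: "'q::finite pmf"
  shows "distr (bernoulli_measure p) (bernoulli_measure p) (shift k) = bernoulli_measure p"
proof -
  have "distr (\<Pi>\<^sub>M i\<in>UNIV. measure_pmf p) (\<Pi>\<^sub>M i\<in>UNIV. measure_pmf p) (\<lambda>\<omega>. \<lambda>n\<in>UNIV. \<omega> (n + k))
      = (\<Pi>\<^sub>M i\<in>UNIV. measure_pmf p)"
    by (rule distr_PiM_reindex[where f = "\<lambda>n. n + k" and K = UNIV and M = "\<lambda>_. measure_pmf p"])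
      (auto intro: prob_space_measure_pmf)
  moreover have "(shift k :: (int \<Rightarrow> 'q) \<Rightarrow> _) = (\<lambda>\<omega>. \<lambda>i\<in>UNIV. \<omega> (i + k))" by (simp add: shift_def fun_eq_iff)
  ultimately show ?thesis unfolding bernoulli_measure_def by simp
qed

lemma AE_shift:
  assumes "AE \<omega> in bernoulli_measure p. P \<omega>"
  shows "AE \<omega> in bernoulli_measure p. P (shift k \<omega>)"
proof -
  have "AE \<omega> in distr (bernoulli_measure p) (bernoulli_measure p) (shift k). P \<omega>"
    using assms by (simp only: distr_shift)
  then show ?thesis by (rule AE_distrD[OF shift_measurable])
qed

lemma sets_PiM_pmf_finite:
  assumes "finite W"
  shows "sets (\<Pi>\<^sub>M i\<in>W. measure_pmf (p :: 'q::finite pmf)) = Pow (W \<rightarrow>\<^sub>E UNIV)"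
proof -
  have "sets (\<Pi>\<^sub>M i\<in>W. measure_pmf p) = sets (\<Pi>\<^sub>M i\<in>W. count_space (UNIV :: 'q set))"
    by (intro sets_PiM_cong) auto
  also have "\<dots> = Pow (W \<rightarrow>\<^sub>E UNIV)"
    using assms by (subst count_space_PiM_finite) (auto intro: countable_finite)
  finally show ?thesis .
qed

definition depends_on :: "int set \<Rightarrow> ((int \<Rightarrow> 'q) \<Rightarrow> real) \<Rightarrow> bool" where
  "depends_on W f \<longleftrightarrow> (\<forall>\<omega> \<omega>'. (\<forall>i\<in>W. \<omega> i = \<omega>' i) \<longrightarrow> f \<omega> = f \<omega>')"

lemma depends_on_restrict: "depends_on W f \<Longrightarrow> f \<omega> = f (restrict \<omega> W)"
  unfolding depends_on_def by simp

text \<open>Over a finite alphabet every set of words on a finite window is measurable. This is how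
  functions of finitely many coordinates become measurable even when they are defined through
  \<open>SOME\<close>.\<close>

lemma depends_on_PiM_measurable:
  assumes "finite W"
  shows "f \<in> borel_measurable (\<Pi>\<^sub>M i\<in>W. measure_pmf (p :: 'q::finite pmf))"
  using assms by (intro measurableI) (auto simp: sets_PiM_pmf_finite space_PiM)

lemma depends_on_measurable:
  fixes f :: "(int \<Rightarrow> 'q::finite) \<Rightarrow> real"
  assumes "finite W" "depends_on W f"
  shows "f \<in> borel_measurable (bernoulli_measure p)"
proof -
  have "(\<lambda>\<omega>. restrict \<omega> W) \<in> measurable (bernoulli_measure p) (\<Pi>\<^sub>M i\<in>W. measure_pmf p)"
    by (intro measurable_restrict coordinate_measurable)
  from measurable_compose[OF this depends_on_PiM_measurable[OF assms(1), of f]]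
  show ?thesis by (simp only: depends_on_restrict[OF assms(2), symmetric])
qed

lemma indep_coordinates:
  "prob_space.indep_vars (bernoulli_measure (p :: 'q::finite pmf)) (\<lambda>_. measure_pmf p) (\<lambda>i \<omega>. \<omega> i) (UNIV :: int set)"
proof -
  interpret prob_space "bernoulli_measure p" by (rule prob_space_bernoulli)
  interpret P: product_prob_space "\<lambda>_ :: int. measure_pmf p" UNIV
    by (rule product_prob_spaceI) (rule prob_space_measure_pmf)
  have "distr (bernoulli_measure p) (measure_pmf p) (\<lambda>\<omega>. \<omega> i) = measure_pmf p" for i
    unfolding bernoulli_measure_def using P.PiM_component[of i] by simp
  moreover have "distr (bernoulli_measure p) (\<Pi>\<^sub>M i\<in>UNIV. measure_pmf p) (\<lambda>x. x) = bernoulli_measure p"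
    unfolding bernoulli_measure_def by (rule distr_id)
  ultimately show ?thesis
    using coordinate_measurable by (subst indep_vars_iff_distr_eq_PiM) (auto simp: bernoulli_measure_def restrict_UNIV)
qed

lemma expectation_shift:
  fixes f :: "(int \<Rightarrow> 'q::finite) \<Rightarrow> real"
  assumes "f \<in> borel_measurable (bernoulli_measure p)"
  shows "(\<integral>\<omega>. f (shift k \<omega>) \<partial>bernoulli_measure p) = (\<integral>\<omega>. f \<omega> \<partial>bernoulli_measure p)"
  using integral_distr[OF shift_measurable assms, of k] by (simp add: distr_shift)

text \<open>Distinct times in one residue class modulo \<open>w\<close> differ by at least
  \<open>w\<close>, so they read disjoint sets of coordinates and the summands are independent.
  \<open>N\<close> replaces the number of summands to give one bound for all classes and all shorter
  sums.\<close>

lemma Hoeffding_residue_class: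
  fixes f :: "(int \<Rightarrow> 'q::finite) \<Rightarrow> real"
  assumes f: "depends_on {a..<a + int w} f" "\<And>\<omega>. 0 \<le> f \<omega>" "\<And>\<omega>. f \<omega> \<le> B" and B: "0 < B"
    and J: "finite J" "\<And>k. k \<in> J \<Longrightarrow> k mod w = r" and \<epsilon>: "0 < \<epsilon>" and N: "card J \<le> N" "0 < N"
  shows "measure (bernoulli_measure p) {\<omega>. \<epsilon> \<le> \<bar>(\<Sum>k\<in>J. f (shift (int (Suc k)) \<omega>)) - real (card J) * (\<integral>\<omega>. f \<omega> \<partial>bernoulli_measure p)\<bar>}
    \<le> 2 * exp (- 2 * \<epsilon>\<^sup>2 / (real N * B\<^sup>2))"
proof (cases "J = {}")
  case True
  then show ?thesis using \<epsilon> by simp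
next
  case False
  interpret prob_space "bernoulli_measure p" by (rule prob_space_bernoulli)
  let ?W = "\<lambda>k. {a + int (Suc k)..<a + int w + int (Suc k)}"
  let ?X = "\<lambda>k \<omega>. f (shift (int (Suc k)) \<omega>)"
  have fm: "f \<in> borel_measurable (bernoulli_measure p)" by (rule depends_on_measurable[OF _ f(1)]) simp
  have dep: "depends_on (?W k) (?X k)" for k
    unfolding depends_on_def
  proof (intro allI impI)
    fix \<omega> \<omega>' :: "int \<Rightarrow> 'q" assume "\<forall>i\<in>?W k. \<omega> i = \<omega>' i"
    then have "\<forall>i\<in>{a..<a + int w}. shift (int (Suc k)) \<omega> i = shift (int (Suc k)) \<omega>' i" by auto
    then show "?X k \<omega> = ?X k \<omega>'" using f(1) unfolding depends_on_def by blast
  qed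
  have disj: "disjoint_family_on ?W J"
    unfolding disjoint_family_on_def
  proof (intro ballI impI)
    fix j k assume jk: "j \<in> J" "k \<in> J" "j \<noteq> k"
    have "int w dvd int j - int k"
      using J(2)[OF jk(1)] J(2)[OF jk(2)] by (metis mod_eq_dvd_iff zmod_int)
    then have "int w \<le> \<bar>int j - int k\<bar>" using jk(3) by (intro zdvd_imp_le) (auto simp: dvd_abs_iff)
    then show "?W j \<inter> ?W k = {}" by auto
  qed
  have "indep_vars (\<lambda>k. \<Pi>\<^sub>M i\<in>?W k. measure_pmf p) (\<lambda>k \<omega>. restrict (\<lambda>i. \<omega> i) (?W k)) J"
    by (rule indep_vars_restrict[OF indep_coordinates _ disj]) simp
  then have "indep_vars (\<lambda>_. borel) (\<lambda>k \<omega>. ?X k (restrict (\<lambda>i. \<omega> i) (?W k))) J"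
    by (rule indep_vars_compose2) (rule depends_on_PiM_measurable, simp)
  moreover have "?X k (restrict (\<lambda>i. \<omega> i) (?W k)) = ?X k \<omega>" for k \<omega>
    using depends_on_restrict[OF dep[of k], of \<omega>] by (simp add: eta_contract_eq)
  ultimately have ind: "indep_vars (\<lambda>_. borel) ?X J" by (simp only:)
  interpret Hoeffding_ineq "bernoulli_measure p" J ?X "\<lambda>_. 0" "\<lambda>_. B" "\<Sum>k\<in>J. expectation (?X k)"
    by unfold_locales (use J(1) ind f(2,3) in auto)
  have mu: "(\<Sum>k\<in>J. expectation (?X k)) = real (card J) * expectation f"
    by (simp only: expectation_shift[OF fm] sum_constant)
  have pos: "0 < card J" using J(1) False by (simp add: card_gt_0_iff)
  have "prob {\<omega> \<in> space (bernoulli_measure p). \<epsilon> \<le> \<bar>(\<Sum>k\<in>J. ?X k \<omega>) - (\<Sum>k\<in>J. expectation (?X k))\<bar>}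
      \<le> 2 * exp (- 2 * \<epsilon>\<^sup>2 / (\<Sum>k\<in>J. (B - 0)\<^sup>2))"
    using \<epsilon> B pos by (intro Hoeffding_ineq_abs_ge) auto
  also have "\<dots> \<le> 2 * exp (- 2 * \<epsilon>\<^sup>2 / (real N * B\<^sup>2))"
    using pos B N by (auto intro!: divide_left_mono mult_right_mono)
  finally show ?thesis unfolding mu by simp
qed

text \<open>The sum splits into its \<open>w\<close> residue classes. If the total deviates by
  \<epsilon>, some class deviates by at least \<open>\<epsilon> / w\<close>.\<close>

lemma Hoeffding_window:
  fixes f :: "(int \<Rightarrow> 'q::finite) \<Rightarrow> real"
  assumes f: "depends_on {a..<a + int w} f" "\<And>\<omega>. 0 \<le> f \<omega>" "\<And>\<omega>. f \<omega> \<le> B" and B: "0 < B"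
    and w: "0 < w" and \<epsilon>: "0 < \<epsilon>" and N: "n \<le> N" "0 < N"
  shows "measure (bernoulli_measure p) {\<omega>. \<epsilon> \<le> \<bar>(\<Sum>k<n. f (shift (int (Suc k)) \<omega>)) - real n * (\<integral>\<omega>. f \<omega> \<partial>bernoulli_measure p)\<bar>}
    \<le> real w * (2 * exp (- 2 * (\<epsilon> / w)\<^sup>2 / (real N * B\<^sup>2)))"
proof -
  interpret prob_space "bernoulli_measure p" by (rule prob_space_bernoulli)
  let ?J = "\<lambda>r. {k\<in>{..<n}. k mod w = r}"
  let ?D = "\<lambda>J \<omega>. (\<Sum>k\<in>J. f (shift (int (Suc k)) \<omega>)) - real (card J) * expectation f"
  let ?A = "\<lambda>r. {\<omega>. \<epsilon> / w \<le> \<bar>?D (?J r) \<omega>\<bar>}"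
  have [measurable]: "f \<in> borel_measurable (bernoulli_measure p)"
    by (rule depends_on_measurable[OF _ f(1)]) simp
  have A: "?A r \<in> events" for r
  proof -
    have "{\<omega> \<in> space (bernoulli_measure p). \<epsilon> / w \<le> \<bar>?D (?J r) \<omega>\<bar>} \<in> events" by measurable
    then show ?thesis by simp
  qed
  have D: "?D {..<n} \<omega> = (\<Sum>r<w. ?D (?J r) \<omega>)" for \<omega>
  proof -
    have J: "finite (?J r)" for r by simp
    have "?D J \<omega> = (\<Sum>k\<in>J. f (shift (int (Suc k)) \<omega>) - expectation f)" for J
      by (simp add: sum_subtractf)
    then have "?D {..<n} \<omega> = (\<Sum>k<n. f (shift (int (Suc k)) \<omega>) - expectation f)"
      and "(\<Sum>r<w. ?D (?J r) \<omega>) = (\<Sum>r<w. \<Sum>k\<in>?J r. f (shift (int (Suc k)) \<omega>) - expectation f)"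
      by (simp_all only:)
    moreover have "(\<lambda>k. k mod w) ` {..<n} \<subseteq> {..<w}" using w by auto
    ultimately show ?thesis by (simp only: sum.group[OF finite_lessThan finite_lessThan])
  qed
  have "{\<omega>. \<epsilon> \<le> \<bar>?D {..<n} \<omega>\<bar>} \<subseteq> (\<Union>r<w. ?A r)"
  proof
    fix \<omega> assume "\<omega> \<in> {\<omega>. \<epsilon> \<le> \<bar>?D {..<n} \<omega>\<bar>}"
    then have \<omega>: "\<epsilon> \<le> \<bar>?D {..<n} \<omega>\<bar>" by blast
    show "\<omega> \<in> (\<Union>r<w. ?A r)"
    proof (rule ccontr)
      assume "\<omega> \<notin> (\<Union>r<w. ?A r)"
      then have l: "\<bar>?D (?J r) \<omega>\<bar> < \<epsilon> / w" if "r \<in> {..<w}" for r using that by (simp add: not_le)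
      have "\<bar>?D {..<n} \<omega>\<bar> \<le> (\<Sum>r<w. \<bar>?D (?J r) \<omega>\<bar>)" unfolding D by (rule sum_abs)
      also have "\<dots> < (\<Sum>r<w. \<epsilon> / w)" using w l by (intro sum_strict_mono) auto
      also have "\<dots> = \<epsilon>" using w by simp
      finally show False using \<omega> by simp
    qed
  qed
  then have "prob {\<omega>. \<epsilon> \<le> \<bar>?D {..<n} \<omega>\<bar>} \<le> prob (\<Union>r<w. ?A r)"
    using A by (intro finite_measure_mono) auto
  also have "\<dots> \<le> (\<Sum>r<w. prob (?A r))"
    using A by (intro finite_measure_subadditive_finite) auto
  also have "\<dots> \<le> (\<Sum>r<w. 2 * exp (- 2 * (\<epsilon> / w)\<^sup>2 / (real N * B\<^sup>2)))"
  proof (rule sum_mono)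
    fix r
    have "card (?J r) \<le> card {..<n}" by (rule card_mono) auto
    then show "prob (?A r) \<le> 2 * exp (- 2 * (\<epsilon> / w)\<^sup>2 / (real N * B\<^sup>2))"
      using \<epsilon> w N by (intro Hoeffding_residue_class[OF f B]) auto
  qed
  finally show ?thesis by simp
qed

text \<open>The length must be negligible against \<open>n\<close>, yet large enough for
  \<open>n * \<theta> ^ window n\<close> to vanish, and \<open>n / (window n)\<^sup>2\<close>, the
  order of the Hoeffding exponent, must grow like a power of \<open>n\<close> for summability. The
  exponent 1/4 meets all three demands. \<open>Suc\<close> makes the length positive, as residue
  classes and (Min) require.\<close>

definition window :: "nat \<Rightarrow> nat" where
  "window n = Suc (nat \<lfloor>real n powr (1 / 4)\<rfloor>)"

lemma window_ge: "real n powr (1 / 4) \<le> real (window n)"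
  unfolding window_def by linarith

lemma window_le: "1 \<le> n \<Longrightarrow> real (window n) \<le> 2 * real n powr (1 / 4)"
proof -
  assume "1 \<le> n"
  then have "1 \<le> real n powr (1 / 4)" by (simp add: ge_one_powr_ge_zero)
  then show ?thesis unfolding window_def by linarith
qed

text \<open>Borel-Cantelli. The union over all \<open>N \<le> M * n\<close> has O(n) members, which
  the stretched exponential bound absorbs. Countably many \<open>M\<close> and \<epsilon> then
  suffice, so a single null set serves all \<open>M\<close>, \<open>N\<close> and
  \<epsilon>.\<close>

lemma concentration_AE:
  fixes f :: "nat \<Rightarrow> (int \<Rightarrow> 'q::finite) \<Rightarrow> real" and p :: "'q pmf"
  assumes dep: "\<And>n. depends_on {a n..<a n + int (window n)} (f n)"
    and bound: "\<forall>\<^sub>F n in sequentially. \<forall>\<omega>. 0 \<le> f n \<omega> \<and> f n \<omega> \<le> B / real n" and B: "0 < B"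
  shows "AE \<omega> in bernoulli_measure p. \<forall>M. \<forall>\<epsilon>>0. \<forall>\<^sub>F n in sequentially. \<forall>N \<le> M * n.
    \<bar>(\<Sum>k<N. f n (shift (int (Suc k)) \<omega>)) - real N * (\<integral>\<omega>. f n \<omega> \<partial>bernoulli_measure p)\<bar> < \<epsilon>"
proof -
  interpret prob_space "bernoulli_measure p" by (rule prob_space_bernoulli)
  let ?D = "\<lambda>n N \<omega>. (\<Sum>k<N. f n (shift (int (Suc k)) \<omega>)) - real N * (\<integral>\<omega>. f n \<omega> \<partial>bernoulli_measure p)"
  have [measurable]: "f n \<in> borel_measurable (bernoulli_measure p)" for n
    by (rule depends_on_measurable[OF _ dep]) simp
  have ev: "AE \<omega> in bernoulli_measure p. \<forall>\<^sub>F n in sequentially. \<forall>N \<le> M * n. \<bar>?D n N \<omega>\<bar> < \<epsilon>"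
    if \<epsilon>: "0 < \<epsilon>" for M \<epsilon>
  proof -
    define Bad where "Bad n = (\<Union>N\<in>{..M * n}. {\<omega>. \<epsilon> \<le> \<bar>?D n N \<omega>\<bar>})" for n
    have Bad1: "{\<omega>. \<epsilon> \<le> \<bar>?D n N \<omega>\<bar>} \<in> events" for n N
    proof -
      have "{\<omega> \<in> space (bernoulli_measure p). \<epsilon> \<le> \<bar>?D n N \<omega>\<bar>} \<in> events" by measurable
      then show ?thesis by simp
    qed
    then have Bad: "Bad n \<in> events" for n unfolding Bad_def by (intro sets.finite_UN) auto
    \<comment> \<open>With summands at most \<open>B / n\<close>, length at most
      \<open>Suc M * n\<close> and squared window at most 4 n^(1/2), the Hoeffding exponent is at
      least \<open>q\<close> times n^(1/2). \<open>Suc M\<close> keeps the length positive when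
      \<open>M = 0\<close>.\<close>
    define q where "q = 2 * \<epsilon>\<^sup>2 / (4 * (real (Suc M) * B\<^sup>2))"
    have q: "0 < q" unfolding q_def using \<epsilon> B by auto
    let ?g = "\<lambda>n. (real M * real n + 1) * (2 * real n powr (1 / 4) * (2 * exp (- q * real n powr (1 / 2))))"
    have "summable (\<lambda>n. prob (Bad n))"
    proof (rule summable_comparison_test_ev)
      show "summable (\<lambda>n. 1 / real n ^ 2)" using inverse_power_summable[of 2, where 'a = real] by (simp add: field_simps)
      have "?g \<in> o(\<lambda>n. 1 / real n ^ 2)" using q by real_asymp
      then have "\<forall>\<^sub>F n in sequentially. norm (?g n) \<le> 1 * norm (1 / real n ^ 2)"
        by (rule landau_o.smallD) simp
      moreover note bound eventually_ge_at_top[of "1::nat"]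
      ultimately show "\<forall>\<^sub>F n in sequentially. norm (prob (Bad n)) \<le> 1 / real n ^ 2"
      proof eventually_elim
        case (elim n)
        then have n: "1 \<le> n" by simp
        let ?w = "window n"
        have w: "0 < ?w" by (simp add: window_def)
        have each: "prob {\<omega>. \<epsilon> \<le> \<bar>?D n N \<omega>\<bar>} \<le> 2 * real n powr (1 / 4) * (2 * exp (- q * real n powr (1 / 2)))"
          if N: "N \<le> M * n" for N
        proof -
          have "prob {\<omega>. \<epsilon> \<le> \<bar>?D n N \<omega>\<bar>} \<le> real ?w * (2 * exp (- 2 * (\<epsilon> / ?w)\<^sup>2 / (real (Suc M * n) * (B / n)\<^sup>2)))"
            using elim n w N B \<epsilon> by (intro Hoeffding_window[OF dep]) auto
          also have "\<dots> \<le> 2 * real n powr (1 / 4) * (2 * exp (- q * real n powr (1 / 2)))"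
          proof (rule mult_mono[OF window_le[OF n]])
            have "(real ?w)\<^sup>2 \<le> (2 * real n powr (1 / 4))\<^sup>2"
              using window_le[OF n] by (intro power_mono) auto
            also have "\<dots> = 4 * real n powr (1 / 2)"
              using n by (simp add: power_mult_distrib power2_eq_square flip: powr_add)
            finally have w2: "(real ?w)\<^sup>2 \<le> 4 * real n powr (1 / 2)" .
            define s where "s = real n powr (1 / 2)"
            have s: "0 < s" "real n = s * s"
              unfolding s_def using n by (simp_all flip: powr_add)
            have "q * s = 2 * \<epsilon>\<^sup>2 * (s * s) / (real (Suc M) * B\<^sup>2) / (4 * s)"
              using s(1) B by (simp add: q_def)
            then have "q * real n powr (1 / 2) = 2 * \<epsilon>\<^sup>2 * real n / (real (Suc M) * B\<^sup>2) / (4 * real n powr (1 / 2))"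
              by (simp only: s_def[symmetric] s(2)[symmetric])
            also have "\<dots> \<le> 2 * \<epsilon>\<^sup>2 * real n / (real (Suc M) * B\<^sup>2) / (real ?w)\<^sup>2"
              using w2 w n by (intro divide_left_mono mult_pos_pos) auto
            also have "\<dots> = 2 * (\<epsilon> / ?w)\<^sup>2 / (real (Suc M * n) * (B / n)\<^sup>2)"
            proof -
              have "2 * e\<^sup>2 * x / (y * b\<^sup>2) / v\<^sup>2 = 2 * (e / v)\<^sup>2 / (y * x * (b / x)\<^sup>2)"
                if "0 < x" "0 < y" "0 < b" "0 < v" for e x y b v :: real
                using that by (simp add: field_simps power2_eq_square)
              then show ?thesis unfolding of_nat_mult using n w B by simp
            qed
            finally show "2 * exp (- 2 * (\<epsilon> / ?w)\<^sup>2 / (real (Suc M * n) * (B / n)\<^sup>2)) \<le> 2 * exp (- q * real n powr (1 / 2))"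
              by simp
          qed auto
          finally show ?thesis .
        qed
        have "prob (Bad n) \<le> (\<Sum>N\<in>{..M * n}. prob {\<omega>. \<epsilon> \<le> \<bar>?D n N \<omega>\<bar>})"
          unfolding Bad_def using Bad1 by (intro finite_measure_subadditive_finite) auto
        also have "\<dots> \<le> (\<Sum>N\<in>{..M * n}. 2 * real n powr (1 / 4) * (2 * exp (- q * real n powr (1 / 2))))"
          by (intro sum_mono each) simp
        also have "\<dots> = ?g n" by (simp add: algebra_simps)
        also have "\<dots> \<le> 1 / real n ^ 2" using elim(1) by (simp add: abs_le_iff)
        finally show ?case by simp
      qed
    qed
    then have "AE \<omega> in bernoulli_measure p. \<forall>\<^sub>F n in sequentially. \<omega> \<in> space (bernoulli_measure p) - Bad n"
      using Bad by (intro borel_cantelli_AE1) (auto simp: less_top[symmetric])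
    then show ?thesis
      by eventually_elim (auto simp: Bad_def not_le elim!: eventually_mono)
  qed
  have "AE \<omega> in bernoulli_measure p. \<forall>M m. \<forall>\<^sub>F n in sequentially. \<forall>N \<le> M * n. \<bar>?D n N \<omega>\<bar> < 1 / real (Suc m)"
    by (intro AE_all_countable[THEN iffD2] allI ev) simp
  then show ?thesis
  proof eventually_elim
    case (elim \<omega>)
    show ?case
    proof (intro allI impI)
      fix M :: nat and \<epsilon> :: real assume "0 < \<epsilon>"
      then obtain m where m: "1 / real (Suc m) < \<epsilon>" using nat_approx_posE by blast
      have "\<forall>\<^sub>F n in sequentially. \<forall>N \<le> M * n. \<bar>?D n N \<omega>\<bar> < 1 / real (Suc m)" using elim by blast
      then show "\<forall>\<^sub>F n in sequentially. \<forall>N \<le> M * n. \<bar>?D n N \<omega>\<bar> < \<epsilon>"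
        by eventually_elim (use m in force)
    qed
  qed
qed

section \<open>The stationary measure\<close>

lemma power_window_tendsto_0:
  assumes "0 < \<theta>" "\<theta> < 1"
  shows "(\<lambda>n. real n * \<theta> ^ window n) \<longlonglongrightarrow> 0"
proof (rule tendsto_sandwich[OF _ _ tendsto_const])
  have l: "ln \<theta> < 0" using assms by simp
  show "(\<lambda>n. real n * exp (real n powr (1 / 4) * ln \<theta>)) \<longlonglongrightarrow> 0"
    using l by real_asymp
  have "\<theta> ^ window n \<le> exp (real n powr (1 / 4) * ln \<theta>)" for n
  proof -
    have "\<theta> ^ window n = exp (real (window n) * ln \<theta>)"
      using assms by (simp add: exp_of_nat_mult)
    also have "\<dots> \<le> exp (real n powr (1 / 4) * ln \<theta>)"
      using l window_ge[of n] by (simp add: mult_right_mono_neg)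
    finally show ?thesis .
  qed
  then show "\<forall>\<^sub>F n in sequentially. real n * \<theta> ^ window n \<le> real n * exp (real n powr (1 / 4) * ln \<theta>)"
    by (intro always_eventually allI mult_left_mono) auto
qed (use assms in auto)

locale random_mixing_maps = mixing_maps T M C \<theta> c
  for T :: "'q::finite \<Rightarrow> real \<Rightarrow> real" and M C \<theta> c +
  fixes p :: "'q pmf"
begin

abbreviation \<P> :: "(int \<Rightarrow> 'q) measure" where "\<P> \<equiv> bernoulli_measure p"

sublocale \<P>: prob_space \<P>
  by (rule prob_space_bernoulli)

definition pushed_measure :: "real set \<Rightarrow> nat \<Rightarrow> (int \<Rightarrow> 'q) \<Rightarrow> real" where
  "pushed_measure U n \<omega> = (\<integral>x. indicator U x * pushed \<omega> n x \<partial>leb01)"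

lemma pushed_measure_approx:
  assumes "U \<in> sets leb01"
  shows "\<bar>measure (\<nu> \<omega>) U - pushed_measure U n \<omega>\<bar> \<le> E * \<theta> ^ n"
  using integral_test_approx[of "indicator U" 1 \<omega> n] assms
  by (simp add: pushed_measure_def measure_\<nu>)

lemma pushed_measure_depends: "depends_on {- int n..<- int n + int n} (pushed_measure U n)"
  unfolding depends_on_def
proof (intro allI impI)
  fix \<omega> \<omega>' :: "int \<Rightarrow> 'q" assume "\<forall>i\<in>{- int n..<- int n + int n}. \<omega> i = \<omega>' i"
  then have "transfer_iter T (shift (- int n) \<omega>) n = transfer_iter T (shift (- int n) \<omega>') n"
    by (intro transfer_iter_cong) auto
  then show "pushed_measure U n \<omega> = pushed_measure U n \<omega>'"
    by (simp add: pushed_measure_def pushed_def)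
qed

text \<open>The densities are chosen for each \<omega> separately. Measurability in \<omega> comes
  from exhibiting the map as a pointwise limit of functions of finitely many coordinates.\<close>

lemma measure_\<nu>_measurable [measurable]:
  assumes U: "U \<in> sets leb01"
  shows "(\<lambda>\<omega>. measure (\<nu> \<omega>) U) \<in> borel_measurable \<P>"
proof (rule borel_measurable_LIMSEQ_real)
  show "pushed_measure U n \<in> borel_measurable \<P>" for n
    by (rule depends_on_measurable[OF _ pushed_measure_depends]) simp
  fix \<omega>
  have "(\<lambda>n. pushed_measure U n \<omega> - measure (\<nu> \<omega>) U) \<longlonglongrightarrow> 0"
  proof (rule Lim_null_comparison[OF _ E_power_tendsto_0[of 1]])
    show "\<forall>\<^sub>F n in sequentially. norm (pushed_measure U n \<omega> - measure (\<nu> \<omega>) U) \<le> 1 * (E * \<theta> ^ n)"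
      using pushed_measure_approx[OF U] by (auto simp: abs_minus_commute)
  qed
  then show "(\<lambda>n. pushed_measure U n \<omega>) \<longlonglongrightarrow> measure (\<nu> \<omega>) U" by (rule LIM_zero_cancel)
qed

lemma measure_\<nu>_integrable:
  "U \<in> sets leb01 \<Longrightarrow> integrable \<P> (\<lambda>\<omega>. measure (\<nu> \<omega>) U)"
  by (rule \<P>.integrable_const_bound[where B = 1]) auto

lemma stationary_ge:
  assumes "U \<in> sets leb01"
  shows "c * measure leb01 U \<le> stationary_prob T p U"
proof -
  have "c * measure leb01 U = (\<integral>\<omega>. c * measure leb01 U \<partial>\<P>)" using \<P>.prob_space by simp
  also have "\<dots> \<le> stationary_prob T p U"
    unfolding stationary_prob_def using measure_\<nu>_ge[OF assms] measure_\<nu>_integrable[OF assms]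
    by (intro integral_mono) auto
  finally show ?thesis .
qed

text \<open>The sample measure of \<open>A n\<close> is replaced by a function of the last
  \<open>window n\<close> coordinates, to which \<open>concentration_AE\<close> applies. Over at
  most \<open>m * n\<close> summands this costs a multiple of
  \<open>n * \<theta> ^ window n\<close>, which tends to 0; the mean is replaced at the same
  cost.\<close>

lemma stationary_concentration:
  assumes A: "\<And>n. A n \<in> sets leb01"
    and small: "\<forall>\<^sub>F n in sequentially. measure leb01 (A n) \<le> \<beta> / real n" and \<beta>: "0 < \<beta>"
  shows "AE \<omega> in \<P>. \<forall>m. \<forall>\<epsilon>>0. \<forall>\<^sub>F n in sequentially. \<forall>N \<le> m * n.
    \<bar>(\<Sum>k<N. measure (\<nu> (shift (int (Suc k)) \<omega>)) (A n)) - real N * stationary_prob T p (A n)\<bar> < \<epsilon>"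
proof -
  let ?f = "\<lambda>n. pushed_measure (A n) (window n)"
  have fm: "?f n \<in> borel_measurable \<P>" for n
    by (rule depends_on_measurable[OF _ pushed_measure_depends]) simp
  \<comment> \<open>The upper bound is proportional to the measure of \<open>A n\<close>, hence
    O(1/n), the size that lets Hoeffding's inequality act on sums of O(n) terms.\<close>
  have bounds: "0 \<le> ?f n \<omega>" "?f n \<omega> \<le> 2 * (H + E) * measure leb01 (A n)" for n \<omega>
  proof -
    have "bv_le (H + E * \<theta> ^ window n) (\<lambda>x. h \<omega> x - (h \<omega> x - pushed \<omega> (window n) x))"
      by (rule bv_le_diff[OF h_bv sample_density_approx])
    then have "bv_le (H + E * \<theta> ^ window n) (pushed \<omega> (window n))" by simp
    then have "bv_le (H + E) (pushed \<omega> (window n))"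
      using E_pos \<theta>_pos \<theta>_less by (rule_tac bv_le_mono) (auto intro!: mult_left_le power_le_one)
    from bv_le_bounded[OF this]
    have up: "AE x in leb01. \<bar>pushed \<omega> (window n) x\<bar> \<le> 2 * (H + E)" .
    have low: "AE x in leb01. c \<le> pushed \<omega> (window n) x"
      unfolding pushed_def by (rule lower_bound) (simp add: window_def)
    show "0 \<le> ?f n \<omega>"
      unfolding pushed_measure_def
    proof (rule integral_nonneg_AE)
      show "AE x in leb01. 0 \<le> indicator (A n) x * pushed \<omega> (window n) x"
        using low by eventually_elim (use c_pos in \<open>auto simp: indicator_def\<close>)
    qed
    have "?f n \<omega> \<le> (\<integral>x. 2 * (H + E) * indicator (A n) x \<partial>leb01)"
      unfolding pushed_measure_def
    proof (rule integral_mono_AE)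
      show "integrable leb01 (\<lambda>x. indicator (A n) x * pushed \<omega> (window n) x)"
        using A pushed_integrable by (intro integrable_leb01_mult[where B = 1]) auto
      show "integrable leb01 (\<lambda>x. 2 * (H + E) * indicator (A n) x :: real)"
        using A by (intro integrable_mult_right integrable_leb01_bounded[where B = 1]) auto
      show "AE x in leb01. indicator (A n) x * pushed \<omega> (window n) x \<le> 2 * (H + E) * indicator (A n) x"
        using up by eventually_elim (auto simp: indicator_def)
    qed
    also have "\<dots> = 2 * (H + E) * measure leb01 (A n)"
      using A sets.sets_into_space[OF A] by (simp add: Int_absorb2)
    finally show "?f n \<omega> \<le> 2 * (H + E) * measure leb01 (A n)" .
  qed
  have HE: "0 < H + E" using H_pos E_pos by simp
  have "AE \<omega> in \<P>. \<forall>m. \<forall>\<epsilon>>0. \<forall>\<^sub>F n in sequentially. \<forall>N \<le> m * n.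
    \<bar>(\<Sum>k<N. ?f n (shift (int (Suc k)) \<omega>)) - real N * (\<integral>\<omega>. ?f n \<omega> \<partial>\<P>)\<bar> < \<epsilon>"
  proof (rule concentration_AE[where B = "2 * (H + E) * \<beta>" and a = "\<lambda>n. - int (window n)"])
    show "\<forall>\<^sub>F n in sequentially. \<forall>\<omega>. 0 \<le> ?f n \<omega> \<and> ?f n \<omega> \<le> 2 * (H + E) * \<beta> / real n"
      using small
    proof eventually_elim
      case (elim n)
      have "2 * (H + E) * measure leb01 (A n) \<le> 2 * (H + E) * (\<beta> / real n)"
        using elim HE by (intro mult_left_mono) auto
      then show ?case using bounds[of n] by (auto intro: order_trans)
    qed
    show "depends_on {- int (window n)..<- int (window n) + int (window n)} (?f n)" for n
      by (rule pushed_measure_depends)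
  qed (use HE \<beta> in auto)
  then show ?thesis
  proof eventually_elim
    case (elim \<omega>)
    show ?case
    proof (intro allI impI)
      fix m :: nat and \<epsilon> :: real assume \<epsilon>: "0 < \<epsilon>"
      have "\<forall>\<^sub>F n in sequentially. \<forall>N \<le> m * n.
          \<bar>(\<Sum>k<N. ?f n (shift (int (Suc k)) \<omega>)) - real N * (\<integral>\<omega>. ?f n \<omega> \<partial>\<P>)\<bar> < \<epsilon> / 2"
        using elim[rule_format, of "\<epsilon> / 2" m] \<epsilon> by simp
      moreover have "(\<lambda>n. 2 * real m * E * (real n * \<theta> ^ window n)) \<longlonglongrightarrow> 2 * real m * E * 0"
        by (intro tendsto_mult_left power_window_tendsto_0 \<theta>_pos \<theta>_less)
      then have "\<forall>\<^sub>F n in sequentially. 2 * real m * E * (real n * \<theta> ^ window n) < \<epsilon> / 2"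
        using \<epsilon> by (intro order_tendstoD(2)) auto
      ultimately show "\<forall>\<^sub>F n in sequentially. \<forall>N \<le> m * n.
        \<bar>(\<Sum>k<N. measure (\<nu> (shift (int (Suc k)) \<omega>)) (A n)) - real N * stationary_prob T p (A n)\<bar> < \<epsilon>"
      proof eventually_elim
        case (elim n)
        let ?e = "E * \<theta> ^ window n"
        show ?case
        proof (intro allI impI)
          fix N assume N: "N \<le> m * n"
          have "\<bar>(\<Sum>k<N. measure (\<nu> (shift (int (Suc k)) \<omega>)) (A n)) - (\<Sum>k<N. ?f n (shift (int (Suc k)) \<omega>))\<bar>
              \<le> (\<Sum>k<N. \<bar>measure (\<nu> (shift (int (Suc k)) \<omega>)) (A n) - ?f n (shift (int (Suc k)) \<omega>)\<bar>)"
            unfolding sum_subtractf[symmetric] by (rule sum_abs)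
          also have "\<dots> \<le> (\<Sum>k<N. ?e)" by (intro sum_mono pushed_measure_approx A)
          finally have 1: "\<bar>(\<Sum>k<N. measure (\<nu> (shift (int (Suc k)) \<omega>)) (A n)) - (\<Sum>k<N. ?f n (shift (int (Suc k)) \<omega>))\<bar>
              \<le> real N * ?e" by simp
          have "\<bar>(\<integral>\<omega>. ?f n \<omega> \<partial>\<P>) - stationary_prob T p (A n)\<bar> \<le> ?e"
          proof -
            have fi: "integrable \<P> (?f n)"
              using bounds[of n] fm by (intro \<P>.integrable_const_bound[where B = "2 * (H + E) * measure leb01 (A n)"]) auto
            have "(\<integral>\<omega>. ?f n \<omega> \<partial>\<P>) - stationary_prob T p (A n) = (\<integral>\<omega>. ?f n \<omega> - measure (\<nu> \<omega>) (A n) \<partial>\<P>)"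
              unfolding stationary_prob_def using fi measure_\<nu>_integrable[OF A] by simp
            also have "\<bar>\<dots>\<bar> \<le> (\<integral>\<omega>. \<bar>?f n \<omega> - measure (\<nu> \<omega>) (A n)\<bar> \<partial>\<P>)"
              using integral_norm_bound[of \<P> "\<lambda>\<omega>. ?f n \<omega> - measure (\<nu> \<omega>) (A n)"] by simp
            also have "\<dots> \<le> (\<integral>\<omega>. ?e \<partial>\<P>)"
            proof (rule integral_mono)
              show "\<bar>?f n \<omega> - measure (\<nu> \<omega>) (A n)\<bar> \<le> ?e" for \<omega>
                using pushed_measure_approx[OF A, of \<omega> n "window n"] by (simp only: abs_minus_commute)
            qed (use fi measure_\<nu>_integrable[OF A] in auto)
            also have "\<dots> = ?e" using \<P>.prob_space by simp
            finally show ?thesis .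
          qed
          then have 2: "\<bar>real N * (\<integral>\<omega>. ?f n \<omega> \<partial>\<P>) - real N * stationary_prob T p (A n)\<bar> \<le> real N * ?e"
            by (simp add: abs_mult mult_left_mono flip: right_diff_distrib)
          have "real N * ?e \<le> real (m * n) * ?e"
            using of_nat_mono[OF N, where 'a = real] E_pos \<theta>_pos by (intro mult_right_mono) auto
          then have "2 * (real N * ?e) \<le> 2 * real m * E * (real n * \<theta> ^ window n)"
            by (simp add: mult_ac)
          moreover have "\<bar>(\<Sum>k<N. ?f n (shift (int (Suc k)) \<omega>)) - real N * (\<integral>\<omega>. ?f n \<omega> \<partial>\<P>)\<bar> < \<epsilon> / 2"
            using elim(1) N by blast
          ultimately show "\<bar>(\<Sum>k<N. measure (\<nu> (shift (int (Suc k)) \<omega>)) (A n)) - real N * stationary_prob T p (A n)\<bar> < \<epsilon>"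
            using 1 2 elim(2) by linarith
        qed
      qed
    qed
  qed
qed

end

section \<open>One-sided limits and rescaling at x0\<close>

lemma variation_le_one_sided_limits:
  assumes g: "variation_le K g" and x: "0 < x" "x < 1"
  obtains l r where "(g \<longlongrightarrow> r) (at x within ({x<..} \<inter> {0..1}))" "(g \<longlongrightarrow> l) (at x within ({..<x} \<inter> {0..1}))"
proof -
  obtain v where "increments_le K v g" using g by (auto simp: variation_le_def)
  note v = increments_leD[OF this]
  \<comment> \<open>\<open>g\<close> is the difference of the increasing functions \<open>v\<close>
    and \<open>?w\<close>, whose one-sided limits are infima and suprema.\<close>
  let ?w = "\<lambda>y. v y - g y"
  have mono: "v a \<le> v b" "?w a \<le> ?w b" if "a \<in> {0..1}" "b \<in> {0..1}" "a \<le> b" for a b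
    using v(3)[of a b] that by auto
  have bounds: "0 \<le> v a" "v a \<le> K" "?w 0 \<le> ?w a" "?w a \<le> ?w 1" if "a \<in> {0..1}" for a
    using v(1,2)[of a] mono(2)[of 0 a] mono(2)[of a 1] that by auto
  let ?R = "{x<..} \<inter> {0..1}" and ?L = "{..<x} \<inter> {0..1}"
  have "((\<lambda>y. v y - ?w y) \<longlongrightarrow> Inf (v ` ?R) - Inf (?w ` ?R)) (at x within ?R)"
    by (intro tendsto_diff Lim_right_bound[where K = 0] Lim_right_bound[where K = "?w 0" and f = ?w])
      (use mono bounds in auto)
  moreover have "((\<lambda>y. v y - ?w y) \<longlongrightarrow> Sup (v ` ?L) - Sup (?w ` ?L)) (at x within ?L)"
    by (intro tendsto_diff Lim_left_bound[where K = K] Lim_left_bound[where K = "?w 1" and f = ?w])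
      (use mono bounds in auto)
  ultimately show thesis using that by simp
qed

lemma sequence_one_sided:
  fixes g :: "real \<Rightarrow> real"
  assumes g: "(g \<longlongrightarrow> l) (at x within (S \<inter> {0..1}))" and x: "0 < x" "x < 1"
    and u: "u \<longlonglongrightarrow> x" "\<And>n. u n \<in> S" "x \<notin> S"
  shows "(\<lambda>n. g (u n)) \<longlonglongrightarrow> l"
proof -
  have "\<forall>\<^sub>F n in sequentially. 0 < u n" "\<forall>\<^sub>F n in sequentially. u n < 1"
    using order_tendstoD[OF u(1)] x by auto
  then have "\<forall>\<^sub>F n in sequentially. u n \<in> S \<inter> {0..1} \<and> u n \<noteq> x"
    by eventually_elim (use u(2,3) in force)
  then have "filterlim u (at x within (S \<inter> {0..1})) sequentially"
    using u(1) unfolding filterlim_at by simp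
  from filterlim_compose[OF g this] show ?thesis .
qed

text \<open>
  After the substitution \<open>x = x0 + r v\<close> only the one-sided limits of the density at \<open>x0\<close> matter.
\<close>

lemma (in mixing_maps) local_limit:
  assumes x0: "0 < x0" "x0 < 1"
  obtains \<gamma> where "\<And>W R A r. W \<in> sets borel \<Longrightarrow> W \<subseteq> {0<..<R} \<Longrightarrow> (\<And>n. 0 < r n) \<Longrightarrow> r \<longlonglongrightarrow> 0 \<Longrightarrow>
    (\<And>n. A n \<in> sets leb01) \<Longrightarrow>
    (\<forall>\<^sub>F n in sequentially. \<forall>v. v \<noteq> 0 \<longrightarrow> (x0 + r n * v \<in> A n \<longleftrightarrow> \<bar>v\<bar> \<in> W)) \<Longrightarrow>
    (\<lambda>n. measure (\<nu> \<omega>) (A n) / r n) \<longlonglongrightarrow> \<gamma> * measure lborel W"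
proof -
  obtain g0 where g0: "AE x in leb01. g0 x = h \<omega> x" "variation_le H g0" "\<forall>x\<in>{0..1}. \<bar>g0 x\<bar> \<le> 2 * H"
    using h_bv by (rule bv_leE) blast
  \<comment> \<open>Extension by 0 gives a bounded function on the whole line, so that the affine
    substitution can be carried out for \<open>lborel\<close>.\<close>
  define g where "g x = indicator {0..1} x *\<^sub>R g0 x" for x
  have g: "AE x in leb01. g x = h \<omega> x"
    using g0(1) AE_space by eventually_elim (simp add: g_def)
  have gb: "\<bar>g x\<bar> \<le> 2 * H" for x using g0(3) H_pos by (auto simp: g_def indicator_def)
  have "(borel_measurable leb01 :: (real \<Rightarrow> real) set) = borel_measurable (restrict_space borel {0..1})"
    by (intro measurable_cong_sets) (simp_all add: leb01_def sets_restrict_space)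
  with variation_le_measurable[OF g0(2)] have "g0 \<in> borel_measurable (restrict_space borel {0..1})"
    by simp
  then have gm [measurable]: "g \<in> borel_measurable borel"
    unfolding g_def by (subst (asm) borel_measurable_restrict_space_iff) auto
  have gm01: "g \<in> borel_measurable leb01"
    unfolding leb01_def by (intro measurable_restrict_space1) simp
  have "variation_le H g"
    using g0(2) unfolding variation_le_def increments_le_def g_def by auto
  from variation_le_one_sided_limits[OF this x0] obtain gl gr where
    lim: "(g \<longlongrightarrow> gr) (at x0 within ({x0<..} \<inter> {0..1}))" "(g \<longlongrightarrow> gl) (at x0 within ({..<x0} \<inter> {0..1}))"
    by blast
  show thesis
  \<comment> \<open>The rescaled sets are symmetric about 0 up to the point 0 itself, so both
    one-sided limits receive the weight \<open>measure lborel W\<close>. The factor is the same for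
    all \<open>W\<close>, \<open>A\<close> and \<open>r\<close>, which permits comparing different
    sets.\<close>
  proof (rule that[of "gr + gl"])
    fix W R A and r :: "nat \<Rightarrow> real"
    assume W: "W \<in> sets borel" "W \<subseteq> {0<..<R}" and r: "\<And>n. 0 < r n" "r \<longlonglongrightarrow> 0"
      and A: "\<And>n. A n \<in> sets leb01"
      and AW: "\<forall>\<^sub>F n in sequentially. \<forall>v. v \<noteq> 0 \<longrightarrow> (x0 + r n * v \<in> A n \<longleftrightarrow> \<bar>v\<bar> \<in> W)"
    note [measurable] = W(1)
    have A01: "A n \<subseteq> {0..1}" for n using sets.sets_into_space[OF A] by simp
    have Abor [measurable]: "A n \<in> sets borel" for n using A sets_leb01 by blast
    define K where "K n v = indicator W \<bar>v\<bar> * g (x0 + r n * v)" for n v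
    define q where "q v = gr * indicator W v + gl * indicator W (- v)" for v :: real
    have scaled: "\<forall>\<^sub>F n in sequentially. (\<integral>v. K n v \<partial>lborel) = measure (\<nu> \<omega>) (A n) / r n"
      using AW
    proof eventually_elim
      case (elim n)
      let ?G = "\<lambda>x. indicator (A n) x * g x"
      have "measure (\<nu> \<omega>) (A n) = (\<integral>x. ?G x \<partial>leb01)"
        unfolding measure_\<nu>[OF A] using A gm01 g by (intro integral_cong_AE) auto
      also have "\<dots> = (\<integral>x. indicator {0..1} x *\<^sub>R ?G x \<partial>lborel)"
        unfolding leb01_def by (rule integral_restrict_space) simp
      also have "\<dots> = (\<integral>x. ?G x \<partial>lborel)"
        by (intro Bochner_Integration.integral_cong) (auto simp: g_def indicator_def)
      also have "\<dots> = \<bar>r n\<bar> *\<^sub>R (\<integral>v. ?G (x0 + r n * v) \<partial>lborel)"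
        using r(1)[of n] by (intro lborel_integral_real_affine) auto
      also have "(\<integral>v. ?G (x0 + r n * v) \<partial>lborel) = (\<integral>v. K n v \<partial>lborel)"
      proof (rule integral_cong_AE)
        have "AE v in lborel. v \<noteq> (0::real)" by (rule AE_lborel_singleton)
        then show "AE v in lborel. ?G (x0 + r n * v) = K n v"
          by eventually_elim (use elim in \<open>auto simp: K_def indicator_def\<close>)
      qed (auto simp: K_def)
      finally show ?case using r(1)[of n] by simp
    qed
    have Wpos: "0 < v" if "v \<in> W" for v using W(2) that by auto
    have fin: "emeasure lborel W < \<infinity>"
    proof -
      have "emeasure lborel W \<le> emeasure lborel {0..\<bar>R\<bar>}" using W by (intro emeasure_mono) force+
      also have "\<dots> < \<infinity>" by simp
      finally show ?thesis .
    qed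
    have conv: "(\<lambda>n. \<integral>v. K n v \<partial>lborel) \<longlonglongrightarrow> (\<integral>v. q v \<partial>lborel)"
    proof (rule integral_dominated_convergence[where w = "\<lambda>v. 2 * H * indicator {-R..R} v"])
      show "AE v in lborel. (\<lambda>n. K n v) \<longlonglongrightarrow> q v"
      proof (rule AE_I2)
        fix v :: real
        have u: "(\<lambda>n. x0 + r n * v) \<longlonglongrightarrow> x0"
          using tendsto_add[OF tendsto_const tendsto_mult_left_zero[OF r(2)], of x0 v] by simp
        consider "v \<in> W" | "- v \<in> W" | "v \<notin> W" "- v \<notin> W" by blast
        then show "(\<lambda>n. K n v) \<longlonglongrightarrow> q v"
        proof cases
          case 1
          then have v: "0 < v" "- v \<notin> W" using Wpos[of v] Wpos[of "- v"] by auto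
          have "(\<lambda>n. g (x0 + r n * v)) \<longlonglongrightarrow> gr"
            using v r(1) by (intro sequence_one_sided[OF lim(1) x0 u]) auto
          then show ?thesis using 1 v by (simp add: K_def q_def)
        next
          case 2
          then have v: "v < 0" "v \<notin> W" using Wpos[of v] Wpos[of "- v"] by auto
          have "(\<lambda>n. g (x0 + r n * v)) \<longlonglongrightarrow> gl"
            using v r(1) by (intro sequence_one_sided[OF lim(2) x0 u]) (auto simp: mult_pos_neg)
          then show ?thesis using 2 v by (simp add: K_def q_def)
        next
          case 3
          then show ?thesis by (simp add: K_def q_def abs_if)
        qed
      qed
      show "AE v in lborel. norm (K n v) \<le> 2 * H * indicator {-R..R} v" for n
        using W(2) gb H_pos by (intro AE_I2) (force simp: K_def indicator_def abs_le_iff)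
      show "integrable lborel (\<lambda>v. 2 * H * indicator {-R..R} v)"
        by (intro integrable_mult_right) (simp add: integrable_indicator_iff emeasure_lborel_Icc_eq)
    qed (auto simp: K_def q_def)
    have iW: "integrable lborel (indicator W :: real \<Rightarrow> real)"
      using fin by (simp add: integrable_indicator_iff)
    have "measure lborel W = (\<integral>v. (indicator W (- v) :: real) \<partial>lborel)"
      using lborel_integral_real_affine[of "-1" "indicator W :: real \<Rightarrow> real" 0] by simp
    moreover have "integrable lborel (\<lambda>v. indicator W (- v) :: real)"
      using lborel_integrable_real_affine[OF iW, of "-1" 0] by simp
    ultimately have "(\<integral>v. q v \<partial>lborel) = (gr + gl) * measure lborel W"
      unfolding q_def using iW by (simp add: algebra_simps)
    then have "(\<lambda>n. \<integral>v. K n v \<partial>lborel) \<longlonglongrightarrow> (gr + gl) * measure lborel W" using conv by simp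
    then show "(\<lambda>n. measure (\<nu> \<omega>) (A n) / r n) \<longlonglongrightarrow> (gr + gl) * measure lborel W"
      by (rule Lim_transform_eventually) (rule scaled)
  qed
qed

section \<open>Level sets of the observable\<close>

lemma phi_gt_iff:
  assumes "0 < \<alpha>" "0 < b"
  shows "ereal b < phi \<alpha> x0 x \<longleftrightarrow> \<bar>x - x0\<bar> < b powr (- \<alpha>)"
proof (cases "x = x0")
  case True
  then show ?thesis using assms by (simp add: phi_def)
next
  case False
  let ?d = "\<bar>x - x0\<bar>"
  have d: "0 < ?d" using False by simp
  have b: "(b powr (- \<alpha>)) powr (- (1 / \<alpha>)) = b" using assms by (simp add: powr_powr)
  have "b < ?d powr (- (1 / \<alpha>))" if "?d < b powr (- \<alpha>)"
    using powr_less_mono2_neg[of "- (1 / \<alpha>)" ?d "b powr (- \<alpha>)"] that d assms b by simp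
  moreover have "?d powr (- (1 / \<alpha>)) \<le> b" if "b powr (- \<alpha>) \<le> ?d"
    using powr_mono2'[of "- (1 / \<alpha>)" "b powr (- \<alpha>)" ?d] that d assms b by simp
  ultimately show ?thesis using False by (auto simp: phi_def not_less[symmetric])
qed

lemma phi_antimono:
  assumes "0 < \<alpha>" "\<bar>x - x0\<bar> \<le> \<bar>y - x0\<bar>"
  shows "phi \<alpha> x0 y \<le> phi \<alpha> x0 x"
proof (cases "x = x0")
  case True
  then show ?thesis by (simp add: phi_def)
next
  case False
  then have "0 < \<bar>x - x0\<bar>" "y \<noteq> x0" using assms(2) by auto
  then show ?thesis
    using powr_mono2'[of "- (1 / \<alpha>)" "\<bar>x - x0\<bar>" "\<bar>y - x0\<bar>"] assms False by (simp add: phi_def)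
qed

lemma phi_superlevel_interval:
  assumes "0 < \<alpha>"
  shows "is_interval {x\<in>{0..1}. s < phi \<alpha> x0 x}"
  unfolding is_interval_1
proof (intro ballI allI impI)
  fix a b x assume ab: "a \<in> {x\<in>{0..1}. s < phi \<alpha> x0 x}" "b \<in> {x\<in>{0..1}. s < phi \<alpha> x0 x}"
    and x: "a \<le> x \<and> x \<le> b"
  have "\<bar>x - x0\<bar> \<le> \<bar>a - x0\<bar> \<or> \<bar>x - x0\<bar> \<le> \<bar>b - x0\<bar>" using x by auto
  then have "phi \<alpha> x0 a \<le> phi \<alpha> x0 x \<or> phi \<alpha> x0 b \<le> phi \<alpha> x0 x"
    using phi_antimono[OF assms] by blast
  then show "x \<in> {x\<in>{0..1}. s < phi \<alpha> x0 x}" using ab x by auto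
qed

lemma mem_scaled_iff:
  assumes "0 < b"
  shows "z \<in> (\<lambda>y. ereal b * y) ` S \<longleftrightarrow> z / ereal b \<in> S"
proof
  assume "z \<in> (\<lambda>y. ereal b * y) ` S"
  then obtain y where "y \<in> S" "z = ereal b * y" by blast
  moreover have "ereal b * y / ereal b = y" using assms by (cases y) auto
  ultimately show "z / ereal b \<in> S" by simp
next
  assume "z / ereal b \<in> S"
  moreover have "ereal b * (z / ereal b) = z" using assms by (cases z) auto
  ultimately show "z \<in> (\<lambda>y. ereal b * y) ` S" by (metis imageI)
qed

definition scaled_level :: "real \<Rightarrow> real \<Rightarrow> real \<Rightarrow> ereal set \<Rightarrow> real set" where
  "scaled_level \<alpha> x0 b J = {x\<in>{0..1}. phi \<alpha> x0 x \<in> (\<lambda>y. ereal b * y) ` J}"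

text \<open>The level set is the difference of two nested superlevel sets, which are intervals;
  hence the variation 2 + 2.\<close>

lemma scaled_level_interval:
  assumes "0 < \<alpha>" "0 < b" "s < t"
  shows "scaled_level \<alpha> x0 b {s<..t} \<in> sets leb01"
    and "variation_le 4 (indicator (scaled_level \<alpha> x0 b {s<..t}))"
proof -
  let ?P = "{x\<in>{0..1}. ereal b * s < phi \<alpha> x0 x}" and ?Q = "{x\<in>{0..1}. ereal b * t < phi \<alpha> x0 x}"
  have eq: "scaled_level \<alpha> x0 b {s<..t} = ?P - ?Q"
    unfolding scaled_level_def mem_scaled_iff[OF assms(2)]
    using assms(2) by (auto simp: ereal_less_divide_pos ereal_divide_le_pos not_less)
  note iv = phi_superlevel_interval[OF assms(1)]
  have "?P \<in> sets leb01" "?Q \<in> sets leb01" by (rule interval_in_sets_leb01[OF iv], blast)+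
  then show "scaled_level \<alpha> x0 b {s<..t} \<in> sets leb01" unfolding eq by (rule sets.Diff)
  have "ereal b * s \<le> ereal b * t" using assms by (intro ereal_mult_left_mono) auto
  then have sub: "?Q \<subseteq> ?P" by auto
  have "variation_le (2 + 2) (\<lambda>x. indicator ?P x - indicator ?Q x)"
    by (intro variation_le_diff variation_le_indicator_interval iv)
  moreover have "(\<lambda>x. indicator ?P x - indicator ?Q x :: real) = indicator (?P - ?Q)"
    using sub by (auto simp: fun_eq_iff indicator_def)
  ultimately show "variation_le 4 (indicator (scaled_level \<alpha> x0 b {s<..t}))"
    unfolding eq by simp
qed

text \<open>Two bounds that do not depend on the scale \<open>b\<close>: the positive part of
  \<open>J\<close> stays above \<open>a\<close>, so the level sets lie in balls of radius of order
  \<open>b powr (- \<alpha>)\<close>, and the indicators have variation at most \<open>L\<close>, so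
  the constants of \<open>decorrelation\<close> stay bounded while the sets shrink.\<close>

lemma J_family_props:
  assumes "J \<in> J_family" "0 < \<alpha>"
  obtains a L where "0 < a" "\<forall>y\<in>J. 0 < y \<longrightarrow> ereal a < y" "0 \<le> L" "J \<in> sets borel"
    "\<And>b. 0 < b \<Longrightarrow> scaled_level \<alpha> x0 b J \<in> sets leb01"
    "\<And>b. 0 < b \<Longrightarrow> variation_le L (indicator (scaled_level \<alpha> x0 b J))"
proof -
  let ?I = "{{x<..y} | x y :: ereal. x < y \<and> 0 \<notin> {x..y}}"
  from assms(1) obtain K where K: "finite K" "K \<subseteq> ?I" "J = \<Union>K" by (auto simp: J_family_def)
  have "\<exists>a L. 0 < a \<and> (\<forall>y\<in>\<Union>K. 0 < y \<longrightarrow> ereal a < y) \<and> 0 \<le> L \<and> \<Union>K \<in> sets borel \<and>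
    (\<forall>b>0. scaled_level \<alpha> x0 b (\<Union>K) \<in> sets leb01 \<and> variation_le L (indicator (scaled_level \<alpha> x0 b (\<Union>K))))"
    using K(1,2)
  proof (induction K rule: finite_induct)
    case empty
    have "indicator {} = (\<lambda>_ :: real. 0 :: real)" by auto
    then show ?case
      by (intro exI[of _ 1] exI[of _ 0]) (auto simp: scaled_level_def intro: variation_le_const)
  next
    case (insert I K)
    then obtain a L where IH: "0 < a" "\<forall>y\<in>\<Union>K. 0 < y \<longrightarrow> ereal a < y" "0 \<le> L" "\<Union>K \<in> sets borel"
      "\<forall>b>0. scaled_level \<alpha> x0 b (\<Union>K) \<in> sets leb01 \<and> variation_le L (indicator (scaled_level \<alpha> x0 b (\<Union>K)))"
      by blast
    from insert.prems obtain s t where I: "I = {s<..t}" "s < t" "0 \<notin> {s..t}" by blast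
    have "\<exists>a'>0. \<forall>y\<in>I. 0 < y \<longrightarrow> ereal a' < y"
    proof (cases "0 < s")
      case True
      with I(2) obtain s' where "s = ereal s'" "0 < s'" by (cases s) auto
      then show ?thesis using I by (intro exI[of _ s']) auto
    next
      \<comment> \<open>An interval that avoids 0 and does not begin above it lies below 0, where
        the requirement on \<open>a'\<close> is void.\<close>
      case False
      then have "t < 0" using I(2,3) by auto
      then show ?thesis using I by (intro exI[of _ 1]) auto
    qed
    then obtain a' where a': "0 < a'" "\<forall>y\<in>I. 0 < y \<longrightarrow> ereal a' < y" by blast
    have Un: "scaled_level \<alpha> x0 b (\<Union>(insert I K)) = scaled_level \<alpha> x0 b I \<union> scaled_level \<alpha> x0 b (\<Union>K)" for b
      by (auto simp: scaled_level_def)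
    show ?case
    proof (rule exI[of _ "min a a'"], rule exI[of _ "4 + L"], intro conjI allI impI)
      show "\<forall>y\<in>\<Union>(insert I K). 0 < y \<longrightarrow> ereal (min a a') < y"
      proof (intro ballI impI)
        fix y assume y: "y \<in> \<Union>(insert I K)" "0 < y"
        have "ereal (min a a') \<le> ereal a" "ereal (min a a') \<le> ereal a'" by auto
        moreover have "ereal a < y \<or> ereal a' < y" using y IH(2) a'(2) by blast
        ultimately show "ereal (min a a') < y" by (metis le_less_trans)
      qed
      fix b :: real assume b: "0 < b"
      show "scaled_level \<alpha> x0 b (\<Union>(insert I K)) \<in> sets leb01"
        unfolding Un using IH(5) b scaled_level_interval(1)[OF assms(2) b I(2)] I(1) by (intro sets.Un) auto
      show "variation_le (4 + L) (indicator (scaled_level \<alpha> x0 b (\<Union>(insert I K))))"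
        unfolding Un using IH(5) b scaled_level_interval(2)[OF assms(2) b I(2)] I(1)
        by (intro variation_le_indicator_Un) auto
    qed (use IH a' I in auto)
  qed
  then show thesis using that K(3) by blast
qed

text \<open>The distances from \<open>x0\<close>, in units of \<open>b powr (- \<alpha>)\<close>, at
  which the observable divided by \<open>b\<close> lies in \<open>J\<close>. By homogeneity of the
  power they do not depend on \<open>b\<close>.\<close>

definition radii :: "real \<Rightarrow> ereal set \<Rightarrow> real set" where
  "radii \<alpha> J = {v. 0 < v \<and> ereal (v powr (- (1 / \<alpha>))) \<in> J}"

lemma radii_borel:
  assumes "J \<in> sets borel"
  shows "radii \<alpha> J \<in> sets borel"
proof -
  have "(\<lambda>v. ereal (v powr (- (1 / \<alpha>)))) \<in> borel_measurable borel" by measurable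
  then have "(\<lambda>v. ereal (v powr (- (1 / \<alpha>)))) -` J \<inter> space borel \<in> sets borel"
    using assms by (rule measurable_sets)
  moreover have "radii \<alpha> J = {0<..} \<inter> ((\<lambda>v. ereal (v powr (- (1 / \<alpha>)))) -` J \<inter> space borel)"
    by (auto simp: radii_def)
  ultimately show ?thesis by auto
qed

lemma radii_subset:
  assumes "0 < \<alpha>" "0 < a" "\<forall>y\<in>J. 0 < y \<longrightarrow> ereal a < y"
  shows "radii \<alpha> J \<subseteq> {0<..<a powr (- \<alpha>)}"
proof
  fix v assume "v \<in> radii \<alpha> J"
  then have v: "0 < v" "ereal (v powr (- (1 / \<alpha>))) \<in> J" by (auto simp: radii_def)
  from bspec[OF assms(3) v(2)] v(1) have "ereal a < phi \<alpha> 0 v" by (simp add: phi_def)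
  then show "v \<in> {0<..<a powr (- \<alpha>)}" using v(1) phi_gt_iff[OF assms(1,2), of 0 v] by simp
qed

lemma phi_scaled:
  assumes "0 < \<alpha>" "0 < b" "v \<noteq> 0"
  shows "phi \<alpha> x0 (x0 + b powr (- \<alpha>) * v) / ereal b = ereal (\<bar>v\<bar> powr (- (1 / \<alpha>)))"
proof -
  have "\<bar>b powr (- \<alpha>) * v\<bar> powr (- (1 / \<alpha>)) = b * \<bar>v\<bar> powr (- (1 / \<alpha>))"
    using assms by (simp add: abs_mult powr_mult powr_powr)
  then show ?thesis using assms by (simp add: phi_def)
qed

lemma scaled_level_iff:
  assumes "0 < \<alpha>" "0 < b" "v \<noteq> 0"
  shows "x0 + b powr (- \<alpha>) * v \<in> scaled_level \<alpha> x0 b J \<longleftrightarrow>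
    x0 + b powr (- \<alpha>) * v \<in> {0..1} \<and> \<bar>v\<bar> \<in> radii \<alpha> J"
  using assms by (simp add: scaled_level_def mem_scaled_iff phi_scaled radii_def)

lemma scaled_level_subset_ball:
  assumes "0 < \<alpha>" "0 < b" "0 < a" "\<forall>y\<in>J. 0 < y \<longrightarrow> ereal a < y"
  shows "scaled_level \<alpha> x0 b J \<subseteq> {x\<in>{0..1}. \<bar>x - x0\<bar> < a powr (- \<alpha>) * b powr (- \<alpha>)}"
proof
  fix x assume x: "x \<in> scaled_level \<alpha> x0 b J"
  then have x01: "x \<in> {0..1}" by (simp add: scaled_level_def)
  show "x \<in> {x\<in>{0..1}. \<bar>x - x0\<bar> < a powr (- \<alpha>) * b powr (- \<alpha>)}"
  \<comment> \<open>The observable is infinite at \<open>x0\<close>, so the centre can belong to the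
    level set; it is outside the reach of the rescaling, which needs
    \<open>v \<noteq> 0\<close>.\<close>
  proof (cases "x = x0")
    case True
    then show ?thesis using assms x01 by simp
  next
    case False
    define v where "v = (x - x0) / b powr (- \<alpha>)"
    have v: "x = x0 + b powr (- \<alpha>) * v" "v \<noteq> 0" using False assms(2) by (auto simp: v_def)
    from x have "\<bar>v\<bar> \<in> radii \<alpha> J"
      unfolding v(1) scaled_level_iff[OF assms(1,2) v(2)] by simp
    then have "\<bar>v\<bar> < a powr (- \<alpha>)" using radii_subset[OF assms(1,3,4)] by auto
    then have "\<bar>v\<bar> * b powr (- \<alpha>) < a powr (- \<alpha>) * b powr (- \<alpha>)"
      using assms(2) by (intro mult_strict_right_mono) auto
    moreover have "\<bar>x - x0\<bar> = \<bar>v\<bar> * b powr (- \<alpha>)" unfolding v(1) by (simp add: abs_mult)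
    ultimately show ?thesis using x01 by simp
  qed
qed

lemma nn_integral_power_tail:
  assumes "0 < \<alpha>" "0 < y"
  shows "(\<integral>\<^sup>+x. ennreal (\<alpha> * x powr (- \<alpha> - 1)) * indicator {y..} x \<partial>lborel) = ennreal (y powr (- \<alpha>))"
proof -
  have "(\<integral>\<^sup>+x. ennreal (\<alpha> * x powr (- \<alpha> - 1)) * indicator {y..} x \<partial>lborel) = ennreal (0 - (- (y powr (- \<alpha>))))"
  proof (rule nn_integral_FTC_atLeast)
    show "((\<lambda>x. - (x powr (- \<alpha>))) \<longlongrightarrow> 0) at_top" using assms(1) by real_asymp
    fix x assume "y \<le> x"
    then have x: "0 < x" using assms(2) by simp
    show "((\<lambda>x. - (x powr (- \<alpha>))) has_real_derivative \<alpha> * x powr (- \<alpha> - 1)) (at x)"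
      using x by (auto intro!: derivative_eq_intros)
    show "0 \<le> \<alpha> * x powr (- \<alpha> - 1)" using assms by simp
  qed measurable
  then show ?thesis by simp
qed

text \<open>The Levy measure is the image of Lebesgue measure under \<open>v \<mapsto> v powr (-1/\<alpha>)\<close>.\<close>

lemma levy_measure_eq:
  assumes \<alpha>: "0 < \<alpha>" and a: "0 < a" "\<forall>y\<in>J. 0 < y \<longrightarrow> ereal a < y" and J: "J \<in> sets borel"
  shows "measure (levy_measure \<alpha>) (ereal -` J) = measure lborel (radii \<alpha> J)"
proof -
  let ?X = "ereal -` J" and ?R = "a powr (- \<alpha>)"
  \<comment> \<open>The Levy measure is infinite near 0. The cutoff at \<open>a\<close>, which no
    positive point of \<open>J\<close> falls below, gives every half-line finite measure, so that
    \<open>M\<close> and \<open>N\<close> are determined by their values on half-lines.\<close>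
  define M where "M = density lborel (\<lambda>x. ennreal (indicator {a<..} x * (\<alpha> * x powr (- \<alpha> - 1))))"
  define N where "N = distr (restrict_space lborel {0<..<?R}) borel (\<lambda>u. u powr (- (1 / \<alpha>)))"
  have Nm: "(\<lambda>u. u powr (- (1 / \<alpha>))) \<in> measurable (restrict_space lborel {0<..<?R}) borel"
    by (intro measurable_restrict_space1) measurable
  have X: "?X \<in> sets borel"
    using measurable_sets[OF borel_measurable_ereal[OF measurable_ident], of J] J by (simp add: vimage_def)
  have eM: "emeasure M {x<..} = ennreal (max x a powr (- \<alpha>))" for x
  proof -
    have "emeasure M {x<..} = (\<integral>\<^sup>+t. ennreal (indicator {a<..} t * (\<alpha> * t powr (- \<alpha> - 1))) * indicator {x<..} t \<partial>lborel)"
      unfolding M_def by (subst emeasure_density) auto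
    also have "\<dots> = (\<integral>\<^sup>+t. ennreal (\<alpha> * t powr (- \<alpha> - 1)) * indicator {max x a..} t \<partial>lborel)"
    proof (rule nn_integral_cong_AE)
      have "AE t in lborel. t \<noteq> max x a" by (rule AE_lborel_singleton)
      then show "AE t in lborel. ennreal (indicator {a<..} t * (\<alpha> * t powr (- \<alpha> - 1))) * indicator {x<..} t
          = ennreal (\<alpha> * t powr (- \<alpha> - 1)) * indicator {max x a..} t"
        by eventually_elim (auto simp: indicator_def)
    qed
    also have "\<dots> = ennreal (max x a powr (- \<alpha>))" using \<alpha> a(1) by (intro nn_integral_power_tail) auto
    finally show ?thesis .
  qed
  have eN: "emeasure N {x<..} = ennreal (max x a powr (- \<alpha>))" for x
  proof -
    have ge: "a < u powr (- (1 / \<alpha>)) \<longleftrightarrow> u < ?R" if "0 < u" for u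
      using phi_gt_iff[OF \<alpha> a(1), of 0 u] that by (simp add: phi_def)
    have "(\<lambda>u. u powr (- (1 / \<alpha>))) -` {x<..} \<inter> {0<..<?R} = {0<..<max x a powr (- \<alpha>)}"
    proof (cases "x \<le> a")
      case True
      then have "x < u powr (- (1 / \<alpha>))" if "0 < u" "u < ?R" for u using ge[OF that(1)] that by auto
      then show ?thesis using True by (auto simp: max_def)
    next
      case False
      have gx: "x < u powr (- (1 / \<alpha>)) \<longleftrightarrow> u < x powr (- \<alpha>)" if "0 < u" for u
        using phi_gt_iff[OF \<alpha>, of x 0 u] that False a(1) by (simp add: phi_def)
      have "x powr (- \<alpha>) \<le> ?R" using False a(1) \<alpha> by (intro powr_mono2') auto
      then show ?thesis using gx False by (auto simp: max_def)
    qed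
    moreover have "max x a powr (- \<alpha>) \<le> ?R" using a(1) \<alpha> by (intro powr_mono2') auto
    then have "emeasure (restrict_space lborel {0<..<?R}) {0<..<max x a powr (- \<alpha>)}
        = ennreal (max x a powr (- \<alpha>))"
      by (subst emeasure_restrict_space) auto
    ultimately show ?thesis
      unfolding N_def using Nm by (subst emeasure_distr) (auto simp: space_restrict_space)
  qed
  have "M = N"
    by (rule measure_eqI_lessThan) (auto simp: eM eN, auto simp: M_def N_def)
  have "emeasure (levy_measure \<alpha>) ?X = emeasure M ?X"
  proof -
    have eq: "(indicator {0<..} t :: real) * (\<alpha> * t powr (- \<alpha> - 1)) = indicator {a<..} t * (\<alpha> * t powr (- \<alpha> - 1))"
      if "t \<in> ?X" for t
      using bspec[OF a(2), of "ereal t"] a(1) that by (auto simp: indicator_def)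
    have "ennreal (indicator {0<..} t * (\<alpha> * t powr (- \<alpha> - 1))) * indicator ?X t
        = ennreal (indicator {a<..} t * (\<alpha> * t powr (- \<alpha> - 1))) * indicator ?X t" for t
    proof (cases "t \<in> ?X")
      case True
      then show ?thesis by (simp only: eq)
    next
      case False
      then have "indicator ?X t = (0 :: ennreal)" by (rule indicator_simps)
      then show ?thesis by (simp only: mult_zero_right)
    qed
    then show ?thesis
      unfolding levy_measure_def M_def using X by (simp add: emeasure_density)
  qed
  also have "\<dots> = emeasure N ?X" by (simp only: \<open>M = N\<close>)
  also have "\<dots> = emeasure lborel ((\<lambda>u. u powr (- (1 / \<alpha>))) -` ?X \<inter> {0<..<?R})"
    unfolding N_def using Nm X
    by (subst emeasure_distr) (auto simp: space_restrict_space emeasure_restrict_space)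
  also have "(\<lambda>u. u powr (- (1 / \<alpha>))) -` ?X \<inter> {0<..<?R} = radii \<alpha> J"
    using radii_subset[OF \<alpha> a] by (auto simp: radii_def)
  finally show ?thesis by (simp add: measure_def)
qed

lemma measure_leb01_ball_le:
  assumes "S \<in> sets leb01" "S \<subseteq> {x\<in>{0..1}. \<bar>x - x0\<bar> < \<rho>}" "0 \<le> \<rho>"
  shows "measure leb01 S \<le> 2 * \<rho>"
proof -
  have "measure leb01 S = measure lborel S" using assms(2) by (intro measure_leb01) auto
  also have "\<dots> \<le> measure lborel {x0 - \<rho>..x0 + \<rho>}"
    using assms sets_leb01
    by (intro measure_mono_fmeasurable) (auto simp: abs_less_iff fmeasurable_def emeasure_lborel_Icc_eq)
  also have "\<dots> = 2 * \<rho>" using assms(3) by simp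
  finally show ?thesis .
qed

context random_mixing_maps
begin

text \<open>The normalisation of \<open>b\<close> concerns the ball of radius
  \<open>b n powr (- \<alpha>)\<close>. Divided by this radius, the stationary measures of the level
  set and of the ball converge with a common factor \<Gamma>, which cancels in their
  quotient.\<close>

lemma stationary_asymptotics:
  assumes \<alpha>: "0 < \<alpha>" and x0: "0 < x0" "x0 < 1" and b: "\<And>n. 0 < b n"
    and lim: "(\<lambda>n. real n * stationary_prob T p {x\<in>{0..1}. phi \<alpha> x0 x > ereal (b n)}) \<longlonglongrightarrow> 1"
    and J: "J \<in> J_family"
  shows "\<forall>\<^sub>F n in sequentially. b n powr (- \<alpha>) \<le> 1 / (c * real n)"
    and "(\<lambda>n. real n * stationary_prob T p (scaled_level \<alpha> x0 (b n) J)) \<longlonglongrightarrow> measure (levy_measure \<alpha>) (ereal -` J)"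
proof -
  define r where "r n = b n powr (- \<alpha>)" for n
  define \<delta> where "\<delta> = min x0 (1 - x0)"
  have \<delta>: "0 < \<delta>" using x0 by (simp add: \<delta>_def)
  have r: "0 < r n" for n using b[of n] by (simp add: r_def)
  define B where "B n = {x\<in>{0..1}. phi \<alpha> x0 x > ereal (b n)}" for n
  have B: "B n = {x\<in>{0..1}. \<bar>x - x0\<bar> < r n}" for n
    unfolding B_def r_def by (simp add: phi_gt_iff[OF \<alpha> b])
  have Bs: "B n \<in> sets leb01" for n
    unfolding B_def by (intro interval_in_sets_leb01 phi_superlevel_interval[OF \<alpha>]) auto
  have lim': "(\<lambda>n. real n * stationary_prob T p (B n)) \<longlonglongrightarrow> 1" using lim by (simp add: B_def)
  \<comment> \<open>At this stage \<open>r n\<close> is not known to be small, and only points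
    within \<delta> of \<open>x0\<close> are sure to lie in \<open>[0,1]\<close>. The minimum
    disappears once it is bounded by \<open>1 / (c * real n)\<close>, which eventually falls below
    \<delta>.\<close>
  have Bm: "2 * min (r n) \<delta> \<le> measure leb01 (B n)" for n
  proof -
    let ?m = "min (r n) \<delta>"
    have m: "0 < ?m" using r \<delta> by simp
    have sub: "{x0 - ?m<..<x0 + ?m} \<subseteq> B n" unfolding B by (auto simp: \<delta>_def)
    have "2 * ?m = measure lborel {x0 - ?m<..<x0 + ?m}" using m by (subst measure_lborel_Ioo) auto
    also have "\<dots> = measure leb01 {x0 - ?m<..<x0 + ?m}"
      using sub Bs[of n] sets_leb01 by (subst measure_leb01) auto
    also have "\<dots> \<le> measure leb01 (B n)"
      using sub Bs[of n] sets_leb01 by (intro leb01.finite_measure_mono) auto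
    finally show ?thesis .
  qed
  have min_le: "\<forall>\<^sub>F n in sequentially. min (r n) \<delta> \<le> 1 / (c * real n)"
  proof -
    have "\<forall>\<^sub>F n in sequentially. real n * stationary_prob T p (B n) < 2"
      using order_tendstoD(2)[OF lim'] by auto
    then show ?thesis using eventually_gt_at_top[of 0]
    proof eventually_elim
      case (elim n)
      have "c * (2 * min (r n) \<delta>) \<le> c * measure leb01 (B n)"
        using Bm c_pos by (intro mult_left_mono) auto
      also have "\<dots> \<le> stationary_prob T p (B n)" by (rule stationary_ge[OF Bs])
      finally have "real n * (c * (2 * min (r n) \<delta>)) \<le> real n * stationary_prob T p (B n)"
        by (intro mult_left_mono) auto
      with elim(1) have "c * real n * min (r n) \<delta> \<le> 1" by (simp add: mult_ac)
      then show ?case using elim(2) c_pos by (simp add: field_simps)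
    qed
  qed
  moreover have "(\<lambda>n. 1 / (c * real n)) \<longlonglongrightarrow> 0" using c_pos by real_asymp
  then have "\<forall>\<^sub>F n in sequentially. 1 / (c * real n) < \<delta>"
    using \<delta> by (rule order_tendstoD(2))
  ultimately have r_le: "\<forall>\<^sub>F n in sequentially. r n \<le> 1 / (c * real n)"
    by eventually_elim (auto simp: min_def split: if_splits)
  then show "\<forall>\<^sub>F n in sequentially. b n powr (- \<alpha>) \<le> 1 / (c * real n)" by (simp add: r_def)
  have r0: "r \<longlonglongrightarrow> 0"
    by (rule tendsto_sandwich[OF _ r_le tendsto_const \<open>(\<lambda>n. 1 / (c * real n)) \<longlonglongrightarrow> 0\<close>])
      (intro always_eventually allI less_imp_le r)
  obtain a L where a: "0 < a" "\<forall>y\<in>J. 0 < y \<longrightarrow> ereal a < y" and Jb: "J \<in> sets borel"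
    and As: "\<And>b. 0 < b \<Longrightarrow> scaled_level \<alpha> x0 b J \<in> sets leb01"
    using J_family_props[OF J \<alpha>, of x0] by metis
  define A where "A n = scaled_level \<alpha> x0 (b n) J" for n
  define W where "W = radii \<alpha> J"
  define R where "R = a powr (- \<alpha>)"
  have R: "0 < R" using a(1) by (simp add: R_def)
  have W: "W \<in> sets borel" "W \<subseteq> {0<..<R}"
    using radii_borel[OF Jb] radii_subset[OF \<alpha> a] by (auto simp: W_def R_def)
  have As: "A n \<in> sets leb01" for n using As b by (simp add: A_def)
  have small: "\<forall>\<^sub>F n in sequentially. s * r n < \<delta>" for s
    using order_tendstoD(2)[OF tendsto_mult_right_zero[OF r0, of s] \<delta>] .
  have inside: "x0 + r n * v \<in> {0..1}" if "\<bar>v\<bar> < s" "s * r n < \<delta>" for n v s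
  proof -
    have "\<bar>r n * v\<bar> = \<bar>v\<bar> * r n" using r[of n] by (simp add: abs_mult)
    also have "\<dots> \<le> s * r n" using that r[of n] by (intro mult_right_mono) auto
    finally have "\<bar>r n * v\<bar> < \<delta>" using that by simp
    then show ?thesis by (auto simp: \<delta>_def abs_less_iff)
  qed
  have AW: "\<forall>\<^sub>F n in sequentially. \<forall>v. v \<noteq> 0 \<longrightarrow> (x0 + r n * v \<in> A n \<longleftrightarrow> \<bar>v\<bar> \<in> W)"
    using small[of R]
  proof eventually_elim
    case (elim n)
    show ?case
    proof (intro allI impI)
      fix v :: real assume v: "v \<noteq> 0"
      have "\<bar>v\<bar> \<in> W \<Longrightarrow> x0 + r n * v \<in> {0..1}" using W(2) by (intro inside[OF _ elim]) auto
      then show "x0 + r n * v \<in> A n \<longleftrightarrow> \<bar>v\<bar> \<in> W"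
        using scaled_level_iff[OF \<alpha> b[of n] v, of x0 J] by (auto simp: A_def W_def r_def)
    qed
  qed
  have BW: "\<forall>\<^sub>F n in sequentially. \<forall>v. v \<noteq> 0 \<longrightarrow> (x0 + r n * v \<in> B n \<longleftrightarrow> \<bar>v\<bar> \<in> {0<..<1})"
    using small[of 1]
  proof eventually_elim
    case (elim n)
    show ?case
    proof (intro allI impI)
      fix v :: real assume v: "v \<noteq> 0"
      have "\<bar>v\<bar> < 1 \<Longrightarrow> x0 + r n * v \<in> {0..1}" by (intro inside[OF _ elim]) auto
      moreover have "\<bar>r n * v\<bar> < r n \<longleftrightarrow> \<bar>v\<bar> < 1" using r[of n] by (simp add: abs_mult)
      ultimately show "x0 + r n * v \<in> B n \<longleftrightarrow> \<bar>v\<bar> \<in> {0<..<1}" using v unfolding B by auto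
    qed
  qed
  have "\<exists>\<gamma>. (\<lambda>n. measure (\<nu> \<omega>) (A n) / r n) \<longlonglongrightarrow> \<gamma> * measure lborel W \<and>
      (\<lambda>n. measure (\<nu> \<omega>) (B n) / r n) \<longlonglongrightarrow> \<gamma>" for \<omega>
  proof -
    obtain \<gamma> where \<gamma>: "\<And>W R A r. W \<in> sets borel \<Longrightarrow> W \<subseteq> {0<..<R} \<Longrightarrow> (\<And>n. 0 < r n) \<Longrightarrow> r \<longlonglongrightarrow> 0 \<Longrightarrow>
      (\<And>n. A n \<in> sets leb01) \<Longrightarrow>
      (\<forall>\<^sub>F n in sequentially. \<forall>v. v \<noteq> 0 \<longrightarrow> (x0 + r n * v \<in> A n \<longleftrightarrow> \<bar>v\<bar> \<in> W)) \<Longrightarrow>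
      (\<lambda>n. measure (\<nu> \<omega>) (A n) / r n) \<longlonglongrightarrow> \<gamma> * measure lborel W"
      using local_limit[OF x0, of \<omega>] by blast
    show ?thesis
      using \<gamma>[OF W r r0 As AW] \<gamma>[of "{0<..<1}" 1, OF _ _ r r0 Bs BW] by (intro exI[of _ \<gamma>]) auto
  qed
  then obtain \<gamma> where \<gamma>A: "\<And>\<omega>. (\<lambda>n. measure (\<nu> \<omega>) (A n) / r n) \<longlonglongrightarrow> \<gamma> \<omega> * measure lborel W"
    and \<gamma>B: "\<And>\<omega>. (\<lambda>n. measure (\<nu> \<omega>) (B n) / r n) \<longlonglongrightarrow> \<gamma> \<omega>"
    by metis
  have \<gamma>m [measurable]: "\<gamma> \<in> borel_measurable \<P>"
    by (rule borel_measurable_LIMSEQ_real[OF \<gamma>B]) (use Bs in measurable)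
  have ball: "measure leb01 S / r n \<le> 2 * s" if "S \<in> sets leb01" "S \<subseteq> {x\<in>{0..1}. \<bar>x - x0\<bar> < s * r n}" "0 < s" for S s n
  proof -
    have "measure leb01 S \<le> 2 * (s * r n)"
      using that r[of n] by (intro measure_leb01_ball_le) auto
    then show ?thesis using r[of n] by (simp add: field_simps)
  qed
  have dom: "norm (measure (\<nu> \<omega>) S / r n) \<le> 2 * H * (2 * s)"
    if "S \<in> sets leb01" "S \<subseteq> {x\<in>{0..1}. \<bar>x - x0\<bar> < s * r n}" "0 < s" for S s n \<omega>
  proof -
    have "measure (\<nu> \<omega>) S / r n \<le> 2 * H * measure leb01 S / r n"
      using measure_\<nu>_le[OF that(1)] r[of n] by (intro divide_right_mono) auto
    also have "\<dots> = 2 * H * (measure leb01 S / r n)" by simp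
    also have "\<dots> \<le> 2 * H * (2 * s)" using ball[OF that] H_pos by (intro mult_left_mono) auto
    finally show ?thesis using r[of n] by simp
  qed
  have subA: "A n \<subseteq> {x\<in>{0..1}. \<bar>x - x0\<bar> < R * r n}" for n
    using scaled_level_subset_ball[OF \<alpha> b a] by (simp add: A_def R_def r_def)
  have subB: "B n \<subseteq> {x\<in>{0..1}. \<bar>x - x0\<bar> < 1 * r n}" for n by (simp add: B)
  have sA: "(\<lambda>n. stationary_prob T p (A n) / r n) \<longlonglongrightarrow> (\<integral>\<omega>. \<gamma> \<omega> * measure lborel W \<partial>\<P>)"
    unfolding stationary_prob_def integral_divide_zero[symmetric]
    by (rule integral_dominated_convergence[where w = "\<lambda>_. 2 * H * (2 * R)"])
      (use As \<gamma>A dom[OF As subA R] in \<open>auto intro!: borel_measurable_divide measure_\<nu>_measurable\<close>)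
  have sB: "(\<lambda>n. stationary_prob T p (B n) / r n) \<longlonglongrightarrow> (\<integral>\<omega>. \<gamma> \<omega> \<partial>\<P>)"
    unfolding stationary_prob_def integral_divide_zero[symmetric]
    by (rule integral_dominated_convergence[where w = "\<lambda>_. 2 * H * (2 * 1)"])
      (use Bs \<gamma>B dom[OF Bs subB] in \<open>auto intro!: borel_measurable_divide measure_\<nu>_measurable\<close>)
  define \<Gamma> where "\<Gamma> = (\<integral>\<omega>. \<gamma> \<omega> \<partial>\<P>)"
  have sA': "(\<lambda>n. stationary_prob T p (A n) / r n) \<longlonglongrightarrow> \<Gamma> * measure lborel W"
    using sA by (simp add: \<Gamma>_def)
  have sB': "(\<lambda>n. stationary_prob T p (B n) / r n) \<longlonglongrightarrow> \<Gamma>" using sB by (simp add: \<Gamma>_def)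
  have ge: "\<forall>\<^sub>F n in sequentially. 2 * c \<le> stationary_prob T p (B n) / r n"
    using small[of 1]
  proof eventually_elim
    case (elim n)
    have "c * (2 * r n) \<le> c * measure leb01 (B n)"
      using Bm[of n] elim c_pos by (intro mult_left_mono) auto
    also have "\<dots> \<le> stationary_prob T p (B n)" by (rule stationary_ge[OF Bs])
    finally show ?case using r[of n] by (simp add: field_simps)
  qed
  \<comment> \<open>The sample densities are bounded below by \<open>c\<close>, which makes the
    division by \<Gamma> legitimate.\<close>
  have "2 * c \<le> \<Gamma>" by (rule tendsto_lowerbound[OF sB' ge]) simp
  then have \<Gamma>: "\<Gamma> \<noteq> 0" using c_pos by auto
  have "(\<lambda>n. (stationary_prob T p (A n) / r n) / (stationary_prob T p (B n) / r n) * (real n * stationary_prob T p (B n)))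
      \<longlonglongrightarrow> \<Gamma> * measure lborel W / \<Gamma> * 1"
    by (intro tendsto_mult tendsto_divide sA' sB' lim' \<Gamma>)
  then have "(\<lambda>n. (stationary_prob T p (A n) / r n) / (stationary_prob T p (B n) / r n) * (real n * stationary_prob T p (B n)))
      \<longlonglongrightarrow> measure lborel W"
    using \<Gamma> by simp
  moreover have "\<forall>\<^sub>F n in sequentially. (stationary_prob T p (A n) / r n) / (stationary_prob T p (B n) / r n) * (real n * stationary_prob T p (B n))
      = real n * stationary_prob T p (A n)"
    using ge
  proof eventually_elim
    case (elim n)
    then have "stationary_prob T p (B n) \<noteq> 0" using c_pos by auto
    then show ?case using r[of n] by simp
  qed
  ultimately have "(\<lambda>n. real n * stationary_prob T p (A n)) \<longlonglongrightarrow> measure lborel W"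
    by (rule Lim_transform_eventually)
  then show "(\<lambda>n. real n * stationary_prob T p (scaled_level \<alpha> x0 (b n) J)) \<longlonglongrightarrow> measure (levy_measure \<alpha>) (ereal -` J)"
    using levy_measure_eq[OF \<alpha> a Jb] by (simp add: A_def W_def)
qed

end

section \<open>The exponential law\<close>

lemma window_ratio_tendsto_0: "(\<lambda>n. real (window n) / real n) \<longlonglongrightarrow> 0"
proof (rule tendsto_sandwich[OF _ _ tendsto_const])
  show "(\<lambda>n. 2 * real n powr (1 / 4) / real n) \<longlonglongrightarrow> 0" by real_asymp
  show "\<forall>\<^sub>F n in sequentially. real (window n) / real n \<le> 2 * real n powr (1 / 4) / real n"
    using eventually_ge_at_top[of 1] by eventually_elim (intro divide_right_mono window_le, auto)
qed auto

text \<open>The deterministic part of the argument, for one fixed \<omega>: \<open>conc\<close> and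
  \<open>ret\<close> are what almost every \<omega> provides. As they mention neither
  \<open>s\<close> nor \<open>t\<close>, no null set depending on these arises.\<close>

lemma (in mixing_maps) survive_limit:
  assumes U: "\<And>n. variation_le L (indicator (U n))" "\<And>n. U n \<in> sets leb01" "0 \<le> L"
    and B: "\<And>n. variation_le 2 (indicator (B n))" "\<And>n. B n \<in> sets leb01" "\<And>n. U n \<subseteq> B n"
    and small: "\<forall>\<^sub>F n in sequentially. measure leb01 (B n) \<le> \<beta> / real n" and \<beta>: "0 < \<beta>"
    and conc: "\<And>m \<epsilon>. 0 < \<epsilon> \<Longrightarrow> \<forall>\<^sub>F n in sequentially. \<forall>N \<le> m * n.
      \<bar>(\<Sum>k<N. measure (\<nu> (shift (int (Suc k)) \<omega>)) (U n)) - real N * \<sigma> n\<bar> < \<epsilon>"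
    and \<sigma>: "(\<lambda>n. real n * \<sigma> n) \<longlonglongrightarrow> \<Lambda>"
    and ret: "\<And>K. \<forall>\<^sub>F n in sequentially. \<forall>k x j. x \<in> B n \<longrightarrow> 1 \<le> j \<longrightarrow> j \<le> K \<longrightarrow>
      orbit_map T (shift (int k) \<omega>) j x \<notin> B n"
    and st: "0 \<le> s" "s < t"
  shows "(\<lambda>n. measure (\<nu> (shift \<lfloor>real n * s\<rfloor> \<omega>)) (survive (U n) (shift \<lfloor>real n * s\<rfloor> \<omega>) (nat \<lfloor>real n * (t - s)\<rfloor>)))
    \<longlonglongrightarrow> exp (- (t - s) * \<Lambda>)"
proof -
  define a where "a n = nat \<lfloor>real n * s\<rfloor>" for n
  define N where "N n = nat \<lfloor>real n * (t - s)\<rfloor>" for n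
  have a: "\<lfloor>real n * s\<rfloor> = int (a n)" for n using st by (simp add: a_def)
  have N_le: "real (N n) \<le> real n * (t - s)" "real n * (t - s) - 1 \<le> real (N n)" for n
    using st by (auto simp: N_def)
  have a_le: "real (a n) \<le> real n * s" for n using st by (simp add: a_def)
  define X where "X n = measure (\<nu> (shift (int (a n)) \<omega>)) (survive (U n) (shift (int (a n)) \<omega>) (N n))" for n
  define Y where "Y n = (\<Sum>k<N n. measure (\<nu> (shift (int (Suc k)) (shift (int (a n)) \<omega>))) (U n))" for n
  have Y: "Y \<longlonglongrightarrow> (t - s) * \<Lambda>"
  proof -
    \<comment> \<open>The block of times after \<open>a n\<close> moves with \<open>n\<close>; as a
      difference of two initial sums it is covered by \<open>conc\<close>.\<close>
    have Yn: "Y n = (\<Sum>k<a n + N n. measure (\<nu> (shift (int (Suc k)) \<omega>)) (U n)) - (\<Sum>k<a n. measure (\<nu> (shift (int (Suc k)) \<omega>)) (U n))" for n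
    proof -
      have "shift (int (Suc k)) (shift (int (a n)) \<omega>) = shift (int (Suc (a n + k))) \<omega>" for k
        by (simp only: shift_shift of_nat_Suc of_nat_add ac_simps)
      then have "Y n = (\<Sum>k<N n. measure (\<nu> (shift (int (Suc (a n + k))) \<omega>)) (U n))"
        by (simp only: Y_def)
      also have "\<dots> = (\<Sum>k\<in>{a n..<a n + N n}. measure (\<nu> (shift (int (Suc k)) \<omega>)) (U n))"
        by (rule sum.reindex_bij_witness[of _ "\<lambda>k. k - a n" "\<lambda>k. a n + k"]) auto
      also have "\<dots> = (\<Sum>k<a n + N n. measure (\<nu> (shift (int (Suc k)) \<omega>)) (U n)) - (\<Sum>k<a n. measure (\<nu> (shift (int (Suc k)) \<omega>)) (U n))"
        using sum_diff[of "{..<a n + N n}" "{..<a n}" "\<lambda>k. measure (\<nu> (shift (int (Suc k)) \<omega>)) (U n)"]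
        by (simp add: lessThan_minus_lessThan)
      finally show ?thesis .
    qed
    have "(\<lambda>n. Y n - real (N n) * \<sigma> n) \<longlonglongrightarrow> 0"
    proof (rule tendstoI)
      fix \<epsilon> :: real assume \<epsilon>: "0 < \<epsilon>"
      define m where "m = nat \<lceil>t\<rceil>"
      have m: "t \<le> real m" unfolding m_def by linarith
      have "\<forall>\<^sub>F n in sequentially. \<forall>N \<le> m * n.
        \<bar>(\<Sum>k<N. measure (\<nu> (shift (int (Suc k)) \<omega>)) (U n)) - real N * \<sigma> n\<bar> < \<epsilon> / 2"
        using \<epsilon> by (intro conc) simp
      then show "\<forall>\<^sub>F n in sequentially. dist (Y n - real (N n) * \<sigma> n) 0 < \<epsilon>"
      proof eventually_elim
        case (elim n)
        have "real (a n + N n) \<le> real n * t" using a_le[of n] N_le(1)[of n] by (simp add: algebra_simps)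
        also have "\<dots> \<le> real (m * n)" using m by (simp add: mult.commute mult_right_mono)
        finally have le: "a n + N n \<le> m * n" by (simp only: of_nat_le_iff)
        then have le': "a n \<le> m * n" by simp
        have "Y n - real (N n) * \<sigma> n =
            ((\<Sum>k<a n + N n. measure (\<nu> (shift (int (Suc k)) \<omega>)) (U n)) - real (a n + N n) * \<sigma> n)
            - ((\<Sum>k<a n. measure (\<nu> (shift (int (Suc k)) \<omega>)) (U n)) - real (a n) * \<sigma> n)"
          unfolding Yn of_nat_add distrib_right by simp
        then show ?case
          using elim[rule_format, OF le] elim[rule_format, OF le'] unfolding dist_real_def by linarith
      qed
    qed
    moreover have "(\<lambda>n. real (N n) * \<sigma> n) \<longlonglongrightarrow> (t - s) * \<Lambda>"
    proof -
      have "(\<lambda>n. real (N n) / real n) \<longlonglongrightarrow> t - s"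
      proof (rule tendsto_sandwich)
        show "(\<lambda>n. (t - s) - 1 / real n) \<longlonglongrightarrow> t - s" by real_asymp
        show "\<forall>\<^sub>F n in sequentially. (t - s) - 1 / real n \<le> real (N n) / real n"
          using eventually_gt_at_top[of 0]
        proof eventually_elim
          case (elim n)
          have "(real n * (t - s) - 1) / real n \<le> real (N n) / real n"
            using N_le(2)[of n] by (rule divide_right_mono) simp
          then show ?case using elim by (simp add: diff_divide_distrib)
        qed
        show "\<forall>\<^sub>F n in sequentially. real (N n) / real n \<le> t - s"
          using eventually_gt_at_top[of 0]
        proof eventually_elim
          case (elim n)
          then show ?case using N_le(1)[of n] by (simp add: pos_divide_le_eq mult.commute)
        qed
      qed (rule tendsto_const)
      then have "(\<lambda>n. real (N n) / real n * (real n * \<sigma> n)) \<longlonglongrightarrow> (t - s) * \<Lambda>"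
        using \<sigma> by (rule tendsto_mult)
      moreover have "\<forall>\<^sub>F n in sequentially. real (N n) / real n * (real n * \<sigma> n) = real (N n) * \<sigma> n"
        using eventually_gt_at_top[of 0] by eventually_elim simp
      ultimately show ?thesis by (rule Lim_transform_eventually)
    qed
    ultimately have "(\<lambda>n. (Y n - real (N n) * \<sigma> n) + real (N n) * \<sigma> n) \<longlonglongrightarrow> 0 + (t - s) * \<Lambda>"
      by (rule tendsto_add)
    then show ?thesis by simp
  qed
  let ?D = "4 * C * (L + 1) * H"
  have "(\<lambda>n. X n - exp (- Y n)) \<longlonglongrightarrow> 0"
  proof (rule tendstoI)
    fix \<epsilon> :: real assume \<epsilon>: "0 < \<epsilon>"
    \<comment> \<open>\<open>Q * \<theta> ^ K\<close> bounds the total contribution of the geometric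
      tails in \<open>short_returns\<close>. It does not shrink as \<open>n\<close> grows, so
      \<open>K\<close> is fixed before \<open>n\<close>.\<close>
    define Q where "Q = (t - s) * (12 * C * H * \<beta> / (1 - \<theta>))"
    have "(\<lambda>K. Q * \<theta> ^ K) \<longlonglongrightarrow> 0"
      using \<theta>_pos \<theta>_less by (intro tendsto_mult_right_zero LIMSEQ_power_zero) auto
    then have "\<forall>\<^sub>F K in sequentially. Q * \<theta> ^ K < \<epsilon> / 2" using \<epsilon> by (intro order_tendstoD(2)) auto
    then obtain K where K: "Q * \<theta> ^ K < \<epsilon> / 2" using eventually_happens'[OF sequentially_bot] by blast
    \<comment> \<open>The errors that vanish with \<open>n\<close>, for a gap of length
      \<open>window n\<close>. In twice the window plus 1, one copy comes from the quadratic term of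
      \<open>short_returns\<close> and \<open>Suc (window n)\<close> from
      \<open>survive_exp\<close>; the last summand is the decorrelation error across the
      gap.\<close>
    define G where "G n = (t - s) * ((2 * H * \<beta>)\<^sup>2 * (2 * (real (window n) / real n) + 1 / real n) + ?D * (real n * \<theta> ^ window n))" for n
    have "G \<longlonglongrightarrow> (t - s) * ((2 * H * \<beta>)\<^sup>2 * (2 * 0 + 0) + ?D * 0)"
      unfolding G_def
      by (intro tendsto_mult tendsto_add tendsto_const window_ratio_tendsto_0 lim_1_over_n
          power_window_tendsto_0 \<theta>_pos \<theta>_less)
    then have "\<forall>\<^sub>F n in sequentially. G n < \<epsilon> / 2" using \<epsilon> by (intro order_tendstoD(2)) auto
    then show "\<forall>\<^sub>F n in sequentially. dist (X n - exp (- Y n)) 0 < \<epsilon>"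
      using small ret[of K] eventually_gt_at_top[of 0]
    proof eventually_elim
      case (elim n)
      let ?\<omega> = "shift (int (a n)) \<omega>" and ?b = "\<beta> / real n" and ?w = "window n"
      let ?e = "real ?w * (2 * H * ?b)\<^sup>2 + 12 * C * H * ?b * (\<theta> ^ K / (1 - \<theta>))"
      have up: "measure (\<nu> \<omega>') (U n) \<le> 2 * H * ?b" for \<omega>'
      proof -
        have "measure (\<nu> \<omega>') (U n) \<le> measure (\<nu> \<omega>') (B n)"
          using B by (intro \<nu>.finite_measure_mono) auto
        also have "\<dots> \<le> 2 * H * measure leb01 (B n)" by (rule measure_\<nu>_le[OF B(2)])
        also have "\<dots> \<le> 2 * H * ?b" using elim(2) H_pos by (intro mult_left_mono) auto
        finally show ?thesis .
      qed
      have short: "measure (\<nu> (shift (int (Suc k)) ?\<omega>)) (U n - survive (U n) (shift (int (Suc k)) ?\<omega>) ?w) \<le> ?e" for k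
      proof (rule short_returns[OF B(1,2) U(2) B(3) _ elim(2)])
        fix x j assume "x \<in> B n" "1 \<le> j" "j \<le> K"
        moreover have "shift (int (Suc k)) ?\<omega> = shift (int (Suc k + a n)) \<omega>"
          by (simp only: shift_shift of_nat_add)
        ultimately show "orbit_map T (shift (int (Suc k)) ?\<omega>) j x \<notin> B n" using elim(3) by metis
      qed
      have "\<bar>X n - exp (- Y n)\<bar>
        \<le> (\<Sum>k<N n. measure (\<nu> (shift (int (Suc k)) ?\<omega>)) (U n - survive (U n) (shift (int (Suc k)) ?\<omega>) ?w))
          + real (N n) * (?D * \<theta> ^ ?w + real (Suc ?w) * (2 * H * ?b)\<^sup>2)"
        unfolding X_def Y_def by (rule survive_exp[OF U up])
      also have "\<dots> \<le> (\<Sum>k<N n. ?e) + real (N n) * (?D * \<theta> ^ ?w + real (Suc ?w) * (2 * H * ?b)\<^sup>2)"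
        by (intro add_right_mono sum_mono short)
      also have "\<dots> = real (N n) * (?e + (?D * \<theta> ^ ?w + real (Suc ?w) * (2 * H * ?b)\<^sup>2))"
        by (simp add: algebra_simps)
      also have "\<dots> \<le> (real n * (t - s)) * (?e + (?D * \<theta> ^ ?w + real (Suc ?w) * (2 * H * ?b)\<^sup>2))"
        using C_pos H_pos \<theta>_pos \<theta>_less \<beta> U(3) by (intro mult_right_mono N_le add_nonneg_nonneg) auto
      also have "\<dots> = Q * \<theta> ^ K + G n"
      proof -
        have "x * \<tau> * (w * (2 * g * y)\<^sup>2 + 12 * d * g * y * u + (e * v + (1 + w) * (2 * g * y)\<^sup>2))
            = \<tau> * (12 * d * g * (x * y) * u) + \<tau> * ((2 * g)\<^sup>2 * (x * y\<^sup>2) * (2 * w + 1) + e * (x * v))"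
          for x \<tau> w g y d u e v :: real
          by (simp add: algebra_simps power2_eq_square)
        then have "real n * (t - s) * (?e + (?D * \<theta> ^ ?w + (1 + real ?w) * (2 * H * ?b)\<^sup>2))
          = (t - s) * (12 * C * H * (real n * ?b) * (\<theta> ^ K / (1 - \<theta>)))
            + (t - s) * ((2 * H)\<^sup>2 * (real n * ?b\<^sup>2) * (2 * real ?w + 1) + ?D * (real n * \<theta> ^ ?w))" .
        moreover have "real n * ?b = \<beta>" using elim(4) by simp
        moreover have "(2 * H)\<^sup>2 * (real n * ?b\<^sup>2) * (2 * real ?w + 1)
            = (2 * H * \<beta>)\<^sup>2 * (2 * (real ?w / real n) + 1 / real n)"
          using elim(4) by (simp add: field_simps power2_eq_square)
        moreover have "(t - s) * (12 * C * H * \<beta> * (\<theta> ^ K / (1 - \<theta>))) = Q * \<theta> ^ K" by (simp add: Q_def)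
        ultimately show ?thesis unfolding G_def of_nat_Suc by (simp only:)
      qed
      finally show ?case using K elim(1) by (simp add: dist_real_def)
    qed
  qed
  moreover have "(\<lambda>n. exp (- Y n)) \<longlonglongrightarrow> exp (- ((t - s) * \<Lambda>))" by (intro tendsto_intros Y)
  ultimately have "(\<lambda>n. (X n - exp (- Y n)) + exp (- Y n)) \<longlonglongrightarrow> 0 + exp (- ((t - s) * \<Lambda>))"
    by (rule tendsto_add)
  then have "X \<longlonglongrightarrow> exp (- (t - s) * \<Lambda>)" by (simp only: diff_add_cancel add_0 mult_minus_left)
  then show ?thesis unfolding X_def[abs_def] N_def a .
qed

section \<open>Continuity and absence of early returns at x0\<close>

lemma partition_endpoints_interior:
  assumes "x0 \<in> {0..1} - partition_endpoints T A"
  shows "0 < x0" "x0 < 1"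
proof -
  \<comment> \<open>For \<open>n = 0\<close> no condition is imposed, so the partition is
    \<open>[0,1]\<close> alone and its two ends count as endpoints.\<close>
  have "{0..1} \<in> join_partition T A \<omega> 0" for \<omega> by (auto simp: join_partition_def)
  then have "frontier {0..1::real} \<subseteq> partition_endpoints T A"
    unfolding partition_endpoints_def by blast
  then have "x0 \<notin> {0, 1}" using assms by (auto simp: frontier_def)
  then show "0 < x0" "x0 < 1" using assms by auto
qed

text \<open>\<open>x0\<close> lies in an element \<open>Z\<close> of the \<open>n\<close>-th
  partition and on the frontier of none, hence in the interior of \<open>Z\<close>. On
  \<open>Z\<close> the orbit map is a composition of continuous branches.\<close>

lemma isCont_orbit_map:
  assumes exp: "\<And>i. uniformly_expanding (T i) (A i)" and x0: "x0 \<in> {0..1} - partition_endpoints T A"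
  shows "isCont (orbit_map T \<omega> n) x0"
proof -
  have A: "\<Union>(A i) = {0..1}" "T i ` {0..1} \<subseteq> {0..1}" for i
    using exp[of i] by (auto simp: uniformly_expanding_def partition_on_def)
  have orb: "orbit_map T \<omega> k x0 \<in> {0..1}" for k
    by (induction k) (use x0 A(2) in \<open>auto simp del: atLeastAtMost_iff\<close>)
  have "\<exists>B. B \<in> A (\<omega> (int k)) \<and> orbit_map T \<omega> k x0 \<in> B" for k
    using orb[of k] A(1)[of "\<omega> (int k)"] by blast
  then obtain B where B: "\<And>k. B k \<in> A (\<omega> (int k))" "\<And>k. orbit_map T \<omega> k x0 \<in> B k" by metis
  define Z where "Z = {x\<in>{0..1}. \<forall>k<n. orbit_map T \<omega> k x \<in> B k}"
  have x0Z: "x0 \<in> Z" using x0 B(2) by (auto simp: Z_def)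
  moreover have "\<forall>k<n. B k \<in> A (shift (int k) \<omega> 0)" using B(1) by simp
  then have "Z \<in> {{x\<in>{0..1}. \<forall>k<n. orbit_map T \<omega> k x \<in> B k} | B. \<forall>k<n. B k \<in> A (shift (int k) \<omega> 0)}"
    unfolding Z_def by blast
  ultimately have "Z \<in> join_partition T A \<omega> n" unfolding join_partition_def by blast
  then have "x0 \<notin> frontier Z" using x0 unfolding partition_endpoints_def by blast
  then have int: "x0 \<in> interior Z" using x0Z closure_subset by (auto simp: frontier_def)
  have cont: "continuous_on Z (orbit_map T \<omega> k)" if "k \<le> n" for k
    using that
  proof (induction k)
    case 0
    then show ?case by (simp add: continuous_on_id)
  next
    case (Suc k)
    have "continuous_on (B k) (T (\<omega> (int k)))"
      by (rule uniformly_expanding_branch(2)[OF exp B(1)])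
    moreover have "orbit_map T \<omega> k ` Z \<subseteq> B k" using Suc.prems by (auto simp: Z_def)
    ultimately have "continuous_on (orbit_map T \<omega> k ` Z) (T (\<omega> (int k)))"
      by (rule continuous_on_subset)
    then show ?case using continuous_on_compose[OF Suc.IH] Suc.prems by (simp add: comp_def)
  qed
  have "continuous_on (interior Z) (orbit_map T \<omega> n)"
    using cont[of n] interior_subset by (rule_tac continuous_on_subset) auto
  then show ?thesis using int by (simp add: continuous_on_eq_continuous_at)
qed

text \<open>
  Only finitely many words of length \<open>K\<close> exist, so continuity at \<open>x0\<close> makes the absence of returns
  before time \<open>K\<close> uniform over all admissible sequences.
\<close>

lemma no_short_returns:
  fixes T :: "'q::finite \<Rightarrow> real \<Rightarrow> real"
  assumes cont: "\<And>\<omega> n. isCont (orbit_map T \<omega> n) x0"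
  obtains \<delta> where "0 < \<delta>" "\<And>\<omega> j x. (\<And>j. 1 \<le> j \<Longrightarrow> orbit_map T \<omega> j x0 \<noteq> x0) \<Longrightarrow> 1 \<le> j \<Longrightarrow> j \<le> K \<Longrightarrow>
    \<bar>x - x0\<bar> < \<delta> \<Longrightarrow> \<delta> \<le> \<bar>orbit_map T \<omega> j x - x0\<bar>"
proof -
  \<comment> \<open>The same \<delta> bounds the distance of the starting point and separates its
    image from \<open>x0\<close>, so that a ball of radius at most \<delta> cannot return into
    itself.\<close>
  let ?P = "\<lambda>\<omega> j \<delta>. orbit_map T \<omega> j x0 \<noteq> x0 \<longrightarrow> (\<forall>x. \<bar>x - x0\<bar> < \<delta> \<longrightarrow> \<delta> \<le> \<bar>orbit_map T \<omega> j x - x0\<bar>)"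
  define \<Omega> where "\<Omega> = ({0..<int K} \<rightarrow>\<^sub>E (UNIV :: 'q set))"
  have fin: "finite \<Omega>" unfolding \<Omega>_def by (intro finite_PiE) auto
  have single: "\<forall>\<^sub>F \<delta> in at_right 0. ?P \<omega> j \<delta>" for \<omega> j
  proof (cases "orbit_map T \<omega> j x0 = x0")
    case False
    define e where "e = \<bar>orbit_map T \<omega> j x0 - x0\<bar> / 2"
    have e: "0 < e" using False by (simp add: e_def)
    obtain d where d: "0 < d" "\<And>x. \<bar>x - x0\<bar> < d \<Longrightarrow> \<bar>orbit_map T \<omega> j x - orbit_map T \<omega> j x0\<bar> < e"
      using cont[of \<omega> j] e unfolding continuous_at_eps_delta by (auto simp: dist_real_def)
    have "?P \<omega> j \<delta>" if "\<delta> < min d e" for \<delta>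
    proof (intro impI allI)
      fix x assume "\<bar>x - x0\<bar> < \<delta>"
      then have "\<bar>orbit_map T \<omega> j x - orbit_map T \<omega> j x0\<bar> < e" using that by (intro d(2)) auto
      moreover have "\<bar>orbit_map T \<omega> j x0 - x0\<bar> = 2 * e" by (simp add: e_def)
      moreover have "\<delta> < e" using that by simp
      ultimately show "\<delta> \<le> \<bar>orbit_map T \<omega> j x - x0\<bar>" by linarith
    qed
    then show ?thesis
      using d(1) e unfolding eventually_at_right_field by (intro exI[of _ "min d e"]) auto
  qed simp
  have "\<forall>\<^sub>F \<delta> in at_right 0. \<forall>\<omega>\<in>\<Omega>. \<forall>j\<in>{..K}. ?P \<omega> j \<delta>"
    by (intro eventually_ball_finite fin ballI single finite_atMost)
  then have "\<forall>\<^sub>F \<delta> in at_right 0. (\<forall>\<omega>\<in>\<Omega>. \<forall>j\<in>{..K}. ?P \<omega> j \<delta>) \<and> (0::real) < \<delta>"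
    using eventually_at_right_less[of "0::real"] by (rule eventually_conj)
  then obtain \<delta> :: real where \<delta>: "\<forall>\<omega>\<in>\<Omega>. \<forall>j\<in>{..K}. ?P \<omega> j \<delta>" "0 < \<delta>"
    using eventually_happens'[OF trivial_limit_at_right_real] by blast
  show thesis
  proof (rule that[OF \<delta>(2)])
    fix \<omega> :: "int \<Rightarrow> 'q" and j x
    assume nr: "\<And>j. 1 \<le> j \<Longrightarrow> orbit_map T \<omega> j x0 \<noteq> x0" and j: "1 \<le> j" "j \<le> K" and x: "\<bar>x - x0\<bar> < \<delta>"
    let ?\<omega> = "restrict \<omega> {0..<int K}"
    have "orbit_map T \<omega> j = orbit_map T ?\<omega> j" using j by (intro orbit_map_cong) auto
    moreover have "?\<omega> \<in> \<Omega>" by (simp add: \<Omega>_def)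
    ultimately show "\<delta> \<le> \<bar>orbit_map T \<omega> j x - x0\<bar>" using \<delta>(1) nr[OF j(1)] j x by auto
  qed
qed

lemma mixing_maps_exists:
  assumes exp: "\<And>i. uniformly_expanding (T i) (A i)" and "cond_LY T" "cond_Min T" "cond_Dec T"
  shows "\<exists>M C \<theta> c. mixing_maps T M C \<theta> c"
proof -
  interpret nonsingular_maps T
    by (rule nonsingular_maps.intro)
      (rule uniformly_expanding_measurable[OF exp], rule uniformly_expanding_nonsingular[OF exp])
  obtain M where M1: "0 < M" and LY: "\<And>\<omega>. \<forall>f\<in>BV. BV_norm (transfer_op (T (\<omega> 0)) f) \<le> ennreal M * BV_norm f"
  proof -
    from assms(2) obtain r M D \<rho> where "0 < M"
      "\<forall>\<omega>. \<forall>f\<in>BV. BV_norm (transfer_op (T (\<omega> 0)) f) \<le> ennreal M * BV_norm f \<and>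
        Var (transfer_iter T \<omega> r f) \<le> ennreal \<rho> * Var f + ennreal D * L1_norm f"
      unfolding cond_LY_def by (elim exE bexE conjE) (rule that)
    then show thesis by (intro that) auto
  qed
  have M: "0 < M" "\<And>\<omega> f. f \<in> BV \<Longrightarrow> BV_norm (transfer_op (T (\<omega> 0)) f) \<le> ennreal M * BV_norm f"
    by (fact M1, rule bspec[OF LY])
  obtain C \<theta> where \<theta>: "0 < C" "\<theta> \<in> {0<..<1}"
    and Dec: "\<forall>n\<ge>1. \<forall>\<omega>. \<forall>f\<in>BV. (\<integral>x. f x \<partial>leb01) = 0 \<longrightarrow>
        BV_norm (transfer_iter T \<omega> n f) \<le> ennreal (C * \<theta> ^ n) * BV_norm f"
    using assms(4) unfolding cond_Dec_def by (elim exE bexE conjE) (rule that)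
  have C: "0 < C" "0 < \<theta>" "\<theta> < 1"
    "\<And>n \<omega> f. 1 \<le> n \<Longrightarrow> f \<in> BV \<Longrightarrow> (\<integral>x. f x \<partial>leb01) = 0 \<Longrightarrow>
        BV_norm (transfer_iter T \<omega> n f) \<le> ennreal (C * \<theta> ^ n) * BV_norm f"
    using \<theta> Dec by auto
  obtain c where "0 < c" "\<forall>n\<ge>1. \<forall>\<omega>. AE x in leb01. c \<le> transfer_iter T \<omega> n (\<lambda>_. 1) x"
    using assms(3) unfolding cond_Min_def by (elim exE conjE) (rule that)
  then have c: "0 < c" "\<And>n \<omega>. 1 \<le> n \<Longrightarrow> AE x in leb01. c \<le> transfer_iter T \<omega> n (\<lambda>_. 1) x"
    by simp_all
  \<comment> \<open>The norm of \<open>f\<close> is at most \<open>2 * K\<close>, and the strict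
    inequality demanded by \<open>bv_le_if_BV_norm\<close> raises 2 to 3.\<close>
  have norm: "bv_le (3 * D * K) g"
    if "bv_le K f" "0 < K" "0 < D" "integrable leb01 g" "BV_norm g \<le> ennreal D * BV_norm f" for D K f g
  proof (rule bv_le_if_BV_norm[OF that(4)])
    note that(5)
    also have "ennreal D * BV_norm f \<le> ennreal D * ennreal (2 * K)"
      by (intro mult_left_mono BV_norm_le that(1)) simp
    also have "\<dots> = ennreal (2 * D * K)" using that(2,3) by (simp add: ennreal_mult' mult_ac flip: ennreal_mult)
    also have "\<dots> < ennreal (3 * D * K)" using that(2,3) by (intro ennreal_lessI) auto
    finally show "BV_norm g < ennreal (3 * D * K)" .
  qed
  \<comment> \<open>The maximum with 1 covers \<open>decay\<close> at \<open>n = 0\<close>, where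
    the iterate is \<open>f\<close> itself.\<close>
  have "mixing_maps T (3 * M) (max 1 (3 * C)) \<theta> c"
  proof unfold_locales
    fix K f i assume f: "bv_le K f" "0 < K"
    show "bv_le (3 * M * K) (transfer_op (T i) f)"
      using M(1) M(2)[OF bv_le_BV[OF f(1)], of "\<lambda>_. i"] transfer_op_integrable[OF bv_le_integrable[OF f(1)]]
      by (intro norm[OF f]) auto
  next
    fix K f n \<omega> assume f: "bv_le K f" "0 < K" "(\<integral>x. f x \<partial>leb01) = 0"
    show "bv_le (max 1 (3 * C) * \<theta> ^ n * K) (transfer_iter T \<omega> n f)"
    proof (cases "n = 0")
      case True
      have "K \<le> max 1 (3 * C) * K" using f(2) by simp
      then show ?thesis using bv_le_mono[OF f(1)] True by simp
    next
      case False
      have "bv_le (3 * (C * \<theta> ^ n) * K) (transfer_iter T \<omega> n f)"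
        using C False f(3) bv_le_BV[OF f(1)] transfer_iter_integrable[OF bv_le_integrable[OF f(1)]]
        by (intro norm[OF f(1,2)] C(4)) auto
      moreover have "3 * C * (\<theta> ^ n * K) \<le> max 1 (3 * C) * (\<theta> ^ n * K)"
        using C f(2) by (intro mult_right_mono) auto
      then have "3 * (C * \<theta> ^ n) * K \<le> max 1 (3 * C) * \<theta> ^ n * K" by (simp only: mult.assoc)
      ultimately show ?thesis by (rule bv_le_mono)
    qed
  qed (use M C c in auto)
  then show ?thesis by blast
qed

theorem theorem6p1:
  fixes T :: "'q::finite \<Rightarrow> real \<Rightarrow> real"
    and \<A> :: "'q \<Rightarrow> real set set"
    and p :: "'q pmf"
    and \<alpha> x0 :: real
    and b :: "nat \<Rightarrow> real"
    and J :: "ereal set"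
    and A :: "nat \<Rightarrow> real set"
  assumes "\<And>i. uniformly_expanding (T i) (\<A> i)"
    and "cond_LY T" and "cond_Min T" and "cond_Dec T"
    and "0 < \<alpha>" and "\<alpha> < 2"
    and "x0 \<in> {0..1} - partition_endpoints T \<A>"
    and "nonrecurrent T p x0"
    and "\<And>n. 0 < b n"
    and "(\<lambda>n. real n * stationary_prob T p {x\<in>{0..1}. phi \<alpha> x0 x > ereal (b n)}) \<longlonglongrightarrow> 1"
    and "J \<in> J_family"
    and "\<And>n. A n = {x\<in>{0..1}. phi \<alpha> x0 x \<in> (\<lambda>y. ereal (b n) * y) ` J}"
  shows "AE \<omega> in bernoulli_measure p. \<forall>s t. 0 \<le> s \<and> s < t \<longrightarrow>
    (\<lambda>n. measure (sample_measure T (shift \<lfloor>real n * s\<rfloor> \<omega>))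
           {x\<in>{0..1}. hitting_time T (A n) (shift \<lfloor>real n * s\<rfloor> \<omega>) x
                          > enat (nat \<lfloor>real n * (t - s)\<rfloor>)})
      \<longlonglongrightarrow> exp (- (t - s) * measure (levy_measure \<alpha>) (ereal -` J))"
proof -
  obtain M C \<theta> c where "mixing_maps T M C \<theta> c"
    using mixing_maps_exists[OF assms(1-4)] by blast
  then interpret random_mixing_maps T M C \<theta> c p by (simp add: random_mixing_maps_def)
  note \<alpha> = assms(5) and b = assms(9)
  note x0 = partition_endpoints_interior[OF assms(7)]
  have A: "A n = scaled_level \<alpha> x0 (b n) J" for n by (simp add: assms(12) scaled_level_def)
  obtain a L where a: "0 < a" "\<forall>y\<in>J. 0 < y \<longrightarrow> ereal a < y" and L: "0 \<le> L"
    and lev: "\<And>b. 0 < b \<Longrightarrow> scaled_level \<alpha> x0 b J \<in> sets leb01"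
      "\<And>b. 0 < b \<Longrightarrow> variation_le L (indicator (scaled_level \<alpha> x0 b J))"
    using J_family_props[OF assms(11) \<alpha>, of x0] by metis
  have U: "A n \<in> sets leb01" "variation_le L (indicator (A n))" for n
    using lev[OF b] by (simp_all add: A)
  define R where "R = a powr (- \<alpha>)"
  have R: "0 < R" using a by (simp add: R_def)
  define r where "r n = R * b n powr (- \<alpha>)" for n
  have r: "0 < r n" for n using R b[of n] by (simp add: r_def)
  \<comment> \<open>A level set can have several components and a hole around \<open>x0\<close>.
    Returns are controlled for this ball instead, which contains the level set and is an
    interval.\<close>
  define B where "B n = {x\<in>{0..1}. \<bar>x - x0\<bar> < r n}" for n
  have Bint: "is_interval (B n)" for n
  proof -
    have "B n = {0..1} \<inter> {x0 - r n<..<x0 + r n}" by (auto simp: B_def)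
    then show ?thesis by (simp add: is_interval_Int)
  qed
  have B: "B n \<in> sets leb01" "variation_le 2 (indicator (B n))" for n
    by (rule interval_in_sets_leb01[OF Bint], force simp: B_def)
      (rule variation_le_indicator_interval[OF Bint])
  have sub: "A n \<subseteq> B n" for n
    using scaled_level_subset_ball[OF \<alpha> b a] by (simp add: A B_def r_def R_def)
  have b_le: "\<forall>\<^sub>F n in sequentially. b n powr (- \<alpha>) \<le> 1 / (c * real n)"
    and lim: "(\<lambda>n. real n * stationary_prob T p (A n)) \<longlonglongrightarrow> measure (levy_measure \<alpha>) (ereal -` J)"
    unfolding A by (rule stationary_asymptotics[OF \<alpha> x0 b assms(10,11)])+
  define \<beta> where "\<beta> = 2 * R / c"
  have \<beta>: "0 < \<beta>" using R c_pos by (simp add: \<beta>_def)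
  have small: "\<forall>\<^sub>F n in sequentially. 2 * r n \<le> \<beta> / real n"
    using b_le
  proof eventually_elim
    case (elim n)
    have "2 * R * b n powr (- \<alpha>) \<le> 2 * R * (1 / (c * real n))" using elim R by (intro mult_left_mono) auto
    then show ?case by (simp add: r_def \<beta>_def)
  qed
  have Bm: "measure leb01 (B n) \<le> 2 * r n" for n
    using B r[of n] by (intro measure_leb01_ball_le[of _ x0]) (auto simp: B_def)
  have smallB: "\<forall>\<^sub>F n in sequentially. measure leb01 (B n) \<le> \<beta> / real n"
    using small by eventually_elim (use Bm order_trans in blast)
  have smallA: "\<forall>\<^sub>F n in sequentially. measure leb01 (A n) \<le> \<beta> / real n"
    using smallB
  proof eventually_elim
    case (elim n)
    have "measure leb01 (A n) \<le> measure leb01 (B n)" using sub B by (intro leb01.finite_measure_mono) auto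
    then show ?case using elim by simp
  qed
  have r0: "r \<longlonglongrightarrow> 0"
  proof (rule tendsto_sandwich[OF _ _ tendsto_const])
    show "(\<lambda>n. \<beta> / real n) \<longlonglongrightarrow> 0" by real_asymp
    show "\<forall>\<^sub>F n in sequentially. 0 \<le> r n" by (intro always_eventually allI less_imp_le r)
    show "\<forall>\<^sub>F n in sequentially. r n \<le> \<beta> / real n"
      using small by eventually_elim (use r in \<open>smt (verit)\<close>)
  qed
  have cont: "isCont (orbit_map T \<omega> n) x0" for \<omega> n by (rule isCont_orbit_map[OF assms(1,7)])
  \<comment> \<open>Each time along the orbit can be the start of an early return, so non-recurrence
    is required at every shift of \<omega>; shift invariance and countability give it for all
    \<open>k\<close> together.\<close>
  have "AE \<omega> in \<P>. \<forall>j\<ge>1. orbit_map T (shift (int k) \<omega>) j x0 \<noteq> x0" for k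
    using AE_shift[OF assms(8)[unfolded nonrecurrent_def]] .
  then have "AE \<omega> in \<P>. \<forall>k. \<forall>j\<ge>1. orbit_map T (shift (int k) \<omega>) j x0 \<noteq> x0"
    by (rule_tac AE_all_countable[THEN iffD2, OF allI])
  with stationary_concentration[OF U(1) smallA \<beta>] show ?thesis
  proof eventually_elim
    case (elim \<omega>)
    have ret: "\<forall>\<^sub>F n in sequentially. \<forall>k x j. x \<in> B n \<longrightarrow> 1 \<le> j \<longrightarrow> j \<le> K \<longrightarrow>
      orbit_map T (shift (int k) \<omega>) j x \<notin> B n" for K
    proof -
      obtain \<delta> where \<delta>: "0 < \<delta>" "\<And>\<omega> j x. (\<And>j. 1 \<le> j \<Longrightarrow> orbit_map T \<omega> j x0 \<noteq> x0) \<Longrightarrow> 1 \<le> j \<Longrightarrow> j \<le> K \<Longrightarrow>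
        \<bar>x - x0\<bar> < \<delta> \<Longrightarrow> \<delta> \<le> \<bar>orbit_map T \<omega> j x - x0\<bar>"
        using no_short_returns[OF cont, of K] by blast
      have "\<forall>\<^sub>F n in sequentially. r n < \<delta>" using order_tendstoD(2)[OF r0 \<delta>(1)] .
      then show ?thesis
      proof eventually_elim
        case (elim n)
        show ?case
        proof (intro allI impI notI)
          fix k x j assume x: "x \<in> B n" "1 \<le> j" "j \<le> K" "orbit_map T (shift (int k) \<omega>) j x \<in> B n"
          have "\<bar>x - x0\<bar> < \<delta>" using x(1) elim by (simp add: B_def)
          then have "\<delta> \<le> \<bar>orbit_map T (shift (int k) \<omega>) j x - x0\<bar>"
            using x \<open>\<forall>k. \<forall>j\<ge>1. orbit_map T (shift (int k) \<omega>) j x0 \<noteq> x0\<close> by (intro \<delta>(2)) auto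
          then show False using x(4) elim by (simp add: B_def)
        qed
      qed
    qed
    show ?case
    proof (intro allI impI)
      fix s t :: real assume st: "0 \<le> s \<and> s < t"
      show "(\<lambda>n. measure (\<nu> (shift \<lfloor>real n * s\<rfloor> \<omega>))
           {x\<in>{0..1}. hitting_time T (A n) (shift \<lfloor>real n * s\<rfloor> \<omega>) x > enat (nat \<lfloor>real n * (t - s)\<rfloor>)})
        \<longlonglongrightarrow> exp (- (t - s) * measure (levy_measure \<alpha>) (ereal -` J))"
        unfolding hitting_time_survive
      proof (rule survive_limit[OF U(2,1) L B(2,1) sub smallB \<beta> _ lim ret])
        show "\<forall>\<^sub>F n in sequentially. \<forall>N \<le> m * n.
          \<bar>(\<Sum>k<N. measure (\<nu> (shift (int (Suc k)) \<omega>)) (A n)) - real N * stationary_prob T p (A n)\<bar> < \<epsilon>"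
          if "0 < \<epsilon>" for m \<epsilon>
          using elim(1) that by blast
      qed (use st in auto)
    qed
  qed
qed

end
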